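(* Let $\alpha\ge-\frac12$, $1\le p\le2$, $\frac1p+\frac1{p'}=1$, and let $K\subset L_{p,\alpha}$. Let $\hat K=\{H_\alpha(f): f\in K\}\subset L_{p',\alpha}$ be the set of Hankel transforms of the functions in $K$. If $K$ is bounded and satisfies $\mathbf{P_A}$ in $L_{p,\alpha}$, then $\hat K$ satisfies $\mathbf{P_B}$ in $L_{p',\alpha}$. If $K$ satisfies $\mathbf{P_B}$ in $L_{p,\alpha}$, then $\hat K$ satisfies $\mathbf{P_A}$ in $L_{p',\alpha}$. The properties $\mathbf{P_A}$ and $\mathbf{P_B}$ are those defined in the context.
   Context: For $\alpha\ge-\frac12$ and $1\le q<\infty$, $L_{q,\alpha}$ is the space of measurable (real- or complex-valued) functions on $\mathbb{R}_+$ with finite norm $\|f\|_{q,(\alpha)}=\left(\int_0^\infty|f(x)|^qx^{2\alpha+1}dx\right)^{1/q}$; for $q=\infty$, $\|f\|_{\infty,(\alpha)}$ is the essential supremum of $|f|$ on $\mathbb{R}_+$. The Bessel translation is, for $t,s\ge0$, $$T_{t,\alpha}f(s)=\int_0^\pi f\left(\sqrt{t^2+s^2-2st\cos\varphi}\right)d\mu(\varphi),\qquad d\mu(\varphi)=\left(\int_0^\pi\sin^{2\alpha}\theta\,d\theta\right)^{-1}\sin^{2\alpha}\varphi\,d\varphi;$$ for $\alpha=-\frac12$ the probability measure $\mu$ is understood as its weak limit $\frac12(\delta_0+\delta_\pi)$, i.e. $T_{t,-1/2}f(s)=\frac12\left(f(s+t)+f(|s-t|)\right)$. The entire Bessel function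 is $j_\alpha(z)=\sum_{k=0}^\infty\frac{(-1)^k\Gamma(\alpha+1)}{\Gamma(k+1)\Gamma(k+\alpha+1)}\left(\frac z2\right)^{2k}$. The Hankel (Bessel-Fourier) transform is $$H_\alpha(f)(y)=\hat f(y)=c_\alpha\int_0^\infty f(x)j_\alpha(xy)x^{2\alpha+1}dx,\qquad c_\alpha=\frac{1}{2^\alpha\Gamma(\alpha+1)},$$ extended by continuity to a bounded operator $L_{p,\alpha}\to L_{p',\alpha}$ for $1\le p\le2$ (Hausdorff-Young inequality). For a set $K\subset L_{q,\alpha}$, $1\le q\le\infty$ (with the $L_{q,\alpha}$ integrals replaced by essential suprema when $q=\infty$): $\mathbf{P_A}$ in $L_{q,\alpha}$: for every $\varepsilon>0$ there is $R>0$ such that $\left(\int_R^\infty|f(x)|^qx^{2\alpha+1}dx\right)^{1/q}<\varepsilon$ for all $f\in K$. $\mathbf{P_B}$ in $L_{q,\alpha}$: for every $\varepsilon>0$ and every $M_0>0$ there is $\delta>0$ such that for all $0\le h\le\delta$, $f\in K$ and $t\in[0,M_0]$, $\left(\int_0^\infty|T_{t+h,\alpha}f(s)-T_{t,\alpha}f(s)|^qs^{2\alpha+1}ds\right)^{1/q}<\varepsilon$. *)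

theory Defs
  imports "HOL-Analysis.Analysis" "HOL-Probability.Essential_Supremum"
begin

text \<open>
  Functions on the half-line are represented by functions \<^typ>\<open>real \<Rightarrow> complex\<close> whose values at
  negative arguments play no role. Elements of the weighted Lebesgue spaces are individual functions
  (not almost-everywhere classes), measurable in the sense of Lebesgue.
\<close>

definition bessel_measure :: "real \<Rightarrow> real measure" where
  "bessel_measure \<alpha> = density (lebesgue_on {0..}) (\<lambda>x. ennreal (x powr (2 * \<alpha> + 1)))"

text \<open>
  The norm takes values in \<^typ>\<open>ennreal\<close>, so that it is infinite, rather than zero, when the
  integral diverges. The exponent ranges over \<open>1 \<le> q \<le> \<infinity>\<close>.
\<close>

definition bnorm :: "ennreal \<Rightarrow> real \<Rightarrow> (real \<Rightarrow> complex) \<Rightarrow> ennreal" where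
  "bnorm q \<alpha> f =
     (if q = \<infinity> then esssup (bessel_measure \<alpha>) (\<lambda>x. ennreal (cmod (f x)))
      else let I = (\<integral>\<^sup>+x. ennreal (cmod (f x) powr enn2real q) \<partial>bessel_measure \<alpha>)
           in if I = \<infinity> then \<infinity> else ennreal (enn2real I powr (1 / enn2real q)))"

definition bspace :: "ennreal \<Rightarrow> real \<Rightarrow> (real \<Rightarrow> complex) set" where
  "bspace q \<alpha> = {f \<in> borel_measurable (bessel_measure \<alpha>). bnorm q \<alpha> f < \<infinity>}"

definition bbounded :: "ennreal \<Rightarrow> real \<Rightarrow> (real \<Rightarrow> complex) set \<Rightarrow> bool" where
  "bbounded q \<alpha> K \<longleftrightarrow> (\<exists>C::real. \<forall>f\<in>K. bnorm q \<alpha> f \<le> ennreal C)"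

definition bessel_translation ::
    "real \<Rightarrow> real \<Rightarrow> (real \<Rightarrow> complex) \<Rightarrow> real \<Rightarrow> complex" where
  "bessel_translation \<alpha> t f s =
     (if \<alpha> = - 1 / 2 then (f (s + t) + f \<bar>s - t\<bar>) / 2
      else (LINT \<phi>:{0..pi}|lebesgue.
              f (sqrt (t\<^sup>2 + s\<^sup>2 - 2 * s * t * cos \<phi>)) * of_real (sin \<phi> powr (2 * \<alpha>)))
           / of_real (LINT \<theta>:{0..pi}|lebesgue. sin \<theta> powr (2 * \<alpha>)))"

definition bessel_j :: "real \<Rightarrow> complex \<Rightarrow> complex" where
  "bessel_j \<alpha> z =
     (\<Sum>k. of_real ((- 1) ^ k * Gamma (\<alpha> + 1) / (Gamma (real k + 1) * Gamma (real k + \<alpha> + 1)))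
           * (z / 2) ^ (2 * k))"

definition hankel_integral :: "real \<Rightarrow> (real \<Rightarrow> complex) \<Rightarrow> real \<Rightarrow> complex" where
  "hankel_integral \<alpha> f y =
     of_real (1 / (2 powr \<alpha> * Gamma (\<alpha> + 1)))
     * (LINT x|bessel_measure \<alpha>. f x * bessel_j \<alpha> (of_real (x * y)))"

text \<open>
  Extension by continuity: \<open>g\<close> is the limit in the \<open>p'\<close>-norm of the integral transforms of \<open>\<phi>\<close>,
  as \<open>\<phi>\<close> tends to \<open>f\<close> in the \<open>p\<close>-norm inside the dense subspace of functions lying in both the
  \<open>1\<close>-space and the \<open>p\<close>-space. Such a \<open>g\<close> is determined only up to null sets; the operator
  selects one representative.
\<close>

definition is_hankel_transform ::
    "ennreal \<Rightarrow> ennreal \<Rightarrow> real \<Rightarrow> (real \<Rightarrow> complex) \<Rightarrow> (real \<Rightarrow> complex) \<Rightarrow> bool" where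
  "is_hankel_transform p p' \<alpha> f g \<longleftrightarrow>
     g \<in> bspace p' \<alpha> \<and>
     (\<forall>\<epsilon>>0. \<exists>\<delta>>0. \<forall>\<phi> \<in> bspace 1 \<alpha> \<inter> bspace p \<alpha>.
        bnorm p \<alpha> (\<lambda>x. \<phi> x - f x) < ennreal \<delta> \<longrightarrow>
        bnorm p' \<alpha> (\<lambda>y. hankel_integral \<alpha> \<phi> y - g y) < ennreal \<epsilon>)"

definition hankel ::
    "ennreal \<Rightarrow> ennreal \<Rightarrow> real \<Rightarrow> (real \<Rightarrow> complex) \<Rightarrow> (real \<Rightarrow> complex)" where
  "hankel p p' \<alpha> f = (SOME g. is_hankel_transform p p' \<alpha> f g)"

definition P_A :: "ennreal \<Rightarrow> real \<Rightarrow> (real \<Rightarrow> complex) set \<Rightarrow> bool" where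
  "P_A q \<alpha> K \<longleftrightarrow>
     (\<forall>\<epsilon>::real>0. \<exists>R::real>0. \<forall>f\<in>K. bnorm q \<alpha> (\<lambda>x. indicator {R..} x * f x) < ennreal \<epsilon>)"

definition P_B :: "ennreal \<Rightarrow> real \<Rightarrow> (real \<Rightarrow> complex) set \<Rightarrow> bool" where
  "P_B q \<alpha> K \<longleftrightarrow>
     (\<forall>\<epsilon>::real>0. \<forall>M\<^sub>0::real>0. \<exists>\<delta>>0. \<forall>h\<in>{0..\<delta>}. \<forall>f\<in>K. \<forall>t\<in>{0..M\<^sub>0}.
        bnorm q \<alpha> (\<lambda>s. bessel_translation \<alpha> (t + h) f s - bessel_translation \<alpha> t f s)
          < ennreal \<epsilon>)"

end

theory Submission
  imports Defs "HOL-Probability.Probability_Measure"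
begin

text \<open>
  The Hankel transform \<open>H\<close> turns Bessel translation into multiplication and conversely: with \<open>T\<^sub>t\<close> for
  the translation and \<open>j\<close> for the Bessel function,
  \<open>T\<^sub>t (H f) = H (j (t \<cdot>) f)\<close> and \<open>H (T\<^sub>h f) = j (h \<cdot>) (H f)\<close>. Both relations come from the product formula
  \<open>T\<^sub>t j = j(t) j\<close> (\<open>poisson_j_product\<close>), the second one also from the self-adjointness of \<open>T\<^sub>h\<close>
  (\<open>translate_self_adjoint\<close>). Together with the Hausdorff--Young bound for \<open>H\<close> they reduce the two
  implications to statements about multipliers.

  \<^item> If \<open>K\<close> is bounded and has uniformly small tails, then \<open>T\<^bsub>t+h\<^esub> (H f) - T\<^sub>t (H f)\<close> is the transform of
    \<open>(j((t + h) x) - j(t x)) f(x)\<close>. The factor is at most \<open>h x\<close>, since \<open>j\<close> is Lipschitz, and is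
    bounded, since \<open>j\<close> is; so this function is small on \<open>x < R\<close> because of \<open>h\<close> and on \<open>x \<ge> R\<close> because of
    \<open>f\<close>.

  \<^item> If \<open>K\<close> is equicontinuous, then taking \<open>t = 0\<close> shows that \<open>(1 - j(h y)) H f(y)\<close>, the transform of
    \<open>f - T\<^sub>h f\<close>, is small in norm for all \<open>0 \<le> h \<le> \<delta>\<close>. Averaging over these \<open>h\<close> replaces the factor by
    one which is bounded below for \<open>y \<ge> 1 / \<delta>\<close>, and so bounds the tail of \<open>H f\<close> (\<open>bnorm_tail_le\<close>).

  The harmonic analysis behind this is built on a probability measure for the angle which for
  \<open>\<alpha> = - 1 / 2\<close> is concentrated at \<open>0\<close> and \<open>\<pi>\<close>. Its moments yield Poisson's integral for \<open>j\<close> and, by the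
  Chu--Vandermonde identity, the product formula. The translation by \<open>t\<close> has a kernel that is
  symmetric in the two radii \<open>s\<close> and \<open>r\<close>, because for \<open>\<alpha> > - 1 / 2\<close> it is, with respect to \<open>ds dr\<close>, the
  product of \<open>s r\<close> with a function of \<open>t\<close> and of the area of the triangle with sides \<open>s\<close>, \<open>t\<close>, \<open>r\<close>. This makes
  the translation self-adjoint and a contraction in all the norms. Boundedness of \<open>H\<close> between the
  spaces of square integrable functions follows by Schur's test from the explicit heat kernel
  (\<open>radial_hankel_L2\<close>), and the Hausdorff--Young inequality, with some constant, by interpolation
  with the trivial bound (\<open>radial_hausdorff_young\<close>). Finally \<open>H\<close> is extended by continuity
  (\<open>hankel_transform_exists\<close>), and the intertwining relations pass to the extension in the form
  of norm inequalities (\<open>hankel_intertwining_bound\<close>).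
\<close>


section \<open>The angular probability measure\<close>

text \<open>
  With the weak limit at \<open>\<alpha> = - 1 / 2\<close> as part of the definition, one formula gives the translation
  for all \<open>\<alpha>\<close>, and cases are distinguished only where integrals over the angle are computed.
\<close>

definition angle_mass :: "real \<Rightarrow> real" where
  "angle_mass \<alpha> = (LBINT \<theta>:{0..pi}. sin \<theta> powr (2 * \<alpha>))"

definition angle_measure :: "real \<Rightarrow> real measure" where
  "angle_measure \<alpha> =
     (if \<alpha> = - 1 / 2 then distr (uniform_count_measure {0, pi}) borel (\<lambda>\<phi>. \<phi>)
      else density lborel (\<lambda>\<phi>. ennreal (indicator {0..pi} \<phi> * sin \<phi> powr (2 * \<alpha>) / angle_mass \<alpha>)))"

lemma sets_angle_measure [simp, measurable_cong]: "sets (angle_measure \<alpha>) = sets borel"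
  by (simp add: angle_measure_def)

lemma space_angle_measure [simp]: "space (angle_measure \<alpha>) = UNIV"
  by (simp add: angle_measure_def)

text \<open>
  The integrand is the derivative of \<open>cos \<phi> ^ n * sin \<phi> powr (a + 1)\<close>, which vanishes at both ends. This
  identity yields both the integrability of the density, which is singular for \<open>a < 0\<close>, and
  the recurrence of its moments.
\<close>

lemma sin_powr_moment_derivative:
  fixes a :: real
  assumes "a > - 1"
  shows "((\<lambda>\<phi>. (a + 1) * (cos \<phi> ^ (n + 1) * sin \<phi> powr a) - n * (cos \<phi> ^ (n - 1) * sin \<phi> powr (a + 2)))
            has_integral 0) {0..pi}"
proof -
  have "((\<lambda>\<phi>. (a + 1) * (cos \<phi> ^ (n + 1) * sin \<phi> powr a) - n * (cos \<phi> ^ (n - 1) * sin \<phi> powr (a + 2)))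
            has_integral (cos pi ^ n * sin pi powr (a + 1) - cos 0 ^ n * sin 0 powr (a + 1))) {0..pi}"
  proof (rule fundamental_theorem_of_calculus_interior)
    show "continuous_on {0..pi} (\<lambda>\<phi>. cos \<phi> ^ n * sin \<phi> powr (a + 1))"
      using assms by (intro continuous_on_mult continuous_on_powr' continuous_intros) (auto intro: sin_ge_zero)
  next
    fix x :: real assume x: "x \<in> {0<..<pi}"
    then have s: "sin x > 0" by (auto intro: sin_gt_zero)
    have e: "sin x powr (a + 2) = sin x powr a * sin x * sin x" "sin x powr (a + 1) = sin x powr a * sin x"
      using s by (simp_all add: powr_add power2_eq_square)
    have "((\<lambda>\<phi>. cos \<phi> ^ n * sin \<phi> powr (a + 1)) has_field_derivative
        (a + 1) * (cos x ^ (n + 1) * sin x powr a) - n * (cos x ^ (n - 1) * sin x powr (a + 2))) (at x)"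
      using s
      by (auto intro!: derivative_eq_intros simp: e)
    then show "((\<lambda>\<phi>. cos \<phi> ^ n * sin \<phi> powr (a + 1)) has_vector_derivative
        (a + 1) * (cos x ^ (n + 1) * sin x powr a) - n * (cos x ^ (n - 1) * sin x powr (a + 2))) (at x)"
      by (simp add: has_real_derivative_iff_has_vector_derivative)
  qed simp
  then show ?thesis by simp
qed

text \<open>
  Writing \<open>sin \<phi> powr a\<close> in terms of the derivative above and of the continuous \<open>sin \<phi> powr (a + 2)\<close> shows
  integrability without an estimate at the end points.
\<close>

lemma sin_powr_set_integrable:
  fixes a :: real
  assumes "a > - 1"
  shows "set_integrable lborel {0..pi} (\<lambda>\<phi>. sin \<phi> powr a)"
proof -
  define P where "P \<phi> = (a + 1) * (cos \<phi> ^ 2 * sin \<phi> powr a) - 1 * (cos \<phi> ^ 0 * sin \<phi> powr (a + 2))" for \<phi>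
  have P: "P integrable_on {0..pi}"
    using sin_powr_moment_derivative[OF assms, of 1] by (auto simp: P_def[abs_def] power2_eq_square integrable_on_def)
  have c: "(\<lambda>\<phi>. sin \<phi> powr (a + 2)) integrable_on {0..pi}"
    using assms by (intro integrable_continuous_real continuous_on_powr' continuous_intros) (auto intro: sin_ge_zero)
  have e: "sin \<phi> powr a = (P \<phi> + (a + 2) * sin \<phi> powr (a + 2)) / (a + 1)" if "\<phi> \<in> {0..pi}" for \<phi>
  proof (cases "sin \<phi> = 0")
    case False
    with that have s: "sin \<phi> > 0" using sin_ge_zero[of \<phi>] by auto
    then have "sin \<phi> powr (a + 2) = sin \<phi> powr a * sin \<phi> ^ 2" by (simp add: powr_add)
    then show ?thesis using assms
      by (simp add: P_def cos_squared_eq field_simps)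
  qed (simp add: P_def)
  have "(\<lambda>\<phi>. sin \<phi> powr a) integrable_on {0..pi}"
    by (subst integrable_cong[OF e]) (use integrable_on_divide[OF integrable_add[OF P integrable_on_cmult_left[OF c, of "a+2"]]] in auto)
  then have "(\<lambda>\<phi>. sin \<phi> powr a) absolutely_integrable_on {0..pi}"
    by (intro nonnegative_absolutely_integrable_1) auto
  then show ?thesis
    by (simp add: set_integrable_def integrable_completion)
qed

lemma angle_mass_pos:
  assumes "\<alpha> > - 1 / 2"
  shows "angle_mass \<alpha> > 0"
proof -
  have i: "set_integrable lborel {0..pi} (\<lambda>\<phi>. sin \<phi> powr (2 * \<alpha>))"
    using assms by (intro sin_powr_set_integrable) simp
  have "angle_mass \<alpha> \<noteq> 0"
  proof
    assume "angle_mass \<alpha> = 0"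
    then have "AE \<phi> in lborel. indicator {0..pi} \<phi> * sin \<phi> powr (2 * \<alpha>) = 0"
      using i unfolding angle_mass_def set_lebesgue_integral_def set_integrable_def
      by (subst (asm) integral_nonneg_eq_0_iff_AE) auto
    then have "AE \<phi> in lborel. \<phi> \<notin> {0<..<pi}"
      by eventually_elim (auto simp: sin_gt_zero dest: sin_gt_zero)
    then have "{0<..<pi} \<in> null_sets lborel"
      by (subst (asm) AE_iff_null_sets[symmetric]) auto
    then show False by (auto simp: null_sets_def)
  qed
  moreover have "angle_mass \<alpha> \<ge> 0"
    unfolding angle_mass_def set_lebesgue_integral_def by (intro integral_nonneg_AE) auto
  ultimately show ?thesis by simp
qed

lemma nn_integral_angle_measure:
  assumes "\<alpha> > - 1 / 2" and [measurable]: "f \<in> borel_measurable borel"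
  shows "(\<integral>\<^sup>+\<phi>. f \<phi> \<partial>angle_measure \<alpha>) =
    (\<integral>\<^sup>+\<phi>. ennreal (indicator {0..pi} \<phi> * sin \<phi> powr (2 * \<alpha>) / angle_mass \<alpha>) * f \<phi> \<partial>lborel)"
  using assms(1) by (simp add: angle_measure_def nn_integral_density)

lemma nn_integral_angle_measure_half:
  assumes [measurable]: "f \<in> borel_measurable borel"
  shows "(\<integral>\<^sup>+\<phi>. f \<phi> \<partial>angle_measure (- (1 / 2))) = (f 0 + f pi) / 2"
proof -
  have m: "(\<lambda>x. x) \<in> uniform_count_measure {0, pi} \<rightarrow>\<^sub>M borel"
    by (simp add: measurable_def)
  have h: "ennreal (1 / 2) = inverse 2"
    by (metis ennreal_numeral inverse_eq_divide inverse_ennreal zero_less_numeral)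
  have "(\<integral>\<^sup>+\<phi>. f \<phi> \<partial>angle_measure (- (1 / 2))) = (\<integral>\<^sup>+\<phi>. f \<phi> \<partial>uniform_count_measure {0, pi})"
    by (simp add: angle_measure_def nn_integral_distr[OF m])
  also have "\<dots> = (f 0 + f pi) / 2"
    unfolding uniform_count_measure_def
    by (subst nn_integral_point_measure_finite) (auto simp: divide_ennreal_def h distrib_left mult.commute)
  finally show ?thesis .
qed

lemma integral_angle_measure:
  fixes f :: "real \<Rightarrow> 'a :: {banach, second_countable_topology}"
  assumes "\<alpha> > - 1 / 2" and [measurable]: "f \<in> borel_measurable borel"
  shows "(\<integral>\<phi>. f \<phi> \<partial>angle_measure \<alpha>) =
    (LBINT \<phi>:{0..pi}. (sin \<phi> powr (2 * \<alpha>) / angle_mass \<alpha>) *\<^sub>R f \<phi>)"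
proof -
  have "(\<integral>\<phi>. f \<phi> \<partial>angle_measure \<alpha>) =
    (\<integral>\<phi>. (indicator {0..pi} \<phi> * sin \<phi> powr (2 * \<alpha>) / angle_mass \<alpha>) *\<^sub>R f \<phi> \<partial>lborel)"
    using assms(1) angle_mass_pos[OF assms(1)]
    by (simp add: angle_measure_def integral_density)
  then show ?thesis
    by (simp add: set_lebesgue_integral_def mult.assoc divide_inverse)
qed

lemma integral_angle_measure_half:
  fixes f :: "real \<Rightarrow> 'a :: {banach, second_countable_topology}"
  assumes [measurable]: "f \<in> borel_measurable borel"
  shows "(\<integral>\<phi>. f \<phi> \<partial>angle_measure (- (1 / 2))) = (f 0 + f pi) /\<^sub>R 2"
proof -
  have m: "(\<lambda>x. x) \<in> uniform_count_measure {0, pi} \<rightarrow>\<^sub>M borel"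
    by (simp add: measurable_def)
  have "(\<integral>\<phi>. f \<phi> \<partial>angle_measure (- (1 / 2))) = (\<integral>\<phi>. f \<phi> \<partial>uniform_count_measure {0, pi})"
    by (simp add: angle_measure_def integral_distr[OF m])
  also have "\<dots> = (f 0 + f pi) /\<^sub>R 2"
    unfolding uniform_count_measure_def
    by (subst lebesgue_integral_point_measure_finite) (auto simp: scaleR_add_right)
  finally show ?thesis .
qed

lemma prob_space_angle_measure:
  assumes "\<alpha> \<ge> - 1 / 2"
  shows "prob_space (angle_measure \<alpha>)"
proof (cases "\<alpha> = - 1 / 2")
  case True
  have "emeasure (angle_measure (- (1 / 2))) UNIV = (\<integral>\<^sup>+\<phi>. 1 \<partial>angle_measure (- (1 / 2)))"
    by simp
  also have "\<dots> = (1 + 1) / 2" by (rule nn_integral_angle_measure_half) simp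
  finally show ?thesis using True by (intro prob_spaceI) (simp add: one_add_one)
next
  case False
  with assms have a: "\<alpha> > - 1 / 2" by simp
  have i: "integrable lborel (\<lambda>\<phi>. indicator {0..pi} \<phi> * sin \<phi> powr (2 * \<alpha>))"
    using a sin_powr_set_integrable[of "2 * \<alpha>"] by (simp add: set_integrable_def)
  have "emeasure (angle_measure \<alpha>) UNIV = (\<integral>\<^sup>+\<phi>. 1 \<partial>angle_measure \<alpha>)"
    by simp
  also have "\<dots> = (\<integral>\<^sup>+\<phi>. ennreal (indicator {0..pi} \<phi> * sin \<phi> powr (2 * \<alpha>) / angle_mass \<alpha>) \<partial>lborel)"
    by (subst nn_integral_angle_measure[OF a]) auto
  also have "\<dots> = ennreal (\<integral>\<phi>. indicator {0..pi} \<phi> * sin \<phi> powr (2 * \<alpha>) / angle_mass \<alpha> \<partial>lborel)"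
    using i angle_mass_pos[OF a] by (intro nn_integral_eq_integral) auto
  also have "(\<integral>\<phi>. indicator {0..pi} \<phi> * sin \<phi> powr (2 * \<alpha>) / angle_mass \<alpha> \<partial>lborel) = 1"
    using angle_mass_pos[OF a] by (simp add: angle_mass_def set_lebesgue_integral_def)
  finally show ?thesis by (intro prob_spaceI) simp
qed

lemma measure_angle_measure:
  assumes "\<alpha> \<ge> - 1 / 2"
  shows "measure (angle_measure \<alpha>) UNIV = 1"
  using prob_space.prob_space[OF prob_space_angle_measure[OF assms]] by simp

lemma integrable_angle_measure:
  fixes f :: "real \<Rightarrow> 'a :: {banach, second_countable_topology}"
  assumes "\<alpha> \<ge> - 1 / 2" and [measurable]: "f \<in> borel_measurable borel" and "\<And>\<phi>. norm (f \<phi>) \<le> B"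
  shows "integrable (angle_measure \<alpha>) f"
proof -
  interpret prob_space "angle_measure \<alpha>" using assms(1) by (rule prob_space_angle_measure)
  show ?thesis using assms(3) by (intro integrable_const_bound[of _ B]) auto
qed

section \<open>Moments and the Bessel function\<close>

definition cos_moment :: "real \<Rightarrow> nat \<Rightarrow> real" where
  "cos_moment \<alpha> n = (\<integral>\<phi>. cos \<phi> ^ n \<partial>angle_measure \<alpha>)"

lemma cos_power_le_one: "\<bar>cos x ^ n\<bar> \<le> (1::real)"
  by (simp add: power_abs power_le_one)

lemma cos_moment_0: "\<alpha> \<ge> - 1 / 2 \<Longrightarrow> cos_moment \<alpha> 0 = 1"
  using prob_space.prob_space[OF prob_space_angle_measure[of \<alpha>]] by (simp add: cos_moment_def)

lemma cos_moment_has_integral: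
  assumes a: "\<alpha> > - 1 / 2"
  shows "((\<lambda>\<phi>. cos \<phi> ^ n * sin \<phi> powr (2 * \<alpha>)) has_integral (angle_mass \<alpha> * cos_moment \<alpha> n)) {0..pi}"
proof -
  have i: "set_integrable lborel {0..pi} (\<lambda>\<phi>. cos \<phi> ^ n * sin \<phi> powr (2 * \<alpha>))"
  proof (rule set_integrable_bound[OF sin_powr_set_integrable[of "2 * \<alpha>"]])
    show "AE x in lborel. x \<in> {0..pi} \<longrightarrow>
        norm (cos x ^ n * sin x powr (2 * \<alpha>)) \<le> norm (sin x powr (2 * \<alpha>))"
      by (simp add: abs_mult mult_left_le_one_le cos_power_le_one)
  qed (use a in \<open>auto simp: set_borel_measurable_def\<close>)
  have "angle_mass \<alpha> * cos_moment \<alpha> n =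
      angle_mass \<alpha> * (LBINT \<phi>:{0..pi}. cos \<phi> ^ n * sin \<phi> powr (2 * \<alpha>) / angle_mass \<alpha>)"
    unfolding cos_moment_def by (subst integral_angle_measure[OF a]) (auto simp: mult.commute)
  also have "\<dots> = (LBINT \<phi>:{0..pi}. cos \<phi> ^ n * sin \<phi> powr (2 * \<alpha>))"
    using angle_mass_pos[OF a] by (subst set_integral_divide_zero) auto
  finally show ?thesis
    using set_borel_integral_eq_integral[OF i] by (simp add: has_integral_iff)
qed

text \<open>
  For \<open>\<alpha> = - 1 / 2\<close> the moments are computed at the two atoms. There the instance \<open>n = 0\<close> reads
  \<open>0 = 0\<close>, so the vanishing of the first moment is a separate lemma.
\<close>

lemma cos_moment_rec:
  assumes "\<alpha> \<ge> - 1 / 2"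
  shows "(2 * \<alpha> + 1 + real n) * cos_moment \<alpha> (n + 1) = real n * cos_moment \<alpha> (n - 1)"
proof (cases "\<alpha> = - 1 / 2")
  case True
  have m: "cos_moment (- (1 / 2)) k = (1 + (- 1) ^ k) / 2" for k
    using integral_angle_measure_half[of "\<lambda>\<phi>. cos \<phi> ^ k"] by (simp add: cos_moment_def)
  show ?thesis using True by (cases n) (auto simp: m)
next
  case False
  with assms have a: "\<alpha> > - 1 / 2" by simp
  have "((\<lambda>\<phi>. (2 * \<alpha> + 1 + n) * (cos \<phi> ^ (n + 1) * sin \<phi> powr (2 * \<alpha>)) -
            n * (cos \<phi> ^ (n - 1) * sin \<phi> powr (2 * \<alpha>)))
          has_integral ((2 * \<alpha> + 1 + n) * (angle_mass \<alpha> * cos_moment \<alpha> (n + 1)) -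
            n * (angle_mass \<alpha> * cos_moment \<alpha> (n - 1)))) {0..pi}"
    by (intro has_integral_diff has_integral_mult_right cos_moment_has_integral a)
  moreover have "((\<lambda>\<phi>. (2 * \<alpha> + 1 + n) * (cos \<phi> ^ (n + 1) * sin \<phi> powr (2 * \<alpha>)) -
            n * (cos \<phi> ^ (n - 1) * sin \<phi> powr (2 * \<alpha>))) has_integral 0) {0..pi}"
  proof (rule has_integral_eq[OF _ sin_powr_moment_derivative[of "2 * \<alpha>" n]])
    fix \<phi> assume \<phi>: "\<phi> \<in> {0..pi}"
    show "(2 * \<alpha> + 1) * (cos \<phi> ^ (n + 1) * sin \<phi> powr (2 * \<alpha>)) -
        n * (cos \<phi> ^ (n - 1) * sin \<phi> powr (2 * \<alpha> + 2)) =
      (2 * \<alpha> + 1 + n) * (cos \<phi> ^ (n + 1) * sin \<phi> powr (2 * \<alpha>)) -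
        n * (cos \<phi> ^ (n - 1) * sin \<phi> powr (2 * \<alpha>))"
    proof (cases "sin \<phi> = 0")
      case False
      with \<phi> have s: "sin \<phi> > 0" using sin_ge_zero[of \<phi>] by auto
      then have e: "sin \<phi> powr (2 * \<alpha> + 2) = sin \<phi> powr (2 * \<alpha>) * (1 - cos \<phi> ^ 2)"
        by (simp add: powr_add sin_squared_eq)
      show ?thesis
        unfolding e by (cases n) (simp_all add: algebra_simps power2_eq_square)
    qed simp
  qed (use a in simp)
  ultimately have "(2 * \<alpha> + 1 + n) * (angle_mass \<alpha> * cos_moment \<alpha> (n + 1)) -
            n * (angle_mass \<alpha> * cos_moment \<alpha> (n - 1)) = 0"
    by (rule has_integral_unique)
  then have "angle_mass \<alpha> * ((2 * \<alpha> + 1 + n) * cos_moment \<alpha> (n + 1) - n * cos_moment \<alpha> (n - 1)) = 0"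
    by (simp add: algebra_simps)
  then show ?thesis using angle_mass_pos[OF a] by simp
qed

lemma cos_moment_1:
  assumes "\<alpha> \<ge> - 1 / 2"
  shows "cos_moment \<alpha> 1 = 0"
proof (cases "\<alpha> = - 1 / 2")
  case True
  then show ?thesis using integral_angle_measure_half[of cos] by (simp add: cos_moment_def)
next
  case False
  with assms have "2 * \<alpha> + 1 \<noteq> 0" by simp
  moreover have "(2 * \<alpha> + 1) * cos_moment \<alpha> 1 = 0"
    using cos_moment_rec[OF assms, of 0] by simp
  ultimately show ?thesis by simp
qed

lemma cos_moment_odd:
  assumes "\<alpha> \<ge> - 1 / 2"
  shows "cos_moment \<alpha> (2 * k + 1) = 0"
proof (induction k)
  case 0
  then show ?case using cos_moment_1[OF assms] by simp
next
  case (Suc k)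
  have "(2 * \<alpha> + 1 + real (2 * k + 2)) * cos_moment \<alpha> (2 * Suc k + 1) = 0"
    using cos_moment_rec[OF assms, of "2 * k + 2"] Suc.IH by simp
  moreover have "2 * \<alpha> + 1 + real (2 * k + 2) \<noteq> 0" using assms by simp
  ultimately show ?case by simp
qed

lemma cos_moment_even:
  assumes "\<alpha> \<ge> - 1 / 2"
  shows "cos_moment \<alpha> (2 * k) = pochhammer (1 / 2) k / pochhammer (\<alpha> + 1) k"
proof (induction k)
  case 0
  then show ?case by (simp add: cos_moment_0[OF assms])
next
  case (Suc k)
  have p: "\<alpha> + 1 + k > 0" using assms by simp
  have "2 * ((\<alpha> + 1 + k) * cos_moment \<alpha> (2 * Suc k)) = 2 * ((1 / 2 + k) * cos_moment \<alpha> (2 * k))"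
    using cos_moment_rec[OF assms, of "2 * k + 1"] by (simp add: algebra_simps)
  then have "cos_moment \<alpha> (2 * Suc k) = (1 / 2 + k) / (\<alpha> + 1 + k) * cos_moment \<alpha> (2 * k)"
    using p by (simp add: field_simps)
  then show ?case unfolding Suc.IH pochhammer_Suc by (simp add: mult.commute)
qed


text \<open>
  Poisson's integral; \<open>bessel_j_of_real\<close> identifies it with the power series. It shows at
  once that the function is bounded by \<open>1\<close> and Lipschitz.
\<close>

definition poisson_j :: "real \<Rightarrow> real \<Rightarrow> real" where
  "poisson_j \<alpha> z = (\<integral>\<phi>. cos (z * cos \<phi>) \<partial>angle_measure \<alpha>)"

text \<open>The coefficients of \<open>bessel_j\<close> in powers of \<open>z\<^sup>2\<close>, with the Gamma quotients cancelled.\<close>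

definition bessel_coeff :: "real \<Rightarrow> nat \<Rightarrow> real" where
  "bessel_coeff \<alpha> k = (- 1) ^ k / (4 ^ k * fact k * pochhammer (\<alpha> + 1) k)"

lemma abs_poisson_j_le_1:
  assumes "\<alpha> \<ge> - 1 / 2"
  shows "\<bar>poisson_j \<alpha> z\<bar> \<le> 1"
proof -
  interpret prob_space "angle_measure \<alpha>" using assms by (rule prob_space_angle_measure)
  have "\<bar>poisson_j \<alpha> z\<bar> \<le> (\<integral>\<phi>. \<bar>cos (z * cos \<phi>)\<bar> \<partial>angle_measure \<alpha>)"
    unfolding poisson_j_def by (rule integral_abs_bound)
  also have "\<dots> \<le> (\<integral>\<phi>. 1 \<partial>angle_measure \<alpha>)"
    using assms by (intro integral_mono integrable_angle_measure[where B = 1]) auto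
  finally show ?thesis by (simp add: measure_angle_measure[OF assms])
qed

lemma abs_cos_diff_le: "\<bar>cos x - cos y\<bar> \<le> \<bar>x - y\<bar>" for x y :: real
proof -
  have "\<bar>cos x - cos y\<bar> = 2 * \<bar>sin ((x + y) / 2)\<bar> * \<bar>sin ((y - x) / 2)\<bar>"
    by (simp add: cos_diff_cos abs_mult)
  also have "\<dots> \<le> 2 * 1 * \<bar>(y - x) / 2\<bar>"
    by (intro mult_mono abs_sin_le_one abs_sin_x_le_abs_x) auto
  finally show ?thesis by simp
qed

lemma poisson_j_lipschitz:
  assumes "\<alpha> \<ge> - 1 / 2"
  shows "\<bar>poisson_j \<alpha> y - poisson_j \<alpha> z\<bar> \<le> \<bar>y - z\<bar>"
proof -
  interpret prob_space "angle_measure \<alpha>" using assms by (rule prob_space_angle_measure)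
  have i: "integrable (angle_measure \<alpha>) (\<lambda>\<phi>. cos (y * cos \<phi>))" for y
    using assms by (intro integrable_angle_measure[where B = 1]) auto
  have "\<bar>poisson_j \<alpha> y - poisson_j \<alpha> z\<bar> =
      \<bar>\<integral>\<phi>. cos (y * cos \<phi>) - cos (z * cos \<phi>) \<partial>angle_measure \<alpha>\<bar>"
    unfolding poisson_j_def by (simp add: i)
  also have "\<dots> \<le> (\<integral>\<phi>. \<bar>cos (y * cos \<phi>) - cos (z * cos \<phi>)\<bar> \<partial>angle_measure \<alpha>)"
    by (rule integral_abs_bound)
  also have "\<dots> \<le> (\<integral>\<phi>. \<bar>y - z\<bar> \<partial>angle_measure \<alpha>)"
  proof (intro integral_mono integrable_abs Bochner_Integration.integrable_diff i)
    fix \<phi>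
    have "\<bar>cos (y * cos \<phi>) - cos (z * cos \<phi>)\<bar> \<le> \<bar>y - z\<bar> * \<bar>cos \<phi>\<bar>"
      using abs_cos_diff_le[of "y * cos \<phi>" "z * cos \<phi>"] by (simp add: abs_mult flip: left_diff_distrib)
    also have "\<dots> \<le> \<bar>y - z\<bar>" by (intro mult_left_le) auto
    finally show "\<bar>cos (y * cos \<phi>) - cos (z * cos \<phi>)\<bar> \<le> \<bar>y - z\<bar>" .
  qed simp_all
  finally show ?thesis by (simp add: measure_angle_measure[OF assms])
qed

lemma continuous_on_poisson_j:
  assumes "\<alpha> \<ge> - 1 / 2"
  shows "continuous_on A (poisson_j \<alpha>)"
proof -
  have "1-lipschitz_on A (poisson_j \<alpha>)"
    using poisson_j_lipschitz[OF assms] by (auto simp: lipschitz_on_def dist_real_def)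
  then show ?thesis by (rule lipschitz_on_continuous_on)
qed

lemma borel_measurable_poisson_j [measurable]:
  assumes "\<alpha> \<ge> - 1 / 2"
  shows "poisson_j \<alpha> \<in> borel_measurable borel"
  by (intro borel_measurable_continuous_onI continuous_on_poisson_j assms)

text \<open>Termwise integration of the cosine series, whose odd moments vanish.\<close>

lemma poisson_j_sums:
  assumes "\<alpha> \<ge> - 1 / 2"
  shows "(\<lambda>k. bessel_coeff \<alpha> k * z ^ (2 * k)) sums poisson_j \<alpha> z"
proof -
  let ?f = "\<lambda>k \<phi>. cos_coeff k * (z * cos \<phi>) ^ k"
  have i: "integrable (angle_measure \<alpha>) (?f k)" for k
  proof (rule integrable_angle_measure[OF assms, where B = "\<bar>cos_coeff k\<bar> * \<bar>z\<bar> ^ k"])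
    fix \<phi>
    have "\<bar>z * cos \<phi>\<bar> ^ k \<le> \<bar>z\<bar> ^ k"
      by (intro power_mono) (auto simp: abs_mult intro!: mult_left_le)
    then show "norm (?f k \<phi>) \<le> \<bar>cos_coeff k\<bar> * \<bar>z\<bar> ^ k"
      by (simp add: abs_mult power_abs mult_left_mono)
  qed simp
  have s: "summable (\<lambda>k. \<bar>cos_coeff k\<bar> * \<bar>z\<bar> ^ k)"
    using summable_norm_cos[of "\<bar>z\<bar>"] by (simp add: abs_mult power_abs)
  have b: "norm (?f k \<phi>) \<le> \<bar>cos_coeff k\<bar> * \<bar>z\<bar> ^ k" for k \<phi>
  proof -
    have "\<bar>z * cos \<phi>\<bar> ^ k \<le> \<bar>z\<bar> ^ k"
      by (intro power_mono) (auto simp: abs_mult intro!: mult_left_le)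
    then show ?thesis
      by (simp add: abs_mult power_abs mult_left_mono)
  qed
  have n: "(\<integral>\<phi>. norm (?f k \<phi>) \<partial>angle_measure \<alpha>) \<le> \<bar>cos_coeff k\<bar> * \<bar>z\<bar> ^ k" for k
  proof -
    interpret prob_space "angle_measure \<alpha>" using assms by (rule prob_space_angle_measure)
    have "(\<integral>\<phi>. norm (?f k \<phi>) \<partial>angle_measure \<alpha>) \<le> (\<integral>\<phi>. \<bar>cos_coeff k\<bar> * \<bar>z\<bar> ^ k \<partial>angle_measure \<alpha>)"
      by (intro integral_mono integrable_norm i b) simp
    then show ?thesis by (simp add: measure_angle_measure[OF assms])
  qed
  have "(\<lambda>k. \<integral>\<phi>. ?f k \<phi> \<partial>angle_measure \<alpha>) sums (\<integral>\<phi>. (\<Sum>k. ?f k \<phi>) \<partial>angle_measure \<alpha>)"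
  proof (rule sums_integral[OF i])
    show "AE \<phi> in angle_measure \<alpha>. summable (\<lambda>k. norm (?f k \<phi>))"
      using s b by (intro AE_I2 summable_comparison_test'[OF s]) auto
    show "summable (\<lambda>k. \<integral>\<phi>. norm (?f k \<phi>) \<partial>angle_measure \<alpha>)"
      using n by (intro summable_comparison_test'[OF s]) auto
  qed
  moreover have "(\<Sum>k. ?f k \<phi>) = cos (z * cos \<phi>)" for \<phi>
    using cos_converges[of "z * cos \<phi>"] by (simp add: sums_iff)
  ultimately have "(\<lambda>k. cos_coeff k * z ^ k * cos_moment \<alpha> k) sums poisson_j \<alpha> z"
    by (simp add: poisson_j_def cos_moment_def power_mult_distrib mult.assoc)
  moreover have "cos_coeff k * z ^ k * cos_moment \<alpha> k = 0" if "k \<notin> range (\<lambda>k. 2 * k)" for k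
  proof -
    have "odd k" using that by (auto simp: image_def elim!: evenE)
    then show ?thesis by (simp add: cos_coeff_def)
  qed
  ultimately have "(\<lambda>k. cos_coeff (2 * k) * z ^ (2 * k) * cos_moment \<alpha> (2 * k)) sums poisson_j \<alpha> z"
    by (subst sums_mono_reindex) (auto simp: strict_mono_def)
  moreover have "cos_coeff (2 * k) * z ^ (2 * k) * cos_moment \<alpha> (2 * k) = bessel_coeff \<alpha> k * z ^ (2 * k)" for k
  proof -
    have "pochhammer (1 / 2 :: real) k \<noteq> 0" by (simp add: pochhammer_eq_0_iff field_simps)
    then show ?thesis
      by (simp add: cos_moment_even[OF assms] cos_coeff_def bessel_coeff_def fact_double power_mult)
  qed
  ultimately show ?thesis by simp
qed

lemma bessel_j_of_real:
  assumes "\<alpha> \<ge> - 1 / 2"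
  shows "bessel_j \<alpha> (of_real z) = of_real (poisson_j \<alpha> z)"
proof -
  have c: "(- 1) ^ k * Gamma (\<alpha> + 1) / (Gamma (real k + 1) * Gamma (real k + \<alpha> + 1)) * (z / 2) ^ (2 * k) =
      bessel_coeff \<alpha> k * z ^ (2 * k)" for k
  proof -
    have "pochhammer (\<alpha> + 1) k = Gamma (real k + \<alpha> + 1) / Gamma (\<alpha> + 1)"
      using assms by (subst pochhammer_Gamma) (auto simp: add_ac elim!: nonpos_Ints_cases)
    moreover have "Gamma (\<alpha> + 1) > 0" "Gamma (real k + \<alpha> + 1) > 0"
      using assms by (auto intro!: Gamma_real_pos)
    ultimately show ?thesis
      by (simp add: bessel_coeff_def Gamma_fact add.commute[of _ 1] power_divide power_mult)
  qed
  have "(\<lambda>k. of_real (bessel_coeff \<alpha> k * z ^ (2 * k))) sums (of_real (poisson_j \<alpha> z) :: complex)"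
    using poisson_j_sums[OF assms] by (rule sums_of_real)
  also have "(\<lambda>k. of_real (bessel_coeff \<alpha> k * z ^ (2 * k)) :: complex) =
      (\<lambda>k. of_real ((- 1) ^ k * Gamma (\<alpha> + 1) / (Gamma (real k + 1) * Gamma (real k + \<alpha> + 1)))
           * (of_real z / 2) ^ (2 * k))"
    unfolding c[symmetric] by (intro ext) simp
  finally show ?thesis by (simp add: bessel_j_def sums_iff)
qed

section \<open>The product formula\<close>

text \<open>
  The law of cosines: the third side of a triangle with sides \<open>s\<close>, \<open>t\<close> enclosing the angle \<open>\<phi>\<close>.
\<close>

definition third_side :: "real \<Rightarrow> real \<Rightarrow> real \<Rightarrow> real" where
  "third_side t s \<phi> = sqrt (t\<^sup>2 + s\<^sup>2 - 2 * s * t * cos \<phi>)"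

lemma borel_measurable_third_side [measurable]:
  "(\<lambda>x. third_side (f x) (g x) (h x)) \<in> borel_measurable M"
  if "f \<in> borel_measurable M" "g \<in> borel_measurable M" "h \<in> borel_measurable M"
  using that unfolding third_side_def by measurable

lemma third_side_radicand_bounds:
  fixes s t \<phi> :: real
  shows "(\<bar>s\<bar> - \<bar>t\<bar>)\<^sup>2 \<le> t\<^sup>2 + s\<^sup>2 - 2 * s * t * cos \<phi>"
    and "t\<^sup>2 + s\<^sup>2 - 2 * s * t * cos \<phi> \<le> (\<bar>s\<bar> + \<bar>t\<bar>)\<^sup>2"
proof -
  have "\<bar>s * t * cos \<phi>\<bar> \<le> \<bar>s\<bar> * \<bar>t\<bar>" by (simp add: abs_mult mult_left_le)
  then have "s * t * cos \<phi> \<le> \<bar>s\<bar> * \<bar>t\<bar>" "- (s * t * cos \<phi>) \<le> \<bar>s\<bar> * \<bar>t\<bar>" by auto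
  then show "(\<bar>s\<bar> - \<bar>t\<bar>)\<^sup>2 \<le> t\<^sup>2 + s\<^sup>2 - 2 * s * t * cos \<phi>"
    and "t\<^sup>2 + s\<^sup>2 - 2 * s * t * cos \<phi> \<le> (\<bar>s\<bar> + \<bar>t\<bar>)\<^sup>2"
    by (simp_all add: power2_diff power2_sum)
qed

lemma third_side_power2: "(third_side t s \<phi>)\<^sup>2 = t\<^sup>2 + s\<^sup>2 - 2 * s * t * cos \<phi>"
  unfolding third_side_def
  by (rule real_sqrt_pow2) (rule order_trans[OF zero_le_power2 third_side_radicand_bounds(1)])

lemma third_side_0 [simp]: "third_side 0 s \<phi> = \<bar>s\<bar>"
  by (simp add: third_side_def)

lemma third_side_scale: "y \<ge> 0 \<Longrightarrow> y * third_side t s \<phi> = third_side (y * t) (y * s) \<phi>"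
proof -
  assume y: "y \<ge> 0"
  have "(y * t)\<^sup>2 + (y * s)\<^sup>2 - 2 * (y * s) * (y * t) * cos \<phi> = y\<^sup>2 * (t\<^sup>2 + s\<^sup>2 - 2 * s * t * cos \<phi>)"
    by (simp add: power2_eq_square algebra_simps)
  then show ?thesis using y by (simp add: third_side_def real_sqrt_mult)
qed

text \<open>
  The Chu--Vandermonde convolution, rewritten for the multinomial coefficients which arise when a
  power of the law of cosines is integrated.
\<close>

lemma pochhammer_trinomial_sum:
  fixes a :: real
  assumes "a > 0"
  shows "(\<Sum>c\<le>min l m. 1 / (fact c * fact (l - c) * fact (m - c) * pochhammer a c)) =
    pochhammer a (l + m) / (fact l * fact m * pochhammer a l * pochhammer a m)"
proof -
  define S where "S = (\<Sum>c\<le>min l m. 1 / (fact c * fact (l - c) * fact (m - c) * pochhammer a c))"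
  have pos: "pochhammer a n > 0" for n using assms by (rule pochhammer_pos)
  have g: "((a - 1) + m) gchoose (m - c) = pochhammer a m / (pochhammer a c * fact (m - c))" if "c \<le> m" for c
  proof -
    have "((a - 1) + m) gchoose (m - c) = pochhammer (a + c) (m - c) / fact (m - c)"
      using that by (simp add: gbinomial_pochhammer' of_nat_diff algebra_simps)
    also have "pochhammer (a + c) (m - c) = pochhammer a m / pochhammer a c"
      using pochhammer_product[OF that, of a] pos[of c] by (simp add: field_simps)
    finally show ?thesis by simp
  qed
  have "pochhammer a (l + m) / (pochhammer a l * fact m) = (real l + ((a - 1) + m)) gchoose m"
  proof -
    have "(real l + ((a - 1) + m)) gchoose m = pochhammer (a + l) m / fact m"
      by (simp add: gbinomial_pochhammer' algebra_simps)
    also have "pochhammer (a + l) m = pochhammer a (l + m) / pochhammer a l"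
      using pochhammer_product'[of a l m] pos[of l] by (simp add: field_simps)
    finally show ?thesis by simp
  qed
  also have "\<dots> = (\<Sum>c\<le>m. (real l gchoose c) * (((a - 1) + m) gchoose (m - c)))"
    by (rule gbinomial_Vandermonde[symmetric, unfolded atLeast0AtMost])
  also have "\<dots> = (\<Sum>c\<le>min l m. (real l gchoose c) * (((a - 1) + m) gchoose (m - c)))"
    by (rule sum.mono_neutral_right) (auto simp: binomial_gbinomial[symmetric])
  also have "\<dots> = (\<Sum>c\<le>min l m. fact l * pochhammer a m * (1 / (fact c * fact (l - c) * fact (m - c) * pochhammer a c)))"
    by (rule sum.cong) (auto simp: g binomial_gbinomial[symmetric] binomial_fact)
  also have "\<dots> = fact l * pochhammer a m * S"
    by (simp add: sum_distrib_left S_def)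
  finally have "S = pochhammer a (l + m) / (fact l * fact m * pochhammer a l * pochhammer a m)"
    using pos[of m] pos[of l] by (simp add: field_simps)
  then show ?thesis by (simp add: S_def)
qed

text \<open>
  Expanding the power in \<open>cos \<phi>\<close> leaves only even moments, and these cancel the factorial \<open>(2 c)!\<close> of
  the multinomial coefficient up to \<open>c! (\<alpha> + 1)\<^sub>c\<close>. Collecting the coefficient of
  \<open>x ^ (2 * l) * y ^ (2 * (k - l))\<close> then leaves the sum of \<open>pochhammer_trinomial_sum\<close>.
\<close>

lemma law_of_cosines_moment:
  assumes a: "\<alpha> \<ge> - 1 / 2"
  shows "bessel_coeff \<alpha> k * (\<integral>\<phi>. (x\<^sup>2 + y\<^sup>2 - 2 * y * x * cos \<phi>) ^ k \<partial>angle_measure \<alpha>) =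
    (\<Sum>i\<le>k. (bessel_coeff \<alpha> i * x ^ (2 * i)) * (bessel_coeff \<alpha> (k - i) * y ^ (2 * (k - i))))"
proof -
  let ?P = "pochhammer (\<alpha> + 1)"
  have pos: "?P n > 0" for n using a by (intro pochhammer_pos) simp
  have half: "pochhammer (1 / 2 :: real) n > 0" for n by (intro pochhammer_pos) simp
  define w where "w c = 4 ^ c * cos_moment \<alpha> (2 * c)" for c
  have w: "w c = fact (2 * c) / (fact c * ?P c)" for c
    using half[of c] by (simp add: w_def cos_moment_even[OF a] fact_double power_mult)
  have i: "integrable (angle_measure \<alpha>) (\<lambda>\<phi>. cos \<phi> ^ n)" for n
    using a by (intro integrable_angle_measure[where B = 1]) (auto intro: cos_power_le_one)
  have "(\<integral>\<phi>. (x\<^sup>2 + y\<^sup>2 - 2 * y * x * cos \<phi>) ^ k \<partial>angle_measure \<alpha>) =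
      (\<integral>\<phi>. (\<Sum>n\<le>k. (real (k choose n) * (- (2 * y * x)) ^ n * (x\<^sup>2 + y\<^sup>2) ^ (k - n)) * cos \<phi> ^ n) \<partial>angle_measure \<alpha>)"
  proof (intro Bochner_Integration.integral_cong refl)
    fix \<phi>
    have "x\<^sup>2 + y\<^sup>2 - 2 * y * x * cos \<phi> = (- (2 * y * x)) * cos \<phi> + (x\<^sup>2 + y\<^sup>2)" by simp
    then show "(x\<^sup>2 + y\<^sup>2 - 2 * y * x * cos \<phi>) ^ k =
        (\<Sum>n\<le>k. (real (k choose n) * (- (2 * y * x)) ^ n * (x\<^sup>2 + y\<^sup>2) ^ (k - n)) * cos \<phi> ^ n)"
      by (simp only: binomial_ring power_mult_distrib mult_ac)
  qed
  also have "\<dots> = (\<Sum>n\<le>k. (real (k choose n) * (- (2 * y * x)) ^ n * (x\<^sup>2 + y\<^sup>2) ^ (k - n)) * cos_moment \<alpha> n)"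
    by (subst Bochner_Integration.integral_sum) (auto simp: i cos_moment_def)
  also have "\<dots> = (\<Sum>n\<in>(*) 2 ` {c. 2 * c \<le> k}. (real (k choose n) * (- (2 * y * x)) ^ n * (x\<^sup>2 + y\<^sup>2) ^ (k - n)) * cos_moment \<alpha> n)"
  proof (rule sum.mono_neutral_right)
    show "\<forall>n\<in>{..k} - (*) 2 ` {c. 2 * c \<le> k}.
        real (k choose n) * (- (2 * y * x)) ^ n * (x\<^sup>2 + y\<^sup>2) ^ (k - n) * cos_moment \<alpha> n = 0"
    proof
      fix n assume "n \<in> {..k} - (*) 2 ` {c. 2 * c \<le> k}"
      then have "odd n" by (auto elim!: evenE)
      then have "cos_moment \<alpha> n = 0" using cos_moment_odd[OF a] by (auto elim!: oddE)
      then show "real (k choose n) * (- (2 * y * x)) ^ n * (x\<^sup>2 + y\<^sup>2) ^ (k - n) * cos_moment \<alpha> n = 0"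
        by simp
    qed
  qed auto
  also have "\<dots> = (\<Sum>c | 2 * c \<le> k. real (k choose (2 * c)) * w c * (x\<^sup>2 * y\<^sup>2) ^ c * (x\<^sup>2 + y\<^sup>2) ^ (k - 2 * c))"
  proof -
    have "(- (2 * y * x)) ^ (2 * c) = 4 ^ c * (x\<^sup>2 * y\<^sup>2) ^ c" for c
    proof -
      have "(- (2 * y * x)) ^ (2 * c) = (4 * (x\<^sup>2 * y\<^sup>2)) ^ c"
        unfolding power_mult by (simp add: power_mult_distrib[of _ _ 2] mult_ac)
      then show ?thesis by (simp add: power_mult_distrib)
    qed
    then show ?thesis
      by (subst sum.reindex) (auto simp: inj_on_def w_def intro!: sum.cong)
  qed
  also have "\<dots> = (\<Sum>c | 2 * c \<le> k. \<Sum>j\<le>k - 2 * c. real (k choose (2 * c)) * w c *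
      real ((k - 2 * c) choose j) * (x\<^sup>2) ^ (c + j) * (y\<^sup>2) ^ (k - (c + j)))"
  proof (intro sum.cong refl)
    fix c assume "c \<in> {c. 2 * c \<le> k}"
    then have c: "2 * c \<le> k" by simp
    have e: "(y\<^sup>2) ^ (k - (c + j)) = (y\<^sup>2) ^ c * (y\<^sup>2) ^ (k - 2 * c - j)" if "j \<le> k - 2 * c" for j
      using c that by (simp flip: power_add)
    show "real (k choose (2 * c)) * w c * (x\<^sup>2 * y\<^sup>2) ^ c * (x\<^sup>2 + y\<^sup>2) ^ (k - 2 * c) =
      (\<Sum>j\<le>k - 2 * c. real (k choose (2 * c)) * w c *
      real ((k - 2 * c) choose j) * (x\<^sup>2) ^ (c + j) * (y\<^sup>2) ^ (k - (c + j)))"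
      unfolding binomial_ring sum_distrib_left
      by (intro sum.cong refl) (simp add: e power_mult_distrib power_add mult_ac)
  qed
  also have "\<dots> = (\<Sum>l\<le>k. \<Sum>c\<le>min l (k - l). real (k choose (2 * c)) * w c *
      real ((k - 2 * c) choose (l - c)) * (x\<^sup>2) ^ l * (y\<^sup>2) ^ (k - l))"
  proof -
    have fin: "finite {c. 2 * c \<le> k}" by (rule finite_subset[of _ "{..k}"]) auto
    \<comment> \<open>Collect by the total exponent \<open>l = c + j\<close> of \<open>x\<^sup>2\<close>.\<close>
    show ?thesis
      apply (subst sum.Sigma, use fin in simp, simp)
      apply (subst sum.Sigma, simp, simp)
      by (rule sum.reindex_bij_witness[where j = "\<lambda>(c, j). (c + j, c)" and i = "\<lambda>(l, c). (c, l - c)"]) auto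
  qed
  also have "\<dots> = (\<Sum>l\<le>k. fact k * ?P k / (fact l * fact (k - l) * ?P l * ?P (k - l)) * (x\<^sup>2) ^ l * (y\<^sup>2) ^ (k - l))"
  proof (intro sum.cong refl)
    fix l assume "l \<in> {..k}"
    then have l: "l \<le> k" by simp
    have "(\<Sum>c\<le>min l (k - l). real (k choose (2 * c)) * w c * real ((k - 2 * c) choose (l - c))) =
        (\<Sum>c\<le>min l (k - l). fact k * (1 / (fact c * fact (l - c) * fact (k - l - c) * ?P c)))"
    proof (intro sum.cong refl)
      fix c assume c: "c \<in> {..min l (k - l)}"
      then have "real (k choose (2 * c)) = fact k / (fact (2 * c) * fact (k - 2 * c))"
        "real ((k - 2 * c) choose (l - c)) = fact (k - 2 * c) / (fact (l - c) * fact (k - l - c))"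
        using l by (subst binomial_fact; auto simp: algebra_simps)+
      then show "real (k choose (2 * c)) * w c * real ((k - 2 * c) choose (l - c)) =
          fact k * (1 / (fact c * fact (l - c) * fact (k - l - c) * ?P c))"
        by (simp add: w)
    qed
    also have "\<dots> = fact k * ?P k / (fact l * fact (k - l) * ?P l * ?P (k - l))"
      unfolding sum_distrib_left[symmetric] using a l by (subst pochhammer_trinomial_sum) auto
    finally show "(\<Sum>c\<le>min l (k - l). real (k choose (2 * c)) * w c *
      real ((k - 2 * c) choose (l - c)) * (x\<^sup>2) ^ l * (y\<^sup>2) ^ (k - l)) =
      fact k * ?P k / (fact l * fact (k - l) * ?P l * ?P (k - l)) * (x\<^sup>2) ^ l * (y\<^sup>2) ^ (k - l)"
      by (simp flip: sum_distrib_right)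
  qed
  finally have m: "(\<integral>\<phi>. (x\<^sup>2 + y\<^sup>2 - 2 * y * x * cos \<phi>) ^ k \<partial>angle_measure \<alpha>) =
     (\<Sum>l\<le>k. fact k * ?P k / (fact l * fact (k - l) * ?P l * ?P (k - l)) * (x\<^sup>2) ^ l * (y\<^sup>2) ^ (k - l))" .
  show ?thesis
    unfolding m sum_distrib_left
  proof (intro sum.cong refl)
    fix l assume "l \<in> {..k}"
    then have e: "(- 1) ^ k = (- 1 :: real) ^ l * (- 1) ^ (k - l)" "(4::real) ^ k = 4 ^ l * 4 ^ (k - l)"
      by (simp_all flip: power_add)
    show "bessel_coeff \<alpha> k * (fact k * ?P k / (fact l * fact (k - l) * ?P l * ?P (k - l)) * (x\<^sup>2) ^ l * (y\<^sup>2) ^ (k - l)) =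
      bessel_coeff \<alpha> l * x ^ (2 * l) * (bessel_coeff \<alpha> (k - l) * y ^ (2 * (k - l)))"
      using pos[of k] unfolding bessel_coeff_def e power_mult by (simp add: mult_ac)
  qed
qed

lemma summable_bessel_coeff:
  assumes a: "\<alpha> \<ge> - 1 / 2"
  shows "summable (\<lambda>k. \<bar>bessel_coeff \<alpha> k\<bar> * z ^ k)"
proof -
  \<comment> \<open>The powers of \<open>4\<close> make up for the Pochhammer symbol, which is smallest for \<open>\<alpha> = - 1 / 2\<close>.\<close>
  have b: "\<bar>bessel_coeff \<alpha> k\<bar> \<le> 1 / fact k" for k
  proof -
    have "pochhammer (1 / 2) k \<le> pochhammer (\<alpha> + 1) k"
      unfolding pochhammer_prod using a by (intro prod_mono) auto
    moreover have "4 ^ k * pochhammer (1 / 2 :: real) k \<ge> 1"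
    proof (induction k)
      case (Suc k)
      have "1 * 1 \<le> (4 ^ k * pochhammer (1 / 2 :: real) k) * (4 * (1 / 2 + k))"
        by (intro mult_mono Suc) (auto intro!: mult_nonneg_nonneg pochhammer_nonneg)
      then show ?case by (simp add: pochhammer_Suc algebra_simps)
    qed simp
    ultimately have "1 \<le> 4 ^ k * pochhammer (\<alpha> + 1) k"
      by (meson mult_left_mono order_trans zero_le_numeral zero_le_power)
    then have "1 * fact k \<le> (4 ^ k * pochhammer (\<alpha> + 1) k) * fact k"
      by (intro mult_right_mono) auto
    moreover have "pochhammer (\<alpha> + 1) k > 0" using a by (intro pochhammer_pos) simp
    ultimately show ?thesis
      unfolding bessel_coeff_def by (simp add: abs_mult power_abs field_simps)
  qed
  show ?thesis
  proof (rule summable_comparison_test'[where N = 0])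
    show "summable (\<lambda>k. inverse (fact k) * \<bar>z\<bar> ^ k)"
      by (rule summable_exp)
    show "norm (\<bar>bessel_coeff \<alpha> n\<bar> * z ^ n) \<le> inverse (fact n) * \<bar>z\<bar> ^ n" for n
    proof -
      have "norm (\<bar>bessel_coeff \<alpha> n\<bar> * z ^ n) = \<bar>bessel_coeff \<alpha> n\<bar> * \<bar>z\<bar> ^ n"
        by (simp only: real_norm_def abs_mult power_abs abs_idempotent)
      also have "\<dots> \<le> 1 / fact n * \<bar>z\<bar> ^ n"
        by (rule mult_right_mono[OF b]) simp
      finally show ?thesis by (simp only: inverse_eq_divide)
    qed
  qed
qed

text \<open>
  Integrating the power series termwise turns the claim into the equality of
  \<open>law_of_cosines_moment\<close> with the coefficients of the Cauchy product of the two series.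
\<close>

theorem poisson_j_product:
  assumes a: "\<alpha> \<ge> - 1 / 2"
  shows "(\<integral>\<phi>. poisson_j \<alpha> (third_side x y \<phi>) \<partial>angle_measure \<alpha>) = poisson_j \<alpha> x * poisson_j \<alpha> y"
proof -
  let ?q = "\<lambda>\<phi>. x\<^sup>2 + y\<^sup>2 - 2 * y * x * cos \<phi>"
  let ?B = "(\<bar>y\<bar> + \<bar>x\<bar>)\<^sup>2"
  interpret prob_space "angle_measure \<alpha>" using assms by (rule prob_space_angle_measure)
  have q: "\<bar>?q \<phi>\<bar> \<le> ?B" for \<phi>
    using third_side_radicand_bounds[where s = y and t = x and \<phi> = \<phi>] zero_le_power2[of "\<bar>y\<bar> - \<bar>x\<bar>"] by linarith
  have b: "norm (bessel_coeff \<alpha> k * ?q \<phi> ^ k) \<le> \<bar>bessel_coeff \<alpha> k\<bar> * ?B ^ k" for k \<phi>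
    using power_mono[OF q, of \<phi> k] by (simp add: abs_mult power_abs mult_left_mono)
  have i: "integrable (angle_measure \<alpha>) (\<lambda>\<phi>. bessel_coeff \<alpha> k * ?q \<phi> ^ k)" for k
    by (rule integrable_angle_measure[OF a _ b]) simp
  have "(\<lambda>k. \<integral>\<phi>. bessel_coeff \<alpha> k * ?q \<phi> ^ k \<partial>angle_measure \<alpha>) sums
      (\<integral>\<phi>. (\<Sum>k. bessel_coeff \<alpha> k * ?q \<phi> ^ k) \<partial>angle_measure \<alpha>)"
  proof (rule sums_integral[OF i])
    note s = summable_bessel_coeff[OF a, of ?B]
    show "AE \<phi> in angle_measure \<alpha>. summable (\<lambda>k. norm (bessel_coeff \<alpha> k * ?q \<phi> ^ k))"
      using b by (intro AE_I2 summable_comparison_test'[OF s]) auto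
    have n: "(\<integral>\<phi>. norm (bessel_coeff \<alpha> k * ?q \<phi> ^ k) \<partial>angle_measure \<alpha>) \<le> \<bar>bessel_coeff \<alpha> k\<bar> * ?B ^ k" for k
    proof -
      have "(\<integral>\<phi>. norm (bessel_coeff \<alpha> k * ?q \<phi> ^ k) \<partial>angle_measure \<alpha>) \<le>
          (\<integral>\<phi>. \<bar>bessel_coeff \<alpha> k\<bar> * ?B ^ k \<partial>angle_measure \<alpha>)"
        by (intro integral_mono integrable_norm i b) simp
      then show ?thesis by (simp add: measure_angle_measure[OF assms])
    qed
    show "summable (\<lambda>k. \<integral>\<phi>. norm (bessel_coeff \<alpha> k * ?q \<phi> ^ k) \<partial>angle_measure \<alpha>)"
      using n by (intro summable_comparison_test'[OF s]) auto
  qed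
  moreover have "(\<Sum>k. bessel_coeff \<alpha> k * ?q \<phi> ^ k) = poisson_j \<alpha> (third_side x y \<phi>)" for \<phi>
    using poisson_j_sums[OF a, of "third_side x y \<phi>"] by (simp add: sums_iff power_mult third_side_power2)
  ultimately have "(\<lambda>k. \<Sum>i\<le>k. (bessel_coeff \<alpha> i * x ^ (2 * i)) * (bessel_coeff \<alpha> (k - i) * y ^ (2 * (k - i)))) sums
      (\<integral>\<phi>. poisson_j \<alpha> (third_side x y \<phi>) \<partial>angle_measure \<alpha>)"
    by (simp add: law_of_cosines_moment[OF a])
  moreover have "(\<lambda>k. \<Sum>i\<le>k. (bessel_coeff \<alpha> i * x ^ (2 * i)) * (bessel_coeff \<alpha> (k - i) * y ^ (2 * (k - i)))) sums
      ((\<Sum>k. bessel_coeff \<alpha> k * x ^ (2 * k)) * (\<Sum>k. bessel_coeff \<alpha> k * y ^ (2 * k)))"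
  proof -
    have "summable (\<lambda>k. norm (bessel_coeff \<alpha> k * x ^ (2 * k)))" for x
      using summable_bessel_coeff[OF a, of "x\<^sup>2"] by (simp add: abs_mult power_mult power_abs)
    then show ?thesis by (intro Cauchy_product_sums)
  qed
  moreover have "(\<Sum>k. bessel_coeff \<alpha> k * x ^ (2 * k)) = poisson_j \<alpha> x" for x
    using poisson_j_sums[OF a, of x] by (simp add: sums_iff)
  ultimately show ?thesis by (simp add: sums_iff)
qed

section \<open>The symmetry of the Bessel translation\<close>

text \<open>
  The measure \<open>x powr (2 * \<alpha> + 1) dx\<close> on the Borel sets of the line. Compositions with \<open>third_side\<close> and
  Fubini's theorem require Borel measurability, whereas \<open>bessel_measure\<close> is the completion of its
  restriction to the half-line.
\<close>

definition radial_measure :: "real \<Rightarrow> real measure" where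
  "radial_measure \<alpha> = density lborel (\<lambda>x. ennreal (indicator {0<..} x * x powr (2 * \<alpha> + 1)))"

lemma sets_radial_measure [simp, measurable_cong]: "sets (radial_measure \<alpha>) = sets borel"
  by (simp add: radial_measure_def)

lemma space_radial_measure [simp]: "space (radial_measure \<alpha>) = UNIV"
  by (simp add: radial_measure_def)

lemma AE_radial_measure: "(AE x in radial_measure \<alpha>. P x) \<longleftrightarrow> (AE x in lborel. 0 < x \<longrightarrow> P x)"
  unfolding radial_measure_def
  by (subst AE_density) (auto intro!: AE_cong simp: indicator_def)

lemma AE_radial_measure_pos: "AE x in radial_measure \<alpha>. 0 < x"
  by (simp add: AE_radial_measure)

lemma nn_integral_radial_measure:
  "f \<in> borel_measurable borel \<Longrightarrow> (\<integral>\<^sup>+x. f x \<partial>radial_measure \<alpha>) =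
    (\<integral>\<^sup>+x. ennreal (indicator {0<..} x * x powr (2 * \<alpha> + 1)) * f x \<partial>lborel)"
  unfolding radial_measure_def by (rule nn_integral_density) auto

lemma sigma_finite_radial_measure: "sigma_finite_measure (radial_measure \<alpha>)"
  unfolding radial_measure_def by (subst sigma_finite_measure.sigma_finite_iff_density_finite[OF sigma_finite_lborel]) auto

text \<open>
  The kernel of the translation: for fixed \<open>t\<close> the substitution of the third side \<open>r\<close> of the
  triangle for the angle has this density with respect to \<open>dr ds\<close>. The quantity under the root is
  sixteen times the squared area of the triangle with sides \<open>s\<close>, \<open>t\<close>, \<open>r\<close>, which is why the kernel
  is symmetric in \<open>s\<close> and \<open>r\<close>.
\<close>

definition triangle_kernel :: "real \<Rightarrow> real \<Rightarrow> real \<Rightarrow> real \<Rightarrow> real" where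
  "triangle_kernel \<alpha> t s r =
     (if 0 < s \<and> 0 < r \<and> \<bar>s - t\<bar> \<le> r \<and> r \<le> s + t
      then sqrt (4 * s\<^sup>2 * t\<^sup>2 - (t\<^sup>2 + s\<^sup>2 - r\<^sup>2)\<^sup>2) powr (2 * \<alpha> - 1) * (2 * t) powr (1 - 2 * \<alpha>) * s * r
        / (t * angle_mass \<alpha>)
      else 0)"

lemma triangle_kernel_sym: "triangle_kernel \<alpha> t s r = triangle_kernel \<alpha> t r s"
proof -
  have "4 * s\<^sup>2 * t\<^sup>2 - (t\<^sup>2 + s\<^sup>2 - r\<^sup>2)\<^sup>2 = 4 * r\<^sup>2 * t\<^sup>2 - (t\<^sup>2 + r\<^sup>2 - s\<^sup>2)\<^sup>2"
    by (simp add: power2_eq_square algebra_simps)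
  moreover have "0 < s \<and> 0 < r \<and> \<bar>s - t\<bar> \<le> r \<and> r \<le> s + t \<longleftrightarrow> 0 < r \<and> 0 < s \<and> \<bar>r - t\<bar> \<le> s \<and> s \<le> r + t"
    by auto
  ultimately show ?thesis unfolding triangle_kernel_def by (simp only: mult_ac)
qed

lemma borel_measurable_triangle_kernel [measurable]:
  "(\<lambda>x. triangle_kernel \<alpha> t (f x) (g x)) \<in> borel_measurable M"
  if [measurable]: "f \<in> borel_measurable M" "g \<in> borel_measurable M"
  unfolding triangle_kernel_def by measurable

lemma third_side_0_angle: "third_side t s 0 = \<bar>s - t\<bar>"
proof -
  have "t\<^sup>2 + s\<^sup>2 - 2 * s * t = (s - t)\<^sup>2" by (simp add: power2_diff)
  then show ?thesis by (simp add: third_side_def)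
qed

lemma third_side_pi: "third_side t s pi = \<bar>s + t\<bar>"
proof -
  have "t\<^sup>2 + s\<^sup>2 + 2 * s * t = (s + t)\<^sup>2" by (simp add: power2_sum)
  then show ?thesis by (simp add: third_side_def)
qed

lemma nn_integral_third_side:
  assumes a: "\<alpha> > - 1 / 2" and s: "s > 0" and t: "t > 0" and "s \<noteq> t"
    and [measurable]: "G \<in> borel_measurable borel"
  shows "ennreal (s powr (2 * \<alpha> + 1)) * (\<integral>\<^sup>+\<phi>. G (third_side t s \<phi>) \<partial>angle_measure \<alpha>) =
    (\<integral>\<^sup>+r. ennreal (triangle_kernel \<alpha> t s r) * G r \<partial>lborel)"
proof -
  \<comment> \<open>The sine of the angle as a function of the third side.\<close>
  define D where "D r = sqrt (4 * s\<^sup>2 * t\<^sup>2 - (t\<^sup>2 + s\<^sup>2 - r\<^sup>2)\<^sup>2) / (2 * s * t)" for r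
  define f where "f r = ennreal (D r powr (2 * \<alpha> - 1) * r / (s * t * angle_mass \<alpha>)) * G r" for r
  let ?g' = "\<lambda>\<phi>. s * t * sin \<phi> / third_side t s \<phi>"
  have Z: "angle_mass \<alpha> > 0" by (rule angle_mass_pos[OF a])
  have rad: "t\<^sup>2 + s\<^sup>2 - 2 * s * t * cos \<phi> > 0" for \<phi>
  proof -
    have "0 < (\<bar>s\<bar> - \<bar>t\<bar>)\<^sup>2" using s t \<open>s \<noteq> t\<close> by simp
    then show ?thesis using third_side_radicand_bounds(1)[of s t \<phi>] by linarith
  qed
  then have pos: "third_side t s \<phi> > 0" for \<phi> by (simp add: third_side_def)
  have D: "D (third_side t s \<phi>) = sin \<phi>" if "\<phi> \<in> {0..pi}" for \<phi>
  proof -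
    have "4 * s\<^sup>2 * t\<^sup>2 - (t\<^sup>2 + s\<^sup>2 - (third_side t s \<phi>)\<^sup>2)\<^sup>2 = (2 * s * t)\<^sup>2 * (1 - (cos \<phi>)\<^sup>2)"
      unfolding third_side_power2 by (simp add: power2_eq_square algebra_simps)
    also have "\<dots> = (2 * s * t * sin \<phi>)\<^sup>2" by (simp add: power_mult_distrib sin_squared_eq)
    finally show ?thesis
      using that s t by (simp add: D_def abs_mult sin_ge_zero)
  qed
  have sub: "(\<integral>\<^sup>+r. f r * indicator {third_side t s 0..third_side t s pi} r \<partial>lborel) =
      (\<integral>\<^sup>+\<phi>. f (third_side t s \<phi>) * ?g' \<phi> * indicator {0..pi} \<phi> \<partial>lborel)"
  proof (rule nn_integral_substitution_aux)
    show "f \<in> borel_measurable borel" unfolding f_def D_def by measurable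
    show "(third_side t s has_real_derivative ?g' \<phi>) (at \<phi>)" for \<phi>
      unfolding third_side_def[abs_def] using rad[of \<phi>]
      by (auto intro!: derivative_eq_intros simp: field_simps)
    show "continuous_on {0..pi} ?g'"
    proof (intro continuous_intros ballI)
      show "continuous_on {0..pi} (third_side t s)"
        unfolding third_side_def[abs_def] by (intro continuous_intros)
      show "third_side t s \<phi> \<noteq> 0" for \<phi> using pos[of \<phi>] by simp
    qed
    show "0 \<le> ?g' \<phi>" if "\<phi> \<in> {0..pi}" for \<phi>
      using that s t pos[of \<phi>] by (auto intro!: divide_nonneg_pos mult_nonneg_nonneg sin_ge_zero)
  qed auto
  have "(\<integral>\<^sup>+\<phi>. G (third_side t s \<phi>) \<partial>angle_measure \<alpha>) =
      (\<integral>\<^sup>+\<phi>. ennreal (indicator {0..pi} \<phi> * sin \<phi> powr (2 * \<alpha>) / angle_mass \<alpha>) * G (third_side t s \<phi>) \<partial>lborel)"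
    by (rule nn_integral_angle_measure[OF a]) measurable
  also have "\<dots> = (\<integral>\<^sup>+\<phi>. f (third_side t s \<phi>) * ?g' \<phi> * indicator {0..pi} \<phi> \<partial>lborel)"
  proof (rule nn_integral_cong)
    fix \<phi>
    show "ennreal (indicator {0..pi} \<phi> * sin \<phi> powr (2 * \<alpha>) / angle_mass \<alpha>) * G (third_side t s \<phi>) =
      f (third_side t s \<phi>) * ?g' \<phi> * indicator {0..pi} \<phi>"
    proof (cases "\<phi> \<in> {0..pi}")
      case True
      then have sn: "sin \<phi> \<ge> 0" by (auto intro: sin_ge_zero)
      have e: "sin \<phi> powr (2 * \<alpha> - 1) * sin \<phi> = sin \<phi> powr (2 * \<alpha>)"
        using sn by (cases "sin \<phi> = 0") (simp_all add: powr_diff)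
      have nn: "0 \<le> sin \<phi> powr (2 * \<alpha> - 1) * third_side t s \<phi> / (s * t * angle_mass \<alpha>)" "0 \<le> ?g' \<phi>"
        using sn s t Z pos[of \<phi>] by simp_all
      have "f (third_side t s \<phi>) * ?g' \<phi> = ennreal (sin \<phi> powr (2 * \<alpha> - 1) * third_side t s \<phi> / (s * t * angle_mass \<alpha>) * ?g' \<phi>)
          * G (third_side t s \<phi>)"
        unfolding ennreal_mult[OF nn] f_def D[OF True] by (simp only: mult_ac)
      also have "sin \<phi> powr (2 * \<alpha> - 1) * third_side t s \<phi> / (s * t * angle_mass \<alpha>) * ?g' \<phi> = sin \<phi> powr (2 * \<alpha>) / angle_mass \<alpha>"
        using s t Z pos[of \<phi>] by (simp add: e[symmetric])
      finally show ?thesis using True by simp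
    qed simp
  qed
  also have "\<dots> = (\<integral>\<^sup>+r. f r * indicator {third_side t s 0..third_side t s pi} r \<partial>lborel)"
    by (rule sub[symmetric])
  finally have "ennreal (s powr (2 * \<alpha> + 1)) * (\<integral>\<^sup>+\<phi>. G (third_side t s \<phi>) \<partial>angle_measure \<alpha>) =
      (\<integral>\<^sup>+r. ennreal (s powr (2 * \<alpha> + 1)) * (f r * indicator {\<bar>s - t\<bar>..s + t} r) \<partial>lborel)"
    using s t by (subst nn_integral_cmult) (auto simp: third_side_0_angle third_side_pi f_def D_def)
  also have "\<dots> = (\<integral>\<^sup>+r. ennreal (triangle_kernel \<alpha> t s r) * G r \<partial>lborel)"
  proof (rule nn_integral_cong)
    fix r
    show "ennreal (s powr (2 * \<alpha> + 1)) * (f r * indicator {\<bar>s - t\<bar>..s + t} r) = ennreal (triangle_kernel \<alpha> t s r) * G r"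
    proof (cases "r \<in> {\<bar>s - t\<bar>..s + t} \<and> r > 0")
      case True
      let ?A = "sqrt (4 * s\<^sup>2 * t\<^sup>2 - (t\<^sup>2 + s\<^sup>2 - r\<^sup>2)\<^sup>2)"
      have A: "?A \<ge> 0"
      proof -
        have "\<bar>t\<^sup>2 + s\<^sup>2 - r\<^sup>2\<bar> \<le> 2 * s * t"
        proof -
          have "r\<^sup>2 \<le> (s + t)\<^sup>2" "(s - t)\<^sup>2 \<le> r\<^sup>2"
            using True by (auto intro!: power_mono simp: abs_le_square_iff[symmetric])
          then show ?thesis by (simp add: power2_sum power2_diff abs_le_iff)
        qed
        then have "\<bar>t\<^sup>2 + s\<^sup>2 - r\<^sup>2\<bar>\<^sup>2 \<le> (2 * s * t)\<^sup>2" by (intro power_mono) auto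
        then show ?thesis by (simp add: power_mult_distrib)
      qed
      have p: "s powr (2 * \<alpha> + 1) = s powr (2 * \<alpha> - 1) * s * s"
        using s by (simp add: powr_diff powr_add)
      have q: "(2 * s * t) powr (2 * \<alpha> - 1) * (2 * t) powr (1 - 2 * \<alpha>) = s powr (2 * \<alpha> - 1)"
      proof -
        have "(2 * s * t) powr (2 * \<alpha> - 1) = s powr (2 * \<alpha> - 1) * (2 * t) powr (2 * \<alpha> - 1)"
          using s t by (subst powr_mult[symmetric]) (auto simp: mult_ac)
        moreover have "(2 * t) powr (2 * \<alpha> - 1) * (2 * t) powr (1 - 2 * \<alpha>) = 1"
          using t by (simp flip: powr_add)
        ultimately show ?thesis by simp
      qed
      have "s powr (2 * \<alpha> + 1) * (D r powr (2 * \<alpha> - 1) * r / (s * t * angle_mass \<alpha>)) = triangle_kernel \<alpha> t s r"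
      proof -
        have "D r powr (2 * \<alpha> - 1) = ?A powr (2 * \<alpha> - 1) / (2 * s * t) powr (2 * \<alpha> - 1)"
          using s t A by (simp add: D_def powr_divide)
        also have "\<dots> = ?A powr (2 * \<alpha> - 1) * ((2 * t) powr (1 - 2 * \<alpha>) / s powr (2 * \<alpha> - 1))"
          using q[symmetric] s t by (simp add: field_simps)
        finally show ?thesis
          using True s t Z by (simp add: triangle_kernel_def p)
      qed
      moreover have "D r powr (2 * \<alpha> - 1) * r / (s * t * angle_mass \<alpha>) \<ge> 0"
        using True s t Z by simp
      ultimately show ?thesis
        using True by (simp add: f_def mult.assoc[symmetric] flip: ennreal_mult')
    next
      case False
      have "f r = 0" if "r = 0" using that by (simp add: f_def)
      then show ?thesis using False by (cases "r = 0") (auto simp: triangle_kernel_def indicator_def)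
    qed
  qed
  finally show ?thesis .
qed


text \<open>
  Geometrically, in the plane \<open>s\<close> and \<open>\<phi>\<close> are polar coordinates about one end of a segment of length \<open>t\<close> and
  \<open>third_side\<close> is the distance from the other end; the theorem says that reflecting the plane
  in the perpendicular bisector of the segment preserves the measure. The proof uses the symmetric
  kernel instead, and for \<open>\<alpha> = - 1 / 2\<close> translations and reflections of the line.
\<close>

lemma nn_integral_third_side_swap:
  assumes a: "\<alpha> \<ge> - 1 / 2" and t: "t \<ge> 0"
    and [measurable]: "case_prod H \<in> borel_measurable (borel \<Otimes>\<^sub>M borel)"
  shows "(\<integral>\<^sup>+s. \<integral>\<^sup>+\<phi>. H s (third_side t s \<phi>) \<partial>angle_measure \<alpha> \<partial>radial_measure \<alpha>) =
    (\<integral>\<^sup>+s. \<integral>\<^sup>+\<phi>. H (third_side t s \<phi>) s \<partial>angle_measure \<alpha> \<partial>radial_measure \<alpha>)"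
proof -
  interpret A: prob_space "angle_measure \<alpha>" using a by (rule prob_space_angle_measure)
  consider "t = 0" | "\<alpha> = - 1 / 2" "t > 0" | "\<alpha> > - 1 / 2" "t > 0" using a t by linarith
  then show ?thesis
  proof cases
    case 1
    have "(\<integral>\<^sup>+s. \<integral>\<^sup>+\<phi>. H s (third_side t s \<phi>) \<partial>angle_measure \<alpha> \<partial>radial_measure \<alpha>) =
        (\<integral>\<^sup>+s. \<integral>\<^sup>+\<phi>. H s s \<partial>angle_measure \<alpha> \<partial>radial_measure \<alpha>)"
      using AE_radial_measure_pos[of \<alpha>] by (intro nn_integral_cong_AE) (auto simp: 1 elim!: eventually_mono)
    also have "\<dots> = (\<integral>\<^sup>+s. \<integral>\<^sup>+\<phi>. H (third_side t s \<phi>) s \<partial>angle_measure \<alpha> \<partial>radial_measure \<alpha>)"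
      using AE_radial_measure_pos[of \<alpha>] by (intro nn_integral_cong_AE) (auto simp: 1 elim!: eventually_mono)
    finally show ?thesis .
  next
    case 2
    \<comment> \<open>The substitution \<open>s + t\<close> for \<open>s\<close> turns the part with third side \<open>s - t\<close> into that with third side
      \<open>s + t\<close> and the arguments exchanged. On the part with third side \<open>t - s\<close> the reflection \<open>s \<mapsto> t - s\<close>
      exchanges them.\<close>
    let ?I = "\<lambda>K. \<integral>\<^sup>+s. indicator {0<..<t} s * K s (t - s) \<partial>lborel"
    let ?J = "\<lambda>K. \<integral>\<^sup>+s. indicator {0<..} s * K s (s + t) \<partial>lborel"
    have *: "(\<integral>\<^sup>+s. \<integral>\<^sup>+\<phi>. K s (third_side t s \<phi>) \<partial>angle_measure \<alpha> \<partial>radial_measure \<alpha>) =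
        (?I K + ?J (\<lambda>x y. K y x) + ?J K) / 2"
      if K [measurable]: "case_prod K \<in> borel_measurable (borel \<Otimes>\<^sub>M borel)" for K :: "real \<Rightarrow> real \<Rightarrow> ennreal"
    proof -
      have "(\<integral>\<^sup>+s. \<integral>\<^sup>+\<phi>. K s (third_side t s \<phi>) \<partial>angle_measure \<alpha> \<partial>radial_measure \<alpha>) =
          (\<integral>\<^sup>+s. ennreal (indicator {0<..} s * s powr (2 * \<alpha> + 1)) * ((K s \<bar>s - t\<bar> + K s \<bar>s + t\<bar>) / 2) \<partial>lborel)"
        unfolding 2(1) by (simp add: nn_integral_angle_measure_half nn_integral_radial_measure third_side_0_angle third_side_pi)
      also have "\<dots> = (\<integral>\<^sup>+s. (indicator {0<..<t} s * K s (t - s) + indicator {t<..} s * K s (s - t) + indicator {0<..} s * K s (s + t)) / 2 \<partial>lborel)"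
        using AE_lborel_singleton[of t] 2
        by (intro nn_integral_cong_AE) (auto simp: indicator_def elim!: eventually_mono)
      also have "\<dots> = (?I K + (\<integral>\<^sup>+s. indicator {t<..} s * K s (s - t) \<partial>lborel) + ?J K) / 2"
        by (simp add: nn_integral_divide nn_integral_add)
      also have "(\<integral>\<^sup>+s. indicator {t<..} s * K s (s - t) \<partial>lborel) = ?J (\<lambda>x y. K y x)"
        by (subst nn_integral_real_affine[where c = 1 and t = t])
          (auto simp: indicator_def add.commute intro!: nn_integral_cong)
      finally show ?thesis .
    qed
    have "?I H = ?I (\<lambda>x y. H y x)"
      by (subst nn_integral_real_affine[where c = "-1" and t = t])
        (auto simp: indicator_def intro!: nn_integral_cong)
    then show ?thesis using *[of H] *[of "\<lambda>x y. H y x"] by (simp add: add_ac)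
  next
    case 3
    have *: "(\<integral>\<^sup>+s. \<integral>\<^sup>+\<phi>. K s (third_side t s \<phi>) \<partial>angle_measure \<alpha> \<partial>radial_measure \<alpha>) =
        (\<integral>\<^sup>+s. \<integral>\<^sup>+r. ennreal (triangle_kernel \<alpha> t s r) * K s r \<partial>lborel \<partial>lborel)"
      if K [measurable]: "case_prod K \<in> borel_measurable (borel \<Otimes>\<^sub>M borel)" for K :: "real \<Rightarrow> real \<Rightarrow> ennreal"
    proof -
      have "(\<integral>\<^sup>+s. \<integral>\<^sup>+\<phi>. K s (third_side t s \<phi>) \<partial>angle_measure \<alpha> \<partial>radial_measure \<alpha>) =
          (\<integral>\<^sup>+s. ennreal (indicator {0<..} s * s powr (2 * \<alpha> + 1)) * (\<integral>\<^sup>+\<phi>. K s (third_side t s \<phi>) \<partial>angle_measure \<alpha>) \<partial>lborel)"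
        by (rule nn_integral_radial_measure) measurable
      also have "\<dots> = (\<integral>\<^sup>+s. \<integral>\<^sup>+r. ennreal (triangle_kernel \<alpha> t s r) * K s r \<partial>lborel \<partial>lborel)"
      proof (rule nn_integral_cong_AE, use AE_lborel_singleton[of t] in eventually_elim)
        case (elim s)
        show ?case
        proof (cases "s > 0")
          case True
          then show ?thesis
            using nn_integral_third_side[OF 3(1) True 3(2) elim, of "K s"] by simp
        qed (simp add: triangle_kernel_def)
      qed
      finally show ?thesis .
    qed
    have "(\<integral>\<^sup>+s. \<integral>\<^sup>+r. ennreal (triangle_kernel \<alpha> t s r) * H s r \<partial>lborel \<partial>lborel) =
        (\<integral>\<^sup>+r. \<integral>\<^sup>+s. ennreal (triangle_kernel \<alpha> t s r) * H s r \<partial>lborel \<partial>lborel)"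
      by (rule lborel_pair.Fubini') measurable
    also have "\<dots> = (\<integral>\<^sup>+s. \<integral>\<^sup>+r. ennreal (triangle_kernel \<alpha> t s r) * H r s \<partial>lborel \<partial>lborel)"
      by (simp only: triangle_kernel_sym)
    finally show ?thesis using *[of H] *[of "\<lambda>x y. H y x"] by simp
  qed
qed

text \<open>
  The form which \<open>bessel_translation\<close> takes on Borel functions, uniformly in \<open>\<alpha>\<close>; the two are compared in
  \<open>bessel_translation_eq_translate\<close>.
\<close>

definition translate :: "real \<Rightarrow> real \<Rightarrow> (real \<Rightarrow> complex) \<Rightarrow> real \<Rightarrow> complex" where
  "translate \<alpha> t f s = (\<integral>\<phi>. f (third_side t s \<phi>) \<partial>angle_measure \<alpha>)"

lemma borel_measurable_translate [measurable]:
  assumes "\<alpha> \<ge> - 1 / 2" and [measurable]: "f \<in> borel_measurable borel"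
  shows "translate \<alpha> t f \<in> borel_measurable borel"
proof -
  interpret prob_space "angle_measure \<alpha>" using assms(1) by (rule prob_space_angle_measure)
  show ?thesis unfolding translate_def by measurable
qed

lemma nn_integral_translate:
  assumes a: "\<alpha> \<ge> - 1 / 2" and "t \<ge> 0" and [measurable]: "F \<in> borel_measurable borel"
  shows "(\<integral>\<^sup>+s. \<integral>\<^sup>+\<phi>. F (third_side t s \<phi>) \<partial>angle_measure \<alpha> \<partial>radial_measure \<alpha>) = (\<integral>\<^sup>+s. F s \<partial>radial_measure \<alpha>)"
proof -
  interpret prob_space "angle_measure \<alpha>" using a by (rule prob_space_angle_measure)
  have "(\<integral>\<^sup>+s. \<integral>\<^sup>+\<phi>. F (third_side t s \<phi>) \<partial>angle_measure \<alpha> \<partial>radial_measure \<alpha>) =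
      (\<integral>\<^sup>+s. \<integral>\<^sup>+\<phi>. F s \<partial>angle_measure \<alpha> \<partial>radial_measure \<alpha>)"
    using nn_integral_third_side_swap[OF assms(1,2), of "\<lambda>s r. F r"] by simp
  then show ?thesis using emeasure_space_1 by simp
qed

lemma AE_third_side:
  assumes "\<alpha> \<ge> - 1 / 2" and "t \<ge> 0" and P: "AE x in radial_measure \<alpha>. P x"
  shows "AE s in radial_measure \<alpha>. AE \<phi> in angle_measure \<alpha>. P (third_side t s \<phi>)"
proof -
  interpret prob_space "angle_measure \<alpha>" using assms(1) by (rule prob_space_angle_measure)
  obtain N where N: "N \<in> null_sets (radial_measure \<alpha>)" "\<And>x. x \<in> space (radial_measure \<alpha>) - N \<Longrightarrow> P x"
    using AE_E3[OF P] by metis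
  then have [measurable]: "N \<in> sets borel" by (auto simp: null_sets_def)
  have "(\<integral>\<^sup>+s. \<integral>\<^sup>+\<phi>. indicator N (third_side t s \<phi>) \<partial>angle_measure \<alpha> \<partial>radial_measure \<alpha>) = 0"
    using N by (subst nn_integral_translate[OF assms(1,2)]) auto
  then have "AE s in radial_measure \<alpha>. (\<integral>\<^sup>+\<phi>. indicator N (third_side t s \<phi>) \<partial>angle_measure \<alpha>) = 0"
    by (subst (asm) nn_integral_0_iff_AE) auto
  then show ?thesis
  proof eventually_elim
    case (elim s)
    then have "AE \<phi> in angle_measure \<alpha>. (indicator N (third_side t s \<phi>) :: ennreal) = 0"
      by (subst (asm) nn_integral_0_iff_AE) auto
    then show ?case
      by eventually_elim (use N in \<open>auto simp: indicator_eq_0_iff\<close>)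
  qed
qed

text \<open>The symmetry as an equality of image measures, from which it passes to signed integrands.\<close>

lemma distr_third_side_swap:
  assumes a: "\<alpha> \<ge> - 1 / 2" and t: "t \<ge> 0"
  shows "distr (radial_measure \<alpha> \<Otimes>\<^sub>M angle_measure \<alpha>) (borel \<Otimes>\<^sub>M borel) (\<lambda>(s, \<phi>). (s, third_side t s \<phi>)) =
    distr (radial_measure \<alpha> \<Otimes>\<^sub>M angle_measure \<alpha>) (borel \<Otimes>\<^sub>M borel) (\<lambda>(s, \<phi>). (third_side t s \<phi>, s))"
    (is "distr ?M ?N ?f = distr ?M ?N ?g")
proof (rule measure_eqI)
  interpret A: prob_space "angle_measure \<alpha>" using a by (rule prob_space_angle_measure)
  fix X assume "X \<in> sets (distr ?M ?N ?f)"
  then have [measurable]: "X \<in> sets (borel \<Otimes>\<^sub>M borel)" by simp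
  have f [measurable]: "?f \<in> ?M \<rightarrow>\<^sub>M ?N" and g [measurable]: "?g \<in> ?M \<rightarrow>\<^sub>M ?N" by measurable
  have "emeasure (distr ?M ?N h) X = (\<integral>\<^sup>+s. \<integral>\<^sup>+\<phi>. indicator X (h (s, \<phi>)) \<partial>angle_measure \<alpha> \<partial>radial_measure \<alpha>)"
    if [measurable]: "h \<in> ?M \<rightarrow>\<^sub>M ?N" for h
  proof -
    have "emeasure (distr ?M ?N h) X = (\<integral>\<^sup>+x. indicator X x \<partial>distr ?M ?N h)" by simp
    also have "\<dots> = (\<integral>\<^sup>+z. indicator X (h z) \<partial>?M)" by (rule nn_integral_distr) measurable
    finally show ?thesis by (simp add: A.nn_integral_fst[symmetric])
  qed
  from this[OF f] this[OF g] show "emeasure (distr ?M ?N ?f) X = emeasure (distr ?M ?N ?g) X"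
    using nn_integral_third_side_swap[OF assms, of "\<lambda>x y. indicator X (x, y)"] by simp
qed simp

text \<open>
  The exchanges of integrals for the transform are of this kind: a bounded kernel stands between
  two integrable functions.
\<close>

lemma (in pair_sigma_finite) integrable_bounded_kernel:
  fixes f :: "'a \<Rightarrow> complex" and g :: "'b \<Rightarrow> complex" and k :: "'a \<Rightarrow> 'b \<Rightarrow> complex"
  assumes f: "integrable M1 f" and g: "integrable M2 g"
    and [measurable]: "case_prod k \<in> borel_measurable (M1 \<Otimes>\<^sub>M M2)" and B: "\<And>x y. norm (k x y) \<le> B"
  shows "integrable (M1 \<Otimes>\<^sub>M M2) (\<lambda>(x, y). f x * g y * k x y)"
proof -
  have [measurable]: "f \<in> borel_measurable M1" "g \<in> borel_measurable M2"
    using f g by (auto simp: borel_measurable_integrable)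
  have "integrable (M1 \<Otimes>\<^sub>M M2) (\<lambda>(x, y). f x * g y)"
    by (rule Fubini_integrable) (use f g in \<open>auto simp: norm_mult\<close>)
  then have "integrable (M1 \<Otimes>\<^sub>M M2) (\<lambda>z. complex_of_real B * (case z of (x, y) \<Rightarrow> f x * g y))"
    by (rule integrable_mult_right)
  then show ?thesis
  proof (rule Bochner_Integration.integrable_bound)
    have "norm (f x * g y * k x y) \<le> norm (of_real B * (f x * g y))" for x y
    proof -
      have "norm (f x * g y) * norm (k x y) \<le> norm (f x * g y) * \<bar>B\<bar>"
        using B[of x y] by (intro mult_left_mono) auto
      then show ?thesis by (simp add: norm_mult mult_ac)
    qed
    then show "AE z in M1 \<Otimes>\<^sub>M M2. norm (case z of (x, y) \<Rightarrow> f x * g y * k x y) \<le>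
        norm (complex_of_real B * (case z of (x, y) \<Rightarrow> f x * g y))"
      by auto
  qed measurable
qed

lemma (in pair_sigma_finite) Fubini_bounded_kernel:
  fixes f :: "'a \<Rightarrow> complex" and g :: "'b \<Rightarrow> complex" and k :: "'a \<Rightarrow> 'b \<Rightarrow> complex"
  assumes "integrable M1 f" "integrable M2 g"
    and "case_prod k \<in> borel_measurable (M1 \<Otimes>\<^sub>M M2)" "\<And>x y. norm (k x y) \<le> B"
  shows "(\<integral>y. \<integral>x. f x * g y * k x y \<partial>M1 \<partial>M2) = (\<integral>x. \<integral>y. f x * g y * k x y \<partial>M2 \<partial>M1)"
  using Fubini_integral[OF integrable_bounded_kernel[OF assms]] by simp

lemma translate_self_adjoint:
  assumes a: "\<alpha> \<ge> - 1 / 2" and t: "t \<ge> 0"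
    and f: "integrable (radial_measure \<alpha>) f"
    and [measurable]: "g \<in> borel_measurable borel" and g: "\<And>x. norm (g x) \<le> B"
  shows "(\<integral>s. translate \<alpha> t f s * g s \<partial>radial_measure \<alpha>) = (\<integral>s. f s * translate \<alpha> t g s \<partial>radial_measure \<alpha>)"
proof -
  interpret A: prob_space "angle_measure \<alpha>" using a by (rule prob_space_angle_measure)
  interpret R: sigma_finite_measure "radial_measure \<alpha>" by (rule sigma_finite_radial_measure)
  interpret P: pair_sigma_finite "radial_measure \<alpha>" "angle_measure \<alpha>" ..
  let ?M = "radial_measure \<alpha> \<Otimes>\<^sub>M angle_measure \<alpha>"
  have [measurable]: "f \<in> borel_measurable borel"
    using borel_measurable_integrable[OF f] by (simp cong: measurable_cong_sets)
  have swap: "(\<integral>(s, \<phi>). F (s, third_side t s \<phi>) \<partial>?M) = (\<integral>(s, \<phi>). F (third_side t s \<phi>, s) \<partial>?M)"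
    "integrable ?M (\<lambda>(s, \<phi>). F (s, third_side t s \<phi>)) \<longleftrightarrow> integrable ?M (\<lambda>(s, \<phi>). F (third_side t s \<phi>, s))"
    if [measurable]: "F \<in> borel_measurable (borel \<Otimes>\<^sub>M borel)" for F :: "real \<times> real \<Rightarrow> complex"
  proof -
    have m: "(\<lambda>(s, \<phi>). (s, third_side t s \<phi>)) \<in> ?M \<rightarrow>\<^sub>M borel \<Otimes>\<^sub>M borel"
      "(\<lambda>(s, \<phi>). (third_side t s \<phi>, s)) \<in> ?M \<rightarrow>\<^sub>M borel \<Otimes>\<^sub>M borel" by measurable
    note e = distr_third_side_swap[OF a t]
    show "(\<integral>(s, \<phi>). F (s, third_side t s \<phi>) \<partial>?M) = (\<integral>(s, \<phi>). F (third_side t s \<phi>, s) \<partial>?M)"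
      using integral_distr[OF m(1) that] integral_distr[OF m(2) that] unfolding e
      by (simp add: case_prod_unfold)
    show "integrable ?M (\<lambda>(s, \<phi>). F (s, third_side t s \<phi>)) \<longleftrightarrow> integrable ?M (\<lambda>(s, \<phi>). F (third_side t s \<phi>, s))"
      using integrable_distr_eq[OF m(1) that] integrable_distr_eq[OF m(2) that] unfolding e
      by (simp add: case_prod_unfold)
  qed
  have i2: "integrable ?M (\<lambda>(s, \<phi>). f s * g (third_side t s \<phi>))"
    using P.integrable_bounded_kernel[OF f, of "\<lambda>_. 1" "\<lambda>s \<phi>. g (third_side t s \<phi>)" B] g by simp
  then have i1: "integrable ?M (\<lambda>(s, \<phi>). f (third_side t s \<phi>) * g s)"
    using swap(2)[of "\<lambda>(x, y). f x * g y"] by simp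
  have "(\<integral>s. translate \<alpha> t f s * g s \<partial>radial_measure \<alpha>) =
      (\<integral>s. \<integral>\<phi>. f (third_side t s \<phi>) * g s \<partial>angle_measure \<alpha> \<partial>radial_measure \<alpha>)"
    by (simp add: translate_def)
  also have "\<dots> = (\<integral>(s, \<phi>). f (third_side t s \<phi>) * g s \<partial>?M)"
    using P.integral_fst[OF i1] by simp
  also have "\<dots> = (\<integral>(s, \<phi>). f s * g (third_side t s \<phi>) \<partial>?M)"
    using swap(1)[of "\<lambda>(x, y). f x * g y"] by simp
  also have "\<dots> = (\<integral>s. \<integral>\<phi>. f s * g (third_side t s \<phi>) \<partial>angle_measure \<alpha> \<partial>radial_measure \<alpha>)"
    using P.integral_fst[OF i2] by simp
  also have "\<dots> = (\<integral>s. f s * translate \<alpha> t g s \<partial>radial_measure \<alpha>)"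
    by (simp add: translate_def)
  finally show ?thesis .
qed

section \<open>The Hankel transform on integrable functions\<close>

lemma norm_integral_le_nn_integral: "ennreal (norm (\<integral>x. f x \<partial>M)) \<le> (\<integral>\<^sup>+x. ennreal (norm (f x)) \<partial>M)"
  by (cases "integrable M f") (auto simp: integral_norm_bound_ennreal not_integrable_integral_eq)

definition hankel_const :: "real \<Rightarrow> real" where
  "hankel_const \<alpha> = 1 / (2 powr \<alpha> * Gamma (\<alpha> + 1))"

text \<open>
  The form which \<open>hankel_integral\<close> takes on Borel functions; the two are compared in
  \<open>hankel_integral_eq_radial_hankel\<close>.
\<close>

definition radial_hankel :: "real \<Rightarrow> (real \<Rightarrow> complex) \<Rightarrow> real \<Rightarrow> complex" where
  "radial_hankel \<alpha> f y = of_real (hankel_const \<alpha>) * (\<integral>x. f x * of_real (poisson_j \<alpha> (x * y)) \<partial>radial_measure \<alpha>)"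

lemma hankel_const_pos: "\<alpha> \<ge> - 1 / 2 \<Longrightarrow> hankel_const \<alpha> > 0"
  by (auto simp: hankel_const_def intro!: divide_pos_pos mult_pos_pos Gamma_real_pos)

lemma borel_measurable_radial_iff [simp]: "f \<in> borel_measurable (radial_measure \<alpha>) \<longleftrightarrow> f \<in> borel_measurable borel"
  by (simp cong: measurable_cong_sets)

lemma integrable_mult_bounded:
  fixes f g :: "real \<Rightarrow> complex"
  assumes "integrable (radial_measure \<alpha>) f" and [measurable]: "g \<in> borel_measurable borel" and B: "\<And>x. norm (g x) \<le> B"
  shows "integrable (radial_measure \<alpha>) (\<lambda>x. f x * g x)"
proof (rule Bochner_Integration.integrable_bound[OF integrable_mult_right[OF assms(1), of "of_real B"]])
  show "(\<lambda>x. f x * g x) \<in> borel_measurable (radial_measure \<alpha>)"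
    using borel_measurable_integrable[OF assms(1)] by measurable
  show "AE x in radial_measure \<alpha>. norm (f x * g x) \<le> norm (complex_of_real B * f x)"
  proof (rule AE_I2)
    fix x
    have "norm (f x) * norm (g x) \<le> norm (f x) * \<bar>B\<bar>" using B[of x] by (intro mult_left_mono) auto
    then show "norm (f x * g x) \<le> norm (complex_of_real B * f x)" by (simp add: norm_mult mult.commute)
  qed
qed

context
  fixes \<alpha> :: real
  assumes \<alpha>: "\<alpha> \<ge> - 1 / 2"
begin

interpretation A: prob_space "angle_measure \<alpha>" using \<alpha> by (rule prob_space_angle_measure)
interpretation R: sigma_finite_measure "radial_measure \<alpha>" by (rule sigma_finite_radial_measure)
interpretation RR: pair_sigma_finite "radial_measure \<alpha>" "radial_measure \<alpha>" ..
interpretation RA: pair_sigma_finite "radial_measure \<alpha>" "angle_measure \<alpha>" ..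

lemmas [measurable] = borel_measurable_poisson_j[OF \<alpha>] borel_measurable_translate[OF \<alpha>]

lemma integrable_hankel_kernel:
  fixes f :: "real \<Rightarrow> complex"
  shows "integrable (radial_measure \<alpha>) f \<Longrightarrow> integrable (radial_measure \<alpha>) (\<lambda>x. f x * of_real (poisson_j \<alpha> (x * y)))"
  by (rule integrable_mult_bounded[where B = 1]) (auto simp: abs_poisson_j_le_1[OF \<alpha>])

lemma borel_measurable_radial_hankel [measurable]:
  assumes [measurable]: "f \<in> borel_measurable borel"
  shows "radial_hankel \<alpha> f \<in> borel_measurable borel"
  unfolding radial_hankel_def by measurable

lemma norm_radial_hankel_le:
  assumes f: "integrable (radial_measure \<alpha>) f"
  shows "norm (radial_hankel \<alpha> f y) \<le> hankel_const \<alpha> * (\<integral>x. norm (f x) \<partial>radial_measure \<alpha>)"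
proof -
  have "norm (\<integral>x. f x * of_real (poisson_j \<alpha> (x * y)) \<partial>radial_measure \<alpha>) \<le>
      (\<integral>x. norm (f x * of_real (poisson_j \<alpha> (x * y))) \<partial>radial_measure \<alpha>)"
    by (rule integral_norm_bound)
  also have "\<dots> \<le> (\<integral>x. norm (f x) \<partial>radial_measure \<alpha>)"
    by (intro integral_mono integrable_norm integrable_hankel_kernel f)
      (simp add: norm_mult mult_left_le abs_poisson_j_le_1[OF \<alpha>])
  finally show ?thesis
    using hankel_const_pos[OF \<alpha>] by (simp add: radial_hankel_def norm_mult mult_left_mono)
qed

lemma radial_hankel_diff:
  "integrable (radial_measure \<alpha>) f \<Longrightarrow> integrable (radial_measure \<alpha>) g \<Longrightarrow>
    radial_hankel \<alpha> (\<lambda>x. f x - g x) y = radial_hankel \<alpha> f y - radial_hankel \<alpha> g y"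
  by (simp add: radial_hankel_def left_diff_distrib right_diff_distrib integrable_hankel_kernel)

lemma radial_hankel_add:
  "integrable (radial_measure \<alpha>) f \<Longrightarrow> integrable (radial_measure \<alpha>) g \<Longrightarrow>
    radial_hankel \<alpha> (\<lambda>x. f x + g x) y = radial_hankel \<alpha> f y + radial_hankel \<alpha> g y"
  by (simp add: radial_hankel_def distrib_right distrib_left integrable_hankel_kernel)

text \<open>The intertwining relations below are the product formula under an integral sign.\<close>

lemma translate_poisson_j:
  assumes "y \<ge> 0"
  shows "(\<integral>\<phi>. poisson_j \<alpha> (y * third_side t s \<phi>) \<partial>angle_measure \<alpha>) = poisson_j \<alpha> (y * t) * poisson_j \<alpha> (y * s)"
  using poisson_j_product[OF \<alpha>, of "y * t" "y * s"] by (simp add: third_side_scale[OF assms])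

lemma translate_radial_hankel:
  assumes f: "integrable (radial_measure \<alpha>) f"
  shows "translate \<alpha> t (radial_hankel \<alpha> f) s = radial_hankel \<alpha> (\<lambda>x. of_real (poisson_j \<alpha> (x * t)) * f x) s"
proof -
  have [measurable]: "f \<in> borel_measurable borel" using borel_measurable_integrable[OF f] by simp
  have "(\<integral>\<phi>. \<integral>x. f x * 1 * of_real (poisson_j \<alpha> (x * third_side t s \<phi>)) \<partial>radial_measure \<alpha> \<partial>angle_measure \<alpha>) =
      (\<integral>x. \<integral>\<phi>. f x * 1 * of_real (poisson_j \<alpha> (x * third_side t s \<phi>)) \<partial>angle_measure \<alpha> \<partial>radial_measure \<alpha>)"
    by (rule RA.Fubini_bounded_kernel[OF f, where B = 1]) (auto simp: abs_poisson_j_le_1[OF \<alpha>])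
  also have "\<dots> = (\<integral>x. f x * of_real (poisson_j \<alpha> (x * t) * poisson_j \<alpha> (x * s)) \<partial>radial_measure \<alpha>)"
  proof (rule integral_cong_AE)
    show "AE x in radial_measure \<alpha>. (\<integral>\<phi>. f x * 1 * of_real (poisson_j \<alpha> (x * third_side t s \<phi>)) \<partial>angle_measure \<alpha>) =
        f x * of_real (poisson_j \<alpha> (x * t) * poisson_j \<alpha> (x * s))"
      using AE_radial_measure_pos
      by eventually_elim (simp add: translate_poisson_j[symmetric])
  qed measurable
  finally show ?thesis
    by (simp add: translate_def radial_hankel_def mult_ac)
qed

lemma radial_hankel_translate:
  assumes t: "t \<ge> 0" and y: "y \<ge> 0" and f: "integrable (radial_measure \<alpha>) f"
  shows "radial_hankel \<alpha> (translate \<alpha> t f) y = of_real (poisson_j \<alpha> (t * y)) * radial_hankel \<alpha> f y"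
proof -
  have "(\<integral>x. translate \<alpha> t f x * of_real (poisson_j \<alpha> (x * y)) \<partial>radial_measure \<alpha>) =
      (\<integral>x. f x * translate \<alpha> t (\<lambda>x. of_real (poisson_j \<alpha> (x * y))) x \<partial>radial_measure \<alpha>)"
    by (rule translate_self_adjoint[OF \<alpha> t f, where B = 1]) (auto simp: abs_poisson_j_le_1[OF \<alpha>])
  also have "translate \<alpha> t (\<lambda>x. of_real (poisson_j \<alpha> (x * y))) = (\<lambda>x. of_real (poisson_j \<alpha> (t * y) * poisson_j \<alpha> (x * y)))"
    using translate_poisson_j[OF y] by (simp add: translate_def fun_eq_iff mult.commute[of _ y])
  finally show ?thesis
    by (simp add: radial_hankel_def mult.left_commute[of _ "complex_of_real (poisson_j \<alpha> (t * y))"])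
qed

lemma radial_hankel_multiplication:
  assumes f: "integrable (radial_measure \<alpha>) f" and g: "integrable (radial_measure \<alpha>) g"
  shows "(\<integral>y. radial_hankel \<alpha> f y * g y \<partial>radial_measure \<alpha>) = (\<integral>x. f x * radial_hankel \<alpha> g x \<partial>radial_measure \<alpha>)"
proof -
  have "(\<integral>y. \<integral>x. f x * g y * of_real (poisson_j \<alpha> (x * y)) \<partial>radial_measure \<alpha> \<partial>radial_measure \<alpha>) =
      (\<integral>x. \<integral>y. f x * g y * of_real (poisson_j \<alpha> (x * y)) \<partial>radial_measure \<alpha> \<partial>radial_measure \<alpha>)"
    by (rule RR.Fubini_bounded_kernel[OF f g, where B = 1]) (auto simp: abs_poisson_j_le_1[OF \<alpha>])
  moreover have "radial_hankel \<alpha> f y * g y =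
      of_real (hankel_const \<alpha>) * (\<integral>x. f x * g y * of_real (poisson_j \<alpha> (x * y)) \<partial>radial_measure \<alpha>)" for y
    unfolding radial_hankel_def mult.assoc[of "complex_of_real (hankel_const \<alpha>)"]
    by (subst integral_mult_left_zero[symmetric]) (simp add: mult_ac)
  moreover have "f x * radial_hankel \<alpha> g x =
      of_real (hankel_const \<alpha>) * (\<integral>y. f x * g y * of_real (poisson_j \<alpha> (x * y)) \<partial>radial_measure \<alpha>)" for x
    unfolding radial_hankel_def mult.left_commute[of "f x"]
    by (subst integral_mult_right_zero[symmetric]) (simp add: mult_ac)
  ultimately show ?thesis by simp
qed

end

section \<open>The Gaussian and the bound on square integrable functions\<close>

text \<open>The substitution \<open>t = \<epsilon> y\<^sup>2\<close> in Euler's integral for the Gamma function.\<close>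

lemma gaussian_moment:
  assumes a: "\<alpha> \<ge> - 1 / 2" and e: "\<epsilon> > 0"
  shows "has_bochner_integral (radial_measure \<alpha>) (\<lambda>y. y ^ (2 * k) * exp (- \<epsilon> * y\<^sup>2))
    (Gamma (\<alpha> + 1 + k) / (2 * \<epsilon> powr (\<alpha> + 1 + k)))"
proof -
  define \<beta> where "\<beta> = \<alpha> + 1 + k"
  have b: "\<beta> > 0" using a by (simp add: \<beta>_def)
  define f where "f t = t powr (\<beta> - 1) / exp t" for t :: real
  let ?g = "\<lambda>y::real. \<epsilon> * y\<^sup>2"
  have im: "?g ` {0<..} = {0<..}"
  proof (intro antisym subsetI)
    fix x :: real assume "x \<in> {0<..}"
    then have "x = ?g (sqrt (x / \<epsilon>))" "sqrt (x / \<epsilon>) \<in> {0<..}" using e by simp_all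
    then show "x \<in> ?g ` {0<..}" by blast
  qed (use e in auto)
  have "(f has_integral Gamma \<beta>) {0..}" unfolding f_def by (rule Gamma_integral_real[OF b])
  then have "(f has_integral Gamma \<beta>) {0<..}"
    by (subst has_integral_spike_set_eq[of _ "{0..}"])
      (auto intro: empty_imp_negligible negligible_subset[of "{0::real}"])
  then have "f absolutely_integrable_on ?g ` {0<..} \<and> integral (?g ` {0<..}) f = Gamma \<beta>"
    unfolding im has_integral_iff by (auto intro!: nonnegative_absolutely_integrable_1 simp: f_def)
  then have "(\<lambda>y. \<bar>2 * \<epsilon> * y\<bar> * f (?g y)) absolutely_integrable_on {0<..} \<and>
      integral {0<..} (\<lambda>y. \<bar>2 * \<epsilon> * y\<bar> * f (?g y)) = Gamma \<beta>"
    by (subst has_absolute_integral_change_of_variables_1')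
      (use e in \<open>auto intro!: derivative_eq_intros simp: inj_on_def\<close>)
  then have "set_integrable lborel {0<..} (\<lambda>y. \<bar>2 * \<epsilon> * y\<bar> * f (?g y)) \<and>
      (LBINT y:{0<..}. \<bar>2 * \<epsilon> * y\<bar> * f (?g y)) = Gamma \<beta>"
  proof -
    have m: "(\<lambda>y. indicator {0<..} y *\<^sub>R (\<bar>2 * \<epsilon> * y\<bar> * f (?g y))) \<in> borel_measurable lborel"
      unfolding f_def by measurable
    assume h: "(\<lambda>y. \<bar>2 * \<epsilon> * y\<bar> * f (?g y)) absolutely_integrable_on {0<..} \<and>
      integral {0<..} (\<lambda>y. \<bar>2 * \<epsilon> * y\<bar> * f (?g y)) = Gamma \<beta>"
    then have i: "set_integrable lborel {0<..} (\<lambda>y. \<bar>2 * \<epsilon> * y\<bar> * f (?g y))"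
      using m by (simp add: set_integrable_def integrable_completion)
    then show ?thesis using set_borel_integral_eq_integral(2)[OF i] h by simp
  qed
  then have hb: "has_bochner_integral lborel (\<lambda>y. indicator {0<..} y *\<^sub>R (\<bar>2 * \<epsilon> * y\<bar> * f (?g y))) (Gamma \<beta>)"
    by (simp add: has_bochner_integral_iff set_integrable_def set_lebesgue_integral_def)
  have "has_bochner_integral lborel
      (\<lambda>y. (1 / (2 * \<epsilon> powr \<beta>)) * (indicator {0<..} y *\<^sub>R (\<bar>2 * \<epsilon> * y\<bar> * f (?g y)))) ((1 / (2 * \<epsilon> powr \<beta>)) * Gamma \<beta>)"
    by (rule has_bochner_integral_mult_right[OF hb])
  also have "(\<lambda>y. (1 / (2 * \<epsilon> powr \<beta>)) * (indicator {0<..} y *\<^sub>R (\<bar>2 * \<epsilon> * y\<bar> * f (?g y)))) =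
      (\<lambda>y. (indicator {0<..} y * y powr (2 * \<alpha> + 1)) *\<^sub>R (y ^ (2 * k) * exp (- \<epsilon> * y\<^sup>2)))"
  proof
    fix y :: real
    show "(1 / (2 * \<epsilon> powr \<beta>)) * (indicator {0<..} y *\<^sub>R (\<bar>2 * \<epsilon> * y\<bar> * f (?g y))) =
        (indicator {0<..} y * y powr (2 * \<alpha> + 1)) *\<^sub>R (y ^ (2 * k) * exp (- \<epsilon> * y\<^sup>2))"
    proof (cases "y > 0")
      case True
      have "(\<epsilon> * y\<^sup>2) powr (\<beta> - 1) = \<epsilon> powr (\<beta> - 1) * (y powr 2) powr (\<beta> - 1)"
        using e True by (simp add: powr_mult)
      also have "\<dots> = \<epsilon> powr \<beta> / \<epsilon> * y powr (2 * (\<beta> - 1))"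
        using e by (simp add: powr_diff powr_powr)
      also have "y powr (2 * (\<beta> - 1)) = y powr (2 * \<alpha> + 1) * y ^ (2 * k) / y"
      proof -
        have "2 * (\<beta> - 1) = (2 * \<alpha> + 1) + real (2 * k) - 1" by (simp add: \<beta>_def)
        then show ?thesis using True by (simp only: powr_diff powr_add powr_realpow powr_one)
      qed
      finally show ?thesis using True e by (simp add: f_def exp_minus field_simps)
    qed simp
  qed
  finally show ?thesis
    unfolding radial_measure_def \<beta>_def
    by (subst has_bochner_integral_density) (auto simp: mult_ac)
qed


text \<open>
  Integrated termwise against the Gaussian, the series of the Bessel function becomes an
  exponential series, since the moments restore the Gamma factors in its denominators.
\<close>

lemma gaussian_hankel:
  assumes a: "\<alpha> \<ge> - 1 / 2" and e: "\<epsilon> > 0"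
  shows "(\<integral>y. poisson_j \<alpha> (x * y) * exp (- \<epsilon> * y\<^sup>2) \<partial>radial_measure \<alpha>) =
    Gamma (\<alpha> + 1) / (2 * \<epsilon> powr (\<alpha> + 1)) * exp (- x\<^sup>2 / (4 * \<epsilon>))"
proof -
  define A where "A = Gamma (\<alpha> + 1) / (2 * \<epsilon> powr (\<alpha> + 1))"
  define I where "I k = Gamma (\<alpha> + 1 + real k) / (2 * \<epsilon> powr (\<alpha> + 1 + k))" for k :: nat
  let ?f = "\<lambda>k y. bessel_coeff \<alpha> k * x ^ (2 * k) * (y ^ (2 * k) * exp (- \<epsilon> * y\<^sup>2))"
  have G: "Gamma (\<alpha> + 1) > 0" "Gamma (\<alpha> + 1 + real k) > 0" for k
    using a by (auto intro!: Gamma_real_pos)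
  have I: "bessel_coeff \<alpha> k * x ^ (2 * k) * I k = A * ((- x\<^sup>2 / (4 * \<epsilon>)) ^ k /\<^sub>R fact k)" for k
  proof -
    have p: "pochhammer (\<alpha> + 1) k = Gamma (\<alpha> + 1 + k) / Gamma (\<alpha> + 1)"
      using a by (intro pochhammer_Gamma) (auto elim!: nonpos_Ints_cases)
    have q: "\<epsilon> powr (\<alpha> + 1 + k) = \<epsilon> powr (\<alpha> + 1) * \<epsilon> ^ k"
      using e by (simp add: powr_add powr_realpow)
    have r: "(- x\<^sup>2 / (4 * \<epsilon>)) ^ k = (- 1) ^ k * x ^ (2 * k) / (4 ^ k * \<epsilon> ^ k)"
    proof -
      have "(- x\<^sup>2 / (4 * \<epsilon>)) ^ k = ((- 1) * x\<^sup>2 / (4 * \<epsilon>)) ^ k" by simp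
      then show ?thesis by (simp only: power_divide power_mult_distrib power_mult)
    qed
    have "s / (F * f * (b / a)) * X * (b / (2 * (E * d))) = a / (2 * E) * (s * X / (F * d) / f)"
      if "a > 0" "b > 0" for s F f a b X E d :: real
      using that by (simp add: mult_ac)
    from this[OF G(1) G(2)[of k], of "(- 1) ^ k" "4 ^ k" "fact k" "x ^ (2 * k)" "\<epsilon> powr (\<alpha> + 1)" "\<epsilon> ^ k"]
    show ?thesis
      unfolding bessel_coeff_def I_def A_def p q r by (simp only: real_scaleR_def divide_inverse mult_ac)
  qed
  have hb: "has_bochner_integral (radial_measure \<alpha>) (?f k) (bessel_coeff \<alpha> k * x ^ (2 * k) * I k)" for k
    unfolding I_def by (intro has_bochner_integral_mult_right gaussian_moment[OF a e])
  have n: "norm (?f k y) = \<bar>bessel_coeff \<alpha> k * x ^ (2 * k)\<bar> * (y ^ (2 * k) * exp (- \<epsilon> * y\<^sup>2))" for k y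
    by (simp add: abs_mult power_mult)
  have hn: "(\<integral>y. norm (?f k y) \<partial>radial_measure \<alpha>) = \<bar>bessel_coeff \<alpha> k * x ^ (2 * k)\<bar> * I k" for k
    unfolding n I_def using has_bochner_integral_mult_right[OF gaussian_moment[OF a e]]
    by (rule has_bochner_integral_integral_eq)
  have "(\<lambda>k. \<integral>y. ?f k y \<partial>radial_measure \<alpha>) sums (\<integral>y. (\<Sum>k. ?f k y) \<partial>radial_measure \<alpha>)"
  proof (rule sums_integral)
    show "integrable (radial_measure \<alpha>) (?f k)" for k using hb[of k] by (simp add: has_bochner_integral_iff)
    show "AE y in radial_measure \<alpha>. summable (\<lambda>k. norm (?f k y))"
    proof (rule AE_I2)
      fix y
      have "summable (\<lambda>k. \<bar>bessel_coeff \<alpha> k\<bar> * ((x * y)\<^sup>2) ^ k * exp (- \<epsilon> * y\<^sup>2))"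
        by (rule summable_mult2[OF summable_bessel_coeff[OF a]])
      moreover have "norm (?f k y) = \<bar>bessel_coeff \<alpha> k\<bar> * ((x * y)\<^sup>2) ^ k * exp (- \<epsilon> * y\<^sup>2)" for k
      proof -
        have "\<bar>x ^ (2 * k)\<bar> = x ^ (2 * k)" by (simp add: power_mult)
        then show ?thesis
          unfolding n by (simp only: abs_mult power_mult_distrib power_mult[symmetric] mult.assoc)
      qed
      ultimately show "summable (\<lambda>k. norm (?f k y))" by simp
    qed
    have "\<bar>bessel_coeff \<alpha> k * x ^ (2 * k)\<bar> * I k = \<bar>A\<bar> * (inverse (fact k) * \<bar>- x\<^sup>2 / (4 * \<epsilon>)\<bar> ^ k)" for k
    proof -
      have "I k > 0" using G(2)[of k] e by (simp add: I_def)
      then have "\<bar>bessel_coeff \<alpha> k * x ^ (2 * k)\<bar> * I k = \<bar>bessel_coeff \<alpha> k * x ^ (2 * k) * I k\<bar>"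
        by (simp add: abs_mult)
      moreover have "\<bar>A * (z ^ k /\<^sub>R fact k)\<bar> = \<bar>A\<bar> * (inverse (fact k) * \<bar>z\<bar> ^ k)" for z
        by (simp add: abs_mult power_abs)
      ultimately show ?thesis unfolding I by simp
    qed
    then show "summable (\<lambda>k. \<integral>y. norm (?f k y) \<partial>radial_measure \<alpha>)"
      unfolding hn by (simp only: summable_mult[OF summable_exp])
  qed
  moreover have "(\<integral>y. ?f k y \<partial>radial_measure \<alpha>) = A * ((- x\<^sup>2 / (4 * \<epsilon>)) ^ k /\<^sub>R fact k)" for k
    using hb[of k] unfolding I by (rule has_bochner_integral_integral_eq)
  moreover have "(\<Sum>k. ?f k y) = poisson_j \<alpha> (x * y) * exp (- \<epsilon> * y\<^sup>2)" for y
  proof -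
    have "(\<lambda>k. bessel_coeff \<alpha> k * (x * y) ^ (2 * k) * exp (- \<epsilon> * y\<^sup>2)) sums (poisson_j \<alpha> (x * y) * exp (- \<epsilon> * y\<^sup>2))"
      by (rule sums_mult2[OF poisson_j_sums[OF a]])
    then show ?thesis by (simp add: sums_iff power_mult_distrib mult.assoc)
  qed
  ultimately have "(\<lambda>k. A * ((- x\<^sup>2 / (4 * \<epsilon>)) ^ k /\<^sub>R fact k)) sums
      (\<integral>y. poisson_j \<alpha> (x * y) * exp (- \<epsilon> * y\<^sup>2) \<partial>radial_measure \<alpha>)" by simp
  moreover have "(\<lambda>k. A * ((- x\<^sup>2 / (4 * \<epsilon>)) ^ k /\<^sub>R fact k)) sums (A * exp (- x\<^sup>2 / (4 * \<epsilon>)))"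
    by (rule sums_mult[OF exp_converges])
  ultimately show ?thesis unfolding A_def by (rule sums_unique2)
qed

text \<open>Up to a constant, the heat kernel of the Bessel operator.\<close>

definition bessel_heat_kernel :: "real \<Rightarrow> real \<Rightarrow> real \<Rightarrow> real \<Rightarrow> real" where
  "bessel_heat_kernel \<alpha> \<epsilon> x x' =
     (\<integral>y. poisson_j \<alpha> (x * y) * poisson_j \<alpha> (x' * y) * exp (- \<epsilon> * y\<^sup>2) \<partial>radial_measure \<alpha>)"

text \<open>
  By the product formula the heat kernel is a translated Gaussian. Hence it is nonnegative, and
  since translation preserves integrals its total mass is that of the Gaussian. There \<open>\<epsilon>\<close> cancels.
\<close>

lemma bessel_heat_kernel_eq:
  assumes a: "\<alpha> \<ge> - 1 / 2" and e: "\<epsilon> > 0"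
  shows "bessel_heat_kernel \<alpha> \<epsilon> x x' = Gamma (\<alpha> + 1) / (2 * \<epsilon> powr (\<alpha> + 1)) *
      (\<integral>\<phi>. exp (- (third_side x x' \<phi>)\<^sup>2 / (4 * \<epsilon>)) \<partial>angle_measure \<alpha>)"
proof -
  interpret A: prob_space "angle_measure \<alpha>" using a by (rule prob_space_angle_measure)
  interpret R: sigma_finite_measure "radial_measure \<alpha>" by (rule sigma_finite_radial_measure)
  interpret RA: pair_sigma_finite "radial_measure \<alpha>" "angle_measure \<alpha>" ..
  note [measurable] = borel_measurable_poisson_j[OF a]
  have g: "integrable (radial_measure \<alpha>) (\<lambda>y. complex_of_real (exp (- \<epsilon> * y\<^sup>2)))"
    using gaussian_moment[OF a e, of 0] by (simp add: has_bochner_integral_iff)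
  have "(\<integral>\<phi>. \<integral>y. complex_of_real (exp (- \<epsilon> * y\<^sup>2)) * 1 * of_real (poisson_j \<alpha> (y * third_side x x' \<phi>)) \<partial>radial_measure \<alpha> \<partial>angle_measure \<alpha>) =
      (\<integral>y. \<integral>\<phi>. complex_of_real (exp (- \<epsilon> * y\<^sup>2)) * 1 * of_real (poisson_j \<alpha> (y * third_side x x' \<phi>)) \<partial>angle_measure \<alpha> \<partial>radial_measure \<alpha>)"
    by (rule RA.Fubini_bounded_kernel[OF g, where B = 1]) (auto simp: abs_poisson_j_le_1[OF a])
  then have "complex_of_real (\<integral>\<phi>. \<integral>y. poisson_j \<alpha> (third_side x x' \<phi> * y) * exp (- \<epsilon> * y\<^sup>2) \<partial>radial_measure \<alpha> \<partial>angle_measure \<alpha>) =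
      complex_of_real (\<integral>y. \<integral>\<phi>. exp (- \<epsilon> * y\<^sup>2) * poisson_j \<alpha> (y * third_side x x' \<phi>) \<partial>angle_measure \<alpha> \<partial>radial_measure \<alpha>)"
    unfolding mult_1_right of_real_mult[symmetric] integral_complex_of_real by (simp add: mult_ac)
  then have "(\<integral>\<phi>. \<integral>y. poisson_j \<alpha> (third_side x x' \<phi> * y) * exp (- \<epsilon> * y\<^sup>2) \<partial>radial_measure \<alpha> \<partial>angle_measure \<alpha>) =
      (\<integral>y. \<integral>\<phi>. exp (- \<epsilon> * y\<^sup>2) * poisson_j \<alpha> (y * third_side x x' \<phi>) \<partial>angle_measure \<alpha> \<partial>radial_measure \<alpha>)"
    unfolding of_real_eq_iff .
  also have "\<dots> = bessel_heat_kernel \<alpha> \<epsilon> x x'"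
    unfolding bessel_heat_kernel_def
  proof (rule integral_cong_AE)
    show "AE y in radial_measure \<alpha>. (\<integral>\<phi>. exp (- \<epsilon> * y\<^sup>2) * poisson_j \<alpha> (y * third_side x x' \<phi>) \<partial>angle_measure \<alpha>) =
        poisson_j \<alpha> (x * y) * poisson_j \<alpha> (x' * y) * exp (- \<epsilon> * y\<^sup>2)"
      using AE_radial_measure_pos by eventually_elim (simp add: translate_poisson_j[OF a] mult_ac)
  qed measurable
  finally show ?thesis
    by (simp only: gaussian_hankel[OF a e] Bochner_Integration.integral_mult_right_zero)
qed

lemma bessel_heat_kernel_nonneg:
  assumes "\<alpha> \<ge> - 1 / 2" "\<epsilon> > 0"
  shows "bessel_heat_kernel \<alpha> \<epsilon> x x' \<ge> 0"
  unfolding bessel_heat_kernel_eq[OF assms] using assms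
  by (intro mult_nonneg_nonneg divide_nonneg_nonneg integral_nonneg_AE) (auto intro!: less_imp_le[OF Gamma_real_pos])

lemma bessel_heat_kernel_sym: "bessel_heat_kernel \<alpha> \<epsilon> x x' = bessel_heat_kernel \<alpha> \<epsilon> x' x"
  by (simp add: bessel_heat_kernel_def mult.commute mult.left_commute)

lemma borel_measurable_bessel_heat_kernel [measurable]:
  assumes "\<alpha> \<ge> - 1 / 2"
  shows "case_prod (bessel_heat_kernel \<alpha> \<epsilon>) \<in> borel_measurable (borel \<Otimes>\<^sub>M borel)"
proof -
  interpret R: sigma_finite_measure "radial_measure \<alpha>" by (rule sigma_finite_radial_measure)
  note [measurable] = borel_measurable_poisson_j[OF assms]
  show ?thesis unfolding bessel_heat_kernel_def by measurable
qed

lemma bessel_heat_kernel_mass: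
  assumes a: "\<alpha> \<ge> - 1 / 2" and e: "\<epsilon> > 0" and x: "x \<ge> 0"
  shows "(\<integral>\<^sup>+x'. ennreal ((hankel_const \<alpha>)\<^sup>2 * bessel_heat_kernel \<alpha> \<epsilon> x x') \<partial>radial_measure \<alpha>) = 1"
proof -
  define A where "A = Gamma (\<alpha> + 1) / (2 * \<epsilon> powr (\<alpha> + 1))"
  have G: "Gamma (\<alpha> + 1) > 0" using a by (intro Gamma_real_pos) simp
  have A: "A > 0" using G e by (simp add: A_def)
  let ?g = "\<lambda>r. exp (- r\<^sup>2 / (4 * \<epsilon>))"
  have gm: "has_bochner_integral (radial_measure \<alpha>) ?g (Gamma (\<alpha> + 1) / (2 * (1 / (4 * \<epsilon>)) powr (\<alpha> + 1)))"
    using gaussian_moment[OF a, of "1 / (4 * \<epsilon>)" 0] e by simp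
  have "(\<integral>\<^sup>+x'. ennreal ((hankel_const \<alpha>)\<^sup>2 * bessel_heat_kernel \<alpha> \<epsilon> x x') \<partial>radial_measure \<alpha>) =
      (\<integral>\<^sup>+x'. ennreal ((hankel_const \<alpha>)\<^sup>2 * A) * (\<integral>\<^sup>+\<phi>. ennreal (?g (third_side x x' \<phi>)) \<partial>angle_measure \<alpha>) \<partial>radial_measure \<alpha>)"
  proof (rule nn_integral_cong)
    fix x'
    have "(\<integral>\<^sup>+\<phi>. ennreal (?g (third_side x x' \<phi>)) \<partial>angle_measure \<alpha>) =
        ennreal (\<integral>\<phi>. ?g (third_side x x' \<phi>) \<partial>angle_measure \<alpha>)"
      using e by (intro nn_integral_eq_integral integrable_angle_measure[OF a, where B = 1]) auto
    then show "ennreal ((hankel_const \<alpha>)\<^sup>2 * bessel_heat_kernel \<alpha> \<epsilon> x x') =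
        ennreal ((hankel_const \<alpha>)\<^sup>2 * A) * (\<integral>\<^sup>+\<phi>. ennreal (?g (third_side x x' \<phi>)) \<partial>angle_measure \<alpha>)"
      using A by (simp add: bessel_heat_kernel_eq[OF a e] A_def[symmetric] mult.assoc flip: ennreal_mult')
  qed
  also have "\<dots> = ennreal ((hankel_const \<alpha>)\<^sup>2 * A) *
      (\<integral>\<^sup>+x'. \<integral>\<^sup>+\<phi>. ennreal (?g (third_side x x' \<phi>)) \<partial>angle_measure \<alpha> \<partial>radial_measure \<alpha>)"
  proof (rule nn_integral_cmult)
    interpret A: prob_space "angle_measure \<alpha>" using a by (rule prob_space_angle_measure)
    show "(\<lambda>x'. \<integral>\<^sup>+\<phi>. ennreal (?g (third_side x x' \<phi>)) \<partial>angle_measure \<alpha>) \<in> borel_measurable (radial_measure \<alpha>)"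
      by measurable
  qed
  also have "(\<integral>\<^sup>+x'. \<integral>\<^sup>+\<phi>. ennreal (?g (third_side x x' \<phi>)) \<partial>angle_measure \<alpha> \<partial>radial_measure \<alpha>) =
      (\<integral>\<^sup>+r. ennreal (?g r) \<partial>radial_measure \<alpha>)"
    by (rule nn_integral_translate[OF a x]) measurable
  also have "\<dots> = ennreal (Gamma (\<alpha> + 1) / (2 * (1 / (4 * \<epsilon>)) powr (\<alpha> + 1)))"
    using gm by (subst nn_integral_eq_integral) (auto simp: has_bochner_integral_iff)
  also have "ennreal ((hankel_const \<alpha>)\<^sup>2 * A) * \<dots> =
      ennreal ((hankel_const \<alpha>)\<^sup>2 * A * (Gamma (\<alpha> + 1) / (2 * (1 / (4 * \<epsilon>)) powr (\<alpha> + 1))))"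
    using A G by (simp flip: ennreal_mult')
  also have "(hankel_const \<alpha>)\<^sup>2 * A * (Gamma (\<alpha> + 1) / (2 * (1 / (4 * \<epsilon>)) powr (\<alpha> + 1))) = 1"
  proof -
    have "(1 / (4 * \<epsilon>)) powr (\<alpha> + 1) = 1 / ((2 powr \<alpha>)\<^sup>2 * 4 * \<epsilon> powr (\<alpha> + 1))"
    proof -
      have "(4 :: real) powr (\<alpha> + 1) = (2 powr 2) powr (\<alpha> + 1)" by simp
      also have "\<dots> = 2 powr (\<alpha> + \<alpha> + 2)" by (simp only: powr_powr) (simp add: algebra_simps)
      also have "\<dots> = 2 powr \<alpha> * 2 powr \<alpha> * 2 powr 2" by (simp only: powr_add)
      also have "\<dots> = (2 powr \<alpha>)\<^sup>2 * 4" by (simp add: power2_eq_square)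
      finally show ?thesis using e by (simp add: powr_divide powr_mult)
    qed
    then show ?thesis
      using G e by (simp add: hankel_const_def A_def power2_eq_square)
  qed
  finally show ?thesis by simp
qed

text \<open>
  Plancherel's inequality. With a Gaussian factor inserted, the squared norm of the transform
  becomes the quadratic form of the heat kernel, and Schur's test bounds that by the mass of the
  kernel. The Gaussian is then removed by monotone convergence.
\<close>

theorem radial_hankel_L2:
  assumes a: "\<alpha> \<ge> - 1 / 2" and f: "integrable (radial_measure \<alpha>) f"
  shows "(\<integral>\<^sup>+y. ennreal ((norm (radial_hankel \<alpha> f y))\<^sup>2) \<partial>radial_measure \<alpha>) \<le>
    (\<integral>\<^sup>+x. ennreal ((norm (f x))\<^sup>2) \<partial>radial_measure \<alpha>)" (is "_ \<le> ?F")
proof -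
  interpret R: sigma_finite_measure "radial_measure \<alpha>" by (rule sigma_finite_radial_measure)
  interpret RR: pair_sigma_finite "radial_measure \<alpha>" "radial_measure \<alpha>" ..
  note [measurable] = borel_measurable_poisson_j[OF a] borel_measurable_radial_hankel[OF a] borel_measurable_bessel_heat_kernel[OF a]
  have [measurable]: "f \<in> borel_measurable borel" using borel_measurable_integrable[OF f] by simp
  define H where "H = radial_hankel \<alpha> f"
  define c where "c = hankel_const \<alpha>"
  have c: "c > 0" using hankel_const_pos[OF a] by (simp add: c_def)
  have [measurable]: "cnj \<in> borel_measurable borel"
    by (intro borel_measurable_continuous_onI continuous_intros)
  have [measurable]: "H \<in> borel_measurable borel" unfolding H_def by measurable
  have reg: "(\<integral>\<^sup>+y. ennreal ((norm (H y))\<^sup>2 * exp (- \<epsilon> * y\<^sup>2)) \<partial>radial_measure \<alpha>) \<le> ?F" if e: "\<epsilon> > 0" for \<epsilon>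
  proof -
    define K where "K x x' = c\<^sup>2 * bessel_heat_kernel \<alpha> \<epsilon> x x'" for x x'
    have K0: "K x x' \<ge> 0" for x x' using bessel_heat_kernel_nonneg[OF a e] by (simp add: K_def)
    have [measurable]: "case_prod K \<in> borel_measurable (borel \<Otimes>\<^sub>M borel)" unfolding K_def by measurable
    have g: "integrable (radial_measure \<alpha>) (\<lambda>y. complex_of_real (exp (- \<epsilon> * y\<^sup>2)))"
      using gaussian_moment[OF a e, of 0] by (simp add: has_bochner_integral_iff)
    \<comment> \<open>The multiplication formula is applied to \<open>h\<close>, for which \<open>H * h\<close> is the integrand to be bounded.\<close>
    define h where "h y = complex_of_real (exp (- \<epsilon> * y\<^sup>2)) * cnj (H y)" for y
    have h: "integrable (radial_measure \<alpha>) h"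
      unfolding h_def using norm_radial_hankel_le[OF a f]
      by (intro integrable_mult_bounded[OF g]) (auto simp: H_def[symmetric])
    have Hh: "radial_hankel \<alpha> h x = (\<integral>x'. cnj (f x') * of_real (K x x') \<partial>radial_measure \<alpha>)" for x
    proof -
      have f': "integrable (radial_measure \<alpha>) (\<lambda>x'. cnj (f x'))" using f by simp
      have "(\<integral>y. h y * of_real (poisson_j \<alpha> (y * x)) \<partial>radial_measure \<alpha>) =
          of_real c * (\<integral>y. \<integral>x'. cnj (f x') * of_real (exp (- \<epsilon> * y\<^sup>2)) *
            of_real (poisson_j \<alpha> (x' * y) * poisson_j \<alpha> (x * y)) \<partial>radial_measure \<alpha> \<partial>radial_measure \<alpha>)"
      proof (subst integral_mult_right_zero[symmetric], rule Bochner_Integration.integral_cong[OF refl])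
        fix y
        have "cnj (H y) = of_real c * (\<integral>x'. cnj (f x') * of_real (poisson_j \<alpha> (x' * y)) \<partial>radial_measure \<alpha>)"
          using Bochner_Integration.integral_cnj[of "radial_measure \<alpha>" "\<lambda>x'. f x' * of_real (poisson_j \<alpha> (x' * y))"]
          by (simp add: H_def radial_hankel_def c_def)
        then have "h y * of_real (poisson_j \<alpha> (y * x)) = of_real c *
            ((\<integral>x'. cnj (f x') * of_real (poisson_j \<alpha> (x' * y)) \<partial>radial_measure \<alpha>) *
              (of_real (exp (- \<epsilon> * y\<^sup>2)) * of_real (poisson_j \<alpha> (x * y))))"
          by (simp add: h_def mult_ac)
        also have "(\<integral>x'. cnj (f x') * of_real (poisson_j \<alpha> (x' * y)) \<partial>radial_measure \<alpha>) *
              (of_real (exp (- \<epsilon> * y\<^sup>2)) * of_real (poisson_j \<alpha> (x * y))) =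
            (\<integral>x'. cnj (f x') * of_real (exp (- \<epsilon> * y\<^sup>2)) * of_real (poisson_j \<alpha> (x' * y) * poisson_j \<alpha> (x * y)) \<partial>radial_measure \<alpha>)"
          by (subst integral_mult_left_zero[symmetric]) (simp add: mult_ac)
        finally show "h y * of_real (poisson_j \<alpha> (y * x)) = of_real c * \<dots>" .
      qed
      also have "(\<integral>y. \<integral>x'. cnj (f x') * of_real (exp (- \<epsilon> * y\<^sup>2)) *
            of_real (poisson_j \<alpha> (x' * y) * poisson_j \<alpha> (x * y)) \<partial>radial_measure \<alpha> \<partial>radial_measure \<alpha>) =
          (\<integral>x'. \<integral>y. cnj (f x') * of_real (exp (- \<epsilon> * y\<^sup>2)) *
            of_real (poisson_j \<alpha> (x' * y) * poisson_j \<alpha> (x * y)) \<partial>radial_measure \<alpha> \<partial>radial_measure \<alpha>)"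
        by (rule RR.Fubini_bounded_kernel[OF f' g, where B = 1])
          (auto simp: abs_mult norm_mult intro!: mult_le_one abs_poisson_j_le_1[OF a])
      also have "\<dots> = (\<integral>x'. cnj (f x') * of_real (bessel_heat_kernel \<alpha> \<epsilon> x x') \<partial>radial_measure \<alpha>)"
      proof (rule Bochner_Integration.integral_cong[OF refl])
        fix x'
        have "(\<integral>y. cnj (f x') * of_real (exp (- \<epsilon> * y\<^sup>2)) * of_real (poisson_j \<alpha> (x' * y) * poisson_j \<alpha> (x * y)) \<partial>radial_measure \<alpha>) =
            cnj (f x') * (\<integral>y. complex_of_real (poisson_j \<alpha> (x * y) * poisson_j \<alpha> (x' * y) * exp (- \<epsilon> * y\<^sup>2)) \<partial>radial_measure \<alpha>)"
          by (subst integral_mult_right_zero[symmetric]) (simp add: mult_ac)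
        then show "(\<integral>y. cnj (f x') * of_real (exp (- \<epsilon> * y\<^sup>2)) * of_real (poisson_j \<alpha> (x' * y) * poisson_j \<alpha> (x * y)) \<partial>radial_measure \<alpha>) =
            cnj (f x') * of_real (bessel_heat_kernel \<alpha> \<epsilon> x x')"
          unfolding bessel_heat_kernel_def integral_complex_of_real .
      qed
      finally have "(\<integral>y. h y * of_real (poisson_j \<alpha> (y * x)) \<partial>radial_measure \<alpha>) =
          of_real c * (\<integral>x'. cnj (f x') * of_real (bessel_heat_kernel \<alpha> \<epsilon> x x') \<partial>radial_measure \<alpha>)" .
      then have "radial_hankel \<alpha> h x = of_real (c\<^sup>2) * (\<integral>x'. cnj (f x') * of_real (bessel_heat_kernel \<alpha> \<epsilon> x x') \<partial>radial_measure \<alpha>)"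
        by (simp add: radial_hankel_def c_def[symmetric] power2_eq_square)
      also have "\<dots> = (\<integral>x'. cnj (f x') * of_real (K x x') \<partial>radial_measure \<alpha>)"
        by (subst integral_mult_right_zero[symmetric]) (simp add: K_def mult_ac)
      finally show ?thesis .
    qed
    have sq: "H y * h y = complex_of_real ((norm (H y))\<^sup>2 * exp (- \<epsilon> * y\<^sup>2))" for y
      by (simp add: h_def mult.left_commute[of "H y"] complex_norm_square[symmetric] del: of_real_power)
    have "integrable (radial_measure \<alpha>) (\<lambda>y. h y * H y)"
      using norm_radial_hankel_le[OF a f] by (intro integrable_mult_bounded[OF h]) (auto simp: H_def)
    then have i: "integrable (radial_measure \<alpha>) (\<lambda>y. (norm (H y))\<^sup>2 * exp (- \<epsilon> * y\<^sup>2))"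
      unfolding mult.commute[of "h _"] sq by (simp only: complex_of_real_integrable_eq)
    have "(\<integral>\<^sup>+y. ennreal ((norm (H y))\<^sup>2 * exp (- \<epsilon> * y\<^sup>2)) \<partial>radial_measure \<alpha>) =
        ennreal (\<integral>y. (norm (H y))\<^sup>2 * exp (- \<epsilon> * y\<^sup>2) \<partial>radial_measure \<alpha>)"
      using i by (intro nn_integral_eq_integral) auto
    also have "\<dots> \<le> ennreal (norm (complex_of_real (\<integral>y. (norm (H y))\<^sup>2 * exp (- \<epsilon> * y\<^sup>2) \<partial>radial_measure \<alpha>)))"
      by (intro ennreal_leI) simp
    also have "complex_of_real (\<integral>y. (norm (H y))\<^sup>2 * exp (- \<epsilon> * y\<^sup>2) \<partial>radial_measure \<alpha>) = (\<integral>y. H y * h y \<partial>radial_measure \<alpha>)"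
      unfolding sq by (rule integral_complex_of_real[symmetric])
    also have "\<dots> = (\<integral>x. f x * radial_hankel \<alpha> h x \<partial>radial_measure \<alpha>)"
      unfolding H_def by (rule radial_hankel_multiplication[OF a f h])
    also have "ennreal (norm \<dots>) \<le> (\<integral>\<^sup>+x. ennreal (norm (f x * radial_hankel \<alpha> h x)) \<partial>radial_measure \<alpha>)"
      by (rule norm_integral_le_nn_integral)
    also have "\<dots> \<le> (\<integral>\<^sup>+x. \<integral>\<^sup>+x'. ennreal (norm (f x) * (norm (f x') * K x x')) \<partial>radial_measure \<alpha> \<partial>radial_measure \<alpha>)"
    proof (rule nn_integral_mono)
      fix x
      have "ennreal (norm (f x * radial_hankel \<alpha> h x)) = ennreal (norm (f x)) * ennreal (norm (radial_hankel \<alpha> h x))"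
        by (simp add: norm_mult ennreal_mult')
      also have "\<dots> \<le> ennreal (norm (f x)) * (\<integral>\<^sup>+x'. ennreal (norm (cnj (f x') * of_real (K x x'))) \<partial>radial_measure \<alpha>)"
        unfolding Hh by (intro mult_left_mono norm_integral_le_nn_integral) auto
      also have "\<dots> = (\<integral>\<^sup>+x'. ennreal (norm (f x) * (norm (f x') * K x x')) \<partial>radial_measure \<alpha>)"
        using K0 by (subst nn_integral_cmult[symmetric]) (auto simp: norm_mult ennreal_mult')
      finally show "ennreal (norm (f x * radial_hankel \<alpha> h x)) \<le> \<dots>" .
    qed
    also have "\<dots> \<le> (\<integral>\<^sup>+x. \<integral>\<^sup>+x'. (ennreal ((norm (f x))\<^sup>2) * ennreal (K x x') + ennreal ((norm (f x'))\<^sup>2) * ennreal (K x x')) / 2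
        \<partial>radial_measure \<alpha> \<partial>radial_measure \<alpha>)"
    proof (intro nn_integral_mono)
      fix x x'
      have "2 * (norm (f x) * norm (f x')) \<le> (norm (f x))\<^sup>2 + (norm (f x'))\<^sup>2"
        using sum_squares_bound[of "norm (f x)" "norm (f x')"] by simp
      then have "norm (f x) * (norm (f x') * K x x') \<le> ((norm (f x))\<^sup>2 * K x x' + (norm (f x'))\<^sup>2 * K x x') / 2"
        using mult_right_mono[OF _ K0[of x x']] by (fastforce simp: field_simps)
      then have "ennreal (norm (f x) * (norm (f x') * K x x')) \<le> ennreal (((norm (f x))\<^sup>2 * K x x' + (norm (f x'))\<^sup>2 * K x x') / 2)"
        by (rule ennreal_leI)
      then show "ennreal (norm (f x) * (norm (f x') * K x x')) \<le>
          (ennreal ((norm (f x))\<^sup>2) * ennreal (K x x') + ennreal ((norm (f x'))\<^sup>2) * ennreal (K x x')) / 2"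
        using K0[of x x'] by (simp add: divide_ennreal[symmetric] ennreal_plus ennreal_mult)
    qed
    also have "\<dots> = ((\<integral>\<^sup>+x. \<integral>\<^sup>+x'. ennreal ((norm (f x))\<^sup>2) * ennreal (K x x') \<partial>radial_measure \<alpha> \<partial>radial_measure \<alpha>) +
        (\<integral>\<^sup>+x. \<integral>\<^sup>+x'. ennreal ((norm (f x'))\<^sup>2) * ennreal (K x x') \<partial>radial_measure \<alpha> \<partial>radial_measure \<alpha>)) / 2"
      by (simp add: nn_integral_divide nn_integral_add)
    also have "(\<integral>\<^sup>+x. \<integral>\<^sup>+x'. ennreal ((norm (f x'))\<^sup>2) * ennreal (K x x') \<partial>radial_measure \<alpha> \<partial>radial_measure \<alpha>) =
        (\<integral>\<^sup>+x'. \<integral>\<^sup>+x. ennreal ((norm (f x'))\<^sup>2) * ennreal (K x x') \<partial>radial_measure \<alpha> \<partial>radial_measure \<alpha>)"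
      by (rule RR.Fubini') measurable
    also have "\<dots> = (\<integral>\<^sup>+x. \<integral>\<^sup>+x'. ennreal ((norm (f x))\<^sup>2) * ennreal (K x x') \<partial>radial_measure \<alpha> \<partial>radial_measure \<alpha>)"
      unfolding K_def by (subst bessel_heat_kernel_sym) (rule refl)
    also have "(\<integral>\<^sup>+x. \<integral>\<^sup>+x'. ennreal ((norm (f x))\<^sup>2) * ennreal (K x x') \<partial>radial_measure \<alpha> \<partial>radial_measure \<alpha>) = ?F"
    proof (rule nn_integral_cong_AE)
      show "AE x in radial_measure \<alpha>. (\<integral>\<^sup>+x'. ennreal ((norm (f x))\<^sup>2) * ennreal (K x x') \<partial>radial_measure \<alpha>) = ennreal ((norm (f x))\<^sup>2)"
        using AE_radial_measure_pos
      proof eventually_elim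
        case (elim x)
        then have "(\<integral>\<^sup>+x'. ennreal (K x x') \<partial>radial_measure \<alpha>) = 1"
          unfolding K_def c_def using bessel_heat_kernel_mass[OF a e, of x] by simp
        then show ?case by (simp add: nn_integral_cmult)
      qed
    qed
    also have "(?F + ?F) / 2 = ?F"
      by (simp add: mult_2[symmetric] ennreal_times_divide[symmetric] mult.commute[of 2] ennreal_mult_divide_eq)
    finally show ?thesis .
  qed
  have "(\<integral>\<^sup>+y. ennreal ((norm (H y))\<^sup>2) \<partial>radial_measure \<alpha>) =
      (\<integral>\<^sup>+y. (SUP n. ennreal ((norm (H y))\<^sup>2 * exp (- (1 / Suc n) * y\<^sup>2))) \<partial>radial_measure \<alpha>)"
  proof (rule nn_integral_cong)
    fix y
    have m: "incseq (\<lambda>n. ennreal ((norm (H y))\<^sup>2 * exp (- (1 / Suc n) * y\<^sup>2)))"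
      by (intro incseq_SucI ennreal_leI mult_left_mono) (auto intro!: divide_left_mono simp: field_simps)
    have z: "(\<lambda>n. 1 / real (Suc n)) \<longlonglongrightarrow> 0"
      by (rule LIMSEQ_Suc[OF lim_1_over_n])
    have l: "(\<lambda>n. ennreal ((norm (H y))\<^sup>2 * exp (- (1 / Suc n) * y\<^sup>2))) \<longlonglongrightarrow> ennreal ((norm (H y))\<^sup>2 * exp (- 0 * y\<^sup>2))"
      by (intro tendsto_ennrealI tendsto_intros z)
    show "ennreal ((norm (H y))\<^sup>2) = (SUP n. ennreal ((norm (H y))\<^sup>2 * exp (- (1 / Suc n) * y\<^sup>2)))"
      using LIMSEQ_unique[OF LIMSEQ_SUP[OF m] l] by simp
  qed
  also have "\<dots> = (SUP n. \<integral>\<^sup>+y. ennreal ((norm (H y))\<^sup>2 * exp (- (1 / Suc n) * y\<^sup>2)) \<partial>radial_measure \<alpha>)"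
    by (rule nn_integral_monotone_convergence_SUP)
      (auto simp: incseq_def le_fun_def intro!: ennreal_leI mult_left_mono divide_left_mono mult_right_mono)
  also have "\<dots> \<le> ?F"
    by (intro SUP_least reg) simp
  finally show ?thesis by (simp add: H_def)
qed

section \<open>The Hausdorff--Young inequality\<close>

text \<open>Used as the layer cake formula for a power, and for the measure of a bounded interval.\<close>

lemma nn_integral_powr_layer:
  assumes a: "a > (0::real)" and c: "c \<ge> 0"
  shows "(\<integral>\<^sup>+x. ennreal (x powr (a - 1)) * indicator {0<..c} x \<partial>lborel) = ennreal (c powr a / a)"
proof -
  have "(\<integral>\<^sup>+x. ennreal (x powr (a - 1)) * indicator {0<..c} x \<partial>lborel) =
      (\<integral>\<^sup>+x. ennreal (x powr (a - 1)) * indicator {0..c} x \<partial>lborel)"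
    using AE_lborel_singleton[of 0]
    by (intro nn_integral_cong_AE) (auto simp: indicator_def elim!: eventually_mono)
  also have "\<dots> = ennreal (c powr a / a)"
    using has_integral_powr_from_0[of "a - 1" c] a c
    by (intro nn_integral_has_integral_lebesgue') auto
  finally show ?thesis .
qed

text \<open>
  A bound with some constant is enough for continuity. The proof is that of the Marcinkiewicz
  interpolation theorem between the trivial bound and Plancherel's inequality: at each level \<open>l\<close> the
  function is cut at a height chosen so that the transform of the upper part is at most \<open>l / 2\<close>
  everywhere, and the lower part is controlled by Plancherel's inequality.
\<close>

theorem radial_hausdorff_young:
  fixes p q :: real
  assumes a: "\<alpha> \<ge> - 1 / 2" and p: "1 < p" "p < 2" and q: "q = p / (p - 1)"
    and f: "integrable (radial_measure \<alpha>) f"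
    and I: "(\<integral>\<^sup>+x. ennreal (norm (f x) powr p) \<partial>radial_measure \<alpha>) = ennreal I" "I \<ge> 0"
  shows "(\<integral>\<^sup>+y. ennreal (norm (radial_hankel \<alpha> f y) powr q) \<partial>radial_measure \<alpha>) \<le>
    ennreal (4 * q / (q - 2) * (2 * hankel_const \<alpha>) powr (q - 2) * I powr (q - 1))"
proof (cases "I = 0")
  case True
  have [measurable]: "f \<in> borel_measurable borel" using borel_measurable_integrable[OF f] by simp
  have "(\<integral>\<^sup>+x. ennreal (norm (f x) powr p) \<partial>radial_measure \<alpha>) = 0" using I True by simp
  then have "AE x in radial_measure \<alpha>. f x = 0"
    by (subst (asm) nn_integral_0_iff_AE) (auto elim!: eventually_mono)
  then have "(\<integral>x. f x * of_real (poisson_j \<alpha> (x * y)) \<partial>radial_measure \<alpha>) = 0" for y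
    by (intro integral_eq_zero_AE) (auto elim!: eventually_mono)
  then show ?thesis by (simp add: radial_hankel_def)
next
  case False
  with I have I0: "I > 0" by simp
  interpret R: sigma_finite_measure "radial_measure \<alpha>" by (rule sigma_finite_radial_measure)
  interpret RL: pair_sigma_finite "radial_measure \<alpha>" lborel ..
  have [measurable]: "f \<in> borel_measurable borel" using borel_measurable_integrable[OF f] by simp
  note [measurable] = borel_measurable_radial_hankel[OF a]
  define c where "c = hankel_const \<alpha>"
  have c: "c > 0" using hankel_const_pos[OF a] by (simp add: c_def)
  define H where "H = radial_hankel \<alpha> f"
  have [measurable]: "H \<in> borel_measurable borel" unfolding H_def by measurable
  have q2: "q > 2" using p by (simp add: q field_simps)
  \<comment> \<open>Where \<open>low l\<close> fails, \<open>norm (f x)\<close> is at most \<open>l / (2 * c * I)\<close> times \<open>norm (f x) powr p\<close>, which makes the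
    transform of that part at most \<open>l / 2\<close>.\<close>
  define low where "low l x \<longleftrightarrow> l * norm (f x) powr (p - 1) \<le> 2 * c * I" for l x
  have level: "(\<integral>\<^sup>+y. indicator {0<..norm (H y)} l \<partial>radial_measure \<alpha>) \<le>
      (\<integral>\<^sup>+x. ennreal (4 / l\<^sup>2 * (norm (f x))\<^sup>2) * indicator {x. low l x} x \<partial>radial_measure \<alpha>)" if l: "l > 0" for l
  proof -
    define f2 where "f2 x = (if low l x then f x else 0)" for x
    define f1 where "f1 x = (if low l x then 0 else f x)" for x
    have [measurable]: "Measurable.pred borel (low l)" unfolding low_def by measurable
    have i1: "integrable (radial_measure \<alpha>) f1" and i2: "integrable (radial_measure \<alpha>) f2"
      unfolding f1_def f2_def by (rule Bochner_Integration.integrable_bound[OF f]; simp)+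
    have b1: "(\<integral>x. norm (f1 x) \<partial>radial_measure \<alpha>) \<le> l / (2 * c)"
    proof -
      have "norm (f1 x) \<le> l / (2 * c * I) * norm (f x) powr p" for x
      proof (cases "low l x")
        case False
        then have n: "f x \<noteq> 0" using c I0 by (auto simp: low_def)
        have "norm (f x) powr p = norm (f x) powr (p - 1) * norm (f x)"
          using n by (simp add: powr_diff)
        moreover have "1 * norm (f x) \<le> (l / (2 * c * I) * norm (f x) powr (p - 1)) * norm (f x)"
          using False c I0 by (intro mult_right_mono) (auto simp: low_def field_simps)
        ultimately show ?thesis using False by (simp add: f1_def mult.assoc)
      qed (use c I0 l in \<open>simp add: f1_def\<close>)
      then have "(\<integral>\<^sup>+x. ennreal (norm (f1 x)) \<partial>radial_measure \<alpha>) \<le>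
          (\<integral>\<^sup>+x. ennreal (l / (2 * c * I)) * ennreal (norm (f x) powr p) \<partial>radial_measure \<alpha>)"
        using c I0 l by (intro nn_integral_mono) (auto simp flip: ennreal_mult intro!: ennreal_leI)
      also have "\<dots> = ennreal (l / (2 * c * I) * I)"
        by (subst nn_integral_cmult) (use c I0 l in \<open>auto simp: I ennreal_mult[symmetric]\<close>)
      finally have "ennreal (\<integral>x. norm (f1 x) \<partial>radial_measure \<alpha>) \<le> ennreal (l / (2 * c))"
        using i1 I0 by (subst (asm) nn_integral_eq_integral) auto
      then show ?thesis using c l by (simp add: ennreal_le_iff)
    qed
    have "(\<integral>\<^sup>+y. indicator {0<..norm (H y)} l \<partial>radial_measure \<alpha>) \<le>
        (\<integral>\<^sup>+y. ennreal (4 / l\<^sup>2) * ennreal ((norm (radial_hankel \<alpha> f2 y))\<^sup>2) \<partial>radial_measure \<alpha>)"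
    proof (rule nn_integral_mono)
      fix y
      show "indicator {0<..norm (H y)} l \<le> ennreal (4 / l\<^sup>2) * ennreal ((norm (radial_hankel \<alpha> f2 y))\<^sup>2)"
      proof (cases "l \<le> norm (H y)")
        case True
        have "H y = radial_hankel \<alpha> (\<lambda>x. f1 x + f2 x) y"
          unfolding H_def by (rule arg_cong[where f = "\<lambda>g. radial_hankel \<alpha> g y"]) (auto simp: f1_def f2_def)
        then have "norm (H y) \<le> norm (radial_hankel \<alpha> f1 y) + norm (radial_hankel \<alpha> f2 y)"
          by (simp add: radial_hankel_add[OF a i1 i2] norm_triangle_ineq)
        moreover have "norm (radial_hankel \<alpha> f1 y) \<le> l / 2"
        proof -
          have "norm (radial_hankel \<alpha> f1 y) \<le> c * (\<integral>x. norm (f1 x) \<partial>radial_measure \<alpha>)"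
            unfolding c_def by (rule norm_radial_hankel_le[OF a i1])
          also have "\<dots> \<le> c * (l / (2 * c))" using c b1 by (intro mult_left_mono) auto
          finally show ?thesis using c by simp
        qed
        ultimately have "l / 2 \<le> norm (radial_hankel \<alpha> f2 y)" using True by simp
        then have "(l / 2)\<^sup>2 \<le> (norm (radial_hankel \<alpha> f2 y))\<^sup>2" using l by (intro power_mono) auto
        then have "1 \<le> 4 / l\<^sup>2 * (norm (radial_hankel \<alpha> f2 y))\<^sup>2" using l by (simp add: field_simps power_divide)
        then have "ennreal 1 \<le> ennreal (4 / l\<^sup>2 * (norm (radial_hankel \<alpha> f2 y))\<^sup>2)" by (rule ennreal_leI)
        then show ?thesis using True l by (simp flip: ennreal_mult)
      qed simp
    qed
    also have "\<dots> = ennreal (4 / l\<^sup>2) * (\<integral>\<^sup>+y. ennreal ((norm (radial_hankel \<alpha> f2 y))\<^sup>2) \<partial>radial_measure \<alpha>)"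
      using borel_measurable_integrable[OF i2] by (intro nn_integral_cmult) simp
    also have "\<dots> \<le> ennreal (4 / l\<^sup>2) * (\<integral>\<^sup>+x. ennreal ((norm (f2 x))\<^sup>2) \<partial>radial_measure \<alpha>)"
      by (intro mult_left_mono radial_hankel_L2[OF a i2]) auto
    also have "\<dots> = (\<integral>\<^sup>+x. ennreal (4 / l\<^sup>2) * ennreal ((norm (f2 x))\<^sup>2) \<partial>radial_measure \<alpha>)"
      using borel_measurable_integrable[OF i2] by (intro nn_integral_cmult[symmetric]) simp
    also have "\<dots> = (\<integral>\<^sup>+x. ennreal (4 / l\<^sup>2 * (norm (f x))\<^sup>2) * indicator {x. low l x} x \<partial>radial_measure \<alpha>)"
      by (intro nn_integral_cong) (auto simp: f2_def simp flip: ennreal_mult)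
    finally show ?thesis .
  qed
  have [measurable]: "Measurable.pred (borel \<Otimes>\<^sub>M borel) (\<lambda>(x, l). low l x)"
    unfolding low_def by measurable
  have [measurable]: "Measurable.pred (borel \<Otimes>\<^sub>M borel) (\<lambda>x. snd x \<in> {0<..norm (H (fst x))})"
    unfolding greaterThanAtMost_iff by measurable
  have [measurable]: "Measurable.pred borel (\<lambda>y. l \<in> {0<..norm (H y)})" for l
    unfolding greaterThanAtMost_iff by measurable
  define D where "D = 4 * q / (q - 2) * (2 * c) powr (q - 2) * I powr (q - 2)"
  have "(\<integral>\<^sup>+y. ennreal (norm (H y) powr q) \<partial>radial_measure \<alpha>) =
      (\<integral>\<^sup>+y. \<integral>\<^sup>+l. ennreal (q * l powr (q - 1)) * indicator {0<..norm (H y)} l \<partial>lborel \<partial>radial_measure \<alpha>)"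
  proof (rule nn_integral_cong)
    fix y
    have "(\<integral>\<^sup>+l. ennreal (q * l powr (q - 1)) * indicator {0<..norm (H y)} l \<partial>lborel) =
        ennreal q * (\<integral>\<^sup>+l. ennreal (l powr (q - 1)) * indicator {0<..norm (H y)} l \<partial>lborel)"
      using q2 by (subst nn_integral_cmult[symmetric]) (auto simp: ennreal_mult mult.assoc)
    also have "\<dots> = ennreal (norm (H y) powr q)"
      using q2 by (simp add: nn_integral_powr_layer flip: ennreal_mult)
    finally show "ennreal (norm (H y) powr q) = (\<integral>\<^sup>+l. ennreal (q * l powr (q - 1)) * indicator {0<..norm (H y)} l \<partial>lborel)" ..
  qed
  also have "\<dots> = (\<integral>\<^sup>+l. \<integral>\<^sup>+y. ennreal (q * l powr (q - 1)) * indicator {0<..norm (H y)} l \<partial>radial_measure \<alpha> \<partial>lborel)"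
    by (rule RL.Fubini'[symmetric]) measurable
  also have "\<dots> \<le> (\<integral>\<^sup>+l. \<integral>\<^sup>+x. ennreal (4 * q * l powr (q - 3) * (norm (f x))\<^sup>2) * indicator {(x, l). 0 < l \<and> low l x} (x, l) \<partial>radial_measure \<alpha> \<partial>lborel)"
  proof (rule nn_integral_mono)
    fix l
    show "(\<integral>\<^sup>+y. ennreal (q * l powr (q - 1)) * indicator {0<..norm (H y)} l \<partial>radial_measure \<alpha>) \<le>
      (\<integral>\<^sup>+x. ennreal (4 * q * l powr (q - 3) * (norm (f x))\<^sup>2) * indicator {(x, l). 0 < l \<and> low l x} (x, l) \<partial>radial_measure \<alpha>)"
    proof (cases "l > 0")
      case True
      have "(\<integral>\<^sup>+y. ennreal (q * l powr (q - 1)) * indicator {0<..norm (H y)} l \<partial>radial_measure \<alpha>) =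
          ennreal (q * l powr (q - 1)) * (\<integral>\<^sup>+y. indicator {0<..norm (H y)} l \<partial>radial_measure \<alpha>)"
        by (rule nn_integral_cmult) measurable
      also have "\<dots> \<le> ennreal (q * l powr (q - 1)) *
          (\<integral>\<^sup>+x. ennreal (4 / l\<^sup>2 * (norm (f x))\<^sup>2) * indicator {x. low l x} x \<partial>radial_measure \<alpha>)"
        by (intro mult_left_mono level True) auto
      also have "\<dots> = (\<integral>\<^sup>+x. ennreal (q * l powr (q - 1)) * (ennreal (4 / l\<^sup>2 * (norm (f x))\<^sup>2) * indicator {x. low l x} x) \<partial>radial_measure \<alpha>)"
        by (rule nn_integral_cmult[symmetric]) measurable
      also have "\<dots> = (\<integral>\<^sup>+x. ennreal (4 * q * l powr (q - 3) * (norm (f x))\<^sup>2) * indicator {(x, l). 0 < l \<and> low l x} (x, l) \<partial>radial_measure \<alpha>)"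
      proof (rule nn_integral_cong)
        fix x
        have "l powr (q - 3) = l powr (q - 1) / l\<^sup>2"
          using True powr_diff[of l "q - 1" 2] by simp
        then have "q * l powr (q - 1) * (4 / l\<^sup>2 * (norm (f x))\<^sup>2) = 4 * q * l powr (q - 3) * (norm (f x))\<^sup>2"
          by simp
        then show "ennreal (q * l powr (q - 1)) * (ennreal (4 / l\<^sup>2 * (norm (f x))\<^sup>2) * indicator {x. low l x} x) =
            ennreal (4 * q * l powr (q - 3) * (norm (f x))\<^sup>2) * indicator {(x, l). 0 < l \<and> low l x} (x, l)"
          using True q2 by (auto simp: indicator_def simp flip: ennreal_mult)
      qed
      finally show ?thesis .
    qed simp
  qed
  also have "\<dots> = (\<integral>\<^sup>+x. \<integral>\<^sup>+l. ennreal (4 * q * l powr (q - 3) * (norm (f x))\<^sup>2) * indicator {(x, l). 0 < l \<and> low l x} (x, l) \<partial>lborel \<partial>radial_measure \<alpha>)"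
    by (rule RL.Fubini') measurable
  also have "\<dots> = (\<integral>\<^sup>+x. ennreal D * ennreal (norm (f x) powr p) \<partial>radial_measure \<alpha>)"
  proof (rule nn_integral_cong)
    fix x
    show "(\<integral>\<^sup>+l. ennreal (4 * q * l powr (q - 3) * (norm (f x))\<^sup>2) * indicator {(x, l). 0 < l \<and> low l x} (x, l) \<partial>lborel) =
        ennreal D * ennreal (norm (f x) powr p)"
    proof (cases "f x = 0")
      case False
      define N where "N = norm (f x)"
      have N: "N > 0" using False by (simp add: N_def)
      define L where "L = 2 * c * I * N powr (1 - p)"
      have L: "L > 0" using c I0 N by (simp add: L_def)
      have low: "low l x \<longleftrightarrow> l \<le> L" for l
      proof -
        have X: "N powr (p - 1) > 0" using N by simp
        have "L = 2 * c * I / N powr (p - 1)"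
          using powr_minus[of N "p - 1"] by (simp add: L_def divide_inverse)
        then show ?thesis by (simp add: low_def N_def[symmetric] pos_le_divide_eq[OF X])
      qed
      have "(\<integral>\<^sup>+l. ennreal (4 * q * l powr (q - 3) * (norm (f x))\<^sup>2) * indicator {(x, l). 0 < l \<and> low l x} (x, l) \<partial>lborel) =
          (\<integral>\<^sup>+l. ennreal (4 * q * N\<^sup>2) * (ennreal (l powr ((q - 2) - 1)) * indicator {0<..L} l) \<partial>lborel)"
        using q2 by (intro nn_integral_cong) (auto simp: low N_def[symmetric] indicator_def mult_ac simp flip: ennreal_mult)
      also have "\<dots> = ennreal (4 * q * N\<^sup>2) * ennreal (L powr (q - 2) / (q - 2))"
        using q2 L nn_integral_powr_layer[of "q - 2" L] by (subst nn_integral_cmult) auto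
      also have "\<dots> = ennreal (4 * q * N\<^sup>2 * (L powr (q - 2) / (q - 2)))"
        using q2 by (simp flip: ennreal_mult)
      also have "4 * q * N\<^sup>2 * (L powr (q - 2) / (q - 2)) = D * N powr p"
      proof -
        have "L powr (q - 2) = (2 * c) powr (q - 2) * I powr (q - 2) * N powr ((1 - p) * (q - 2))"
          using c I0 N by (simp add: L_def powr_mult powr_powr)
        moreover have "(1 - p) * (q - 2) = p - 2" using p by (simp add: q field_simps)
        moreover have "N\<^sup>2 * N powr (p - 2) = N powr p"
          using N powr_add[of N 2 "p - 2"] by simp
        ultimately show ?thesis by (simp add: D_def field_simps)
      qed
      also have "ennreal (D * N powr p) = ennreal D * ennreal (norm (f x) powr p)"
        by (simp add: N_def ennreal_mult'')
      finally show ?thesis .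
    qed simp
  qed
  also have "\<dots> = ennreal D * ennreal I"
    by (simp add: nn_integral_cmult I)
  also have "\<dots> = ennreal (4 * q / (q - 2) * (2 * c) powr (q - 2) * I powr (q - 1))"
  proof -
    have "I powr (q - 1) = I powr (q - 2) * I" using I0 powr_add[of I "q - 2" 1] by simp
    then show ?thesis using I by (simp add: D_def ennreal_mult''[symmetric] mult.assoc)
  qed
  finally show ?thesis by (simp add: H_def c_def)
qed

section \<open>Convexity of powers\<close>

text \<open>
  Jensen's inequality for \<open>x powr q\<close>, from Young's inequality, which is the tangent inequality at the
  mean. If the right-hand side is infinite or \<open>f\<close> is not integrable there is nothing to show, the
  integral then being \<open>0\<close> by convention in the latter case.
\<close>

lemma (in prob_space) norm_integral_powr_le:
  fixes f :: "'a \<Rightarrow> complex" and q :: real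
  assumes q: "q \<ge> 1" and [measurable]: "f \<in> borel_measurable M"
  shows "ennreal (norm (\<integral>x. f x \<partial>M) powr q) \<le> (\<integral>\<^sup>+x. ennreal (norm (f x) powr q) \<partial>M)"
proof (cases "integrable M f \<and> (\<integral>\<^sup>+x. ennreal (norm (f x) powr q) \<partial>M) \<noteq> \<infinity>")
  case False
  then show ?thesis by (auto simp: not_integrable_integral_eq)
next
  case True
  then have i: "integrable M f" and iq: "integrable M (\<lambda>x. norm (f x) powr q)"
    by (auto intro!: integrableI_bounded simp: less_top)
  define m where "m = (\<integral>x. norm (f x) \<partial>M)"
  have m0: "m \<ge> 0" by (simp add: m_def)
  have "m powr q \<le> (\<integral>x. norm (f x) powr q \<partial>M)"
  proof (cases "m = 0")
    case False
    with m0 have m: "m > 0" by simp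
    have tangent: "norm (f x) * m powr (q - 1) \<le> norm (f x) powr q / q + (1 - 1 / q) * m powr q" for x
    proof (cases "f x = 0")
      case False
      have "(norm (f x) powr q) powr (1 / q) * (m powr q) powr (1 - 1 / q) \<le>
          1 / q * norm (f x) powr q + (1 - 1 / q) * m powr q"
        using q m False by (intro Youngs_inequality_0) auto
      moreover have "q * (1 - 1 / q) = q - 1" using q by (simp add: field_simps)
      ultimately show ?thesis using q m False by (simp add: powr_powr)
    qed (use q m in auto)
    have "m * m powr (q - 1) = (\<integral>x. norm (f x) * m powr (q - 1) \<partial>M)"
      by (simp add: m_def)
    also have "\<dots> \<le> (\<integral>x. norm (f x) powr q / q + (1 - 1 / q) * m powr q \<partial>M)"
      using i iq by (intro integral_mono tangent) auto
    also have "\<dots> = (\<integral>x. norm (f x) powr q \<partial>M) / q + (1 - 1 / q) * m powr q"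
      using iq by (simp add: prob_space)
    finally have "m powr q \<le> (\<integral>x. norm (f x) powr q \<partial>M) / q + (1 - 1 / q) * m powr q"
      using m by (simp add: powr_diff)
    then show ?thesis using q by (simp add: field_simps)
  qed (use q in simp)
  moreover have "norm (\<integral>x. f x \<partial>M) powr q \<le> m powr q"
    using q integral_norm_bound[of M f] by (intro powr_mono2) (auto simp: m_def)
  ultimately show ?thesis
    using iq by (subst nn_integral_eq_integral) (auto intro!: ennreal_leI)
qed

section \<open>Borel representatives\<close>

lemma sets_bessel_measure: "sets (bessel_measure \<alpha>) = sets (lebesgue_on {0..})"
  by (simp add: bessel_measure_def)

lemma measurable_bessel_measure: "borel_measurable (bessel_measure \<alpha>) = borel_measurable (lebesgue_on {0..})"
  by (intro measurable_cong_sets sets_bessel_measure refl)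

lemma borel_measurable_bessel_measure_if_borel:
  "f \<in> borel_measurable borel \<Longrightarrow> f \<in> borel_measurable (bessel_measure \<alpha>)"
  unfolding measurable_bessel_measure
  by (intro measurable_restrict_space1 measurable_completion) simp

lemma nn_integral_bessel_measure:
  assumes [measurable]: "F \<in> borel_measurable borel"
  shows "(\<integral>\<^sup>+x. F x \<partial>bessel_measure \<alpha>) = (\<integral>\<^sup>+x. F x \<partial>radial_measure \<alpha>)"
proof -
  have m: "g \<in> borel_measurable (lebesgue_on {0..})" if "g \<in> borel_measurable borel" for g :: "real \<Rightarrow> ennreal"
    using borel_measurable_bessel_measure_if_borel[OF that] by (simp add: measurable_bessel_measure)
  have "(\<integral>\<^sup>+x. F x \<partial>bessel_measure \<alpha>) = (\<integral>\<^sup>+x. ennreal (x powr (2 * \<alpha> + 1)) * F x \<partial>lebesgue_on {0..})"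
    unfolding bessel_measure_def by (intro nn_integral_density m) measurable
  also have "\<dots> = (\<integral>\<^sup>+x. ennreal (x powr (2 * \<alpha> + 1)) * F x * indicator {0..} x \<partial>lborel)"
    by (simp add: nn_integral_restrict_space nn_integral_completion)
  also have "\<dots> = (\<integral>\<^sup>+x. ennreal (indicator {0<..} x * x powr (2 * \<alpha> + 1)) * F x \<partial>lborel)"
    using AE_lborel_singleton[of 0]
    by (intro nn_integral_cong_AE) (auto simp: indicator_def elim!: eventually_mono)
  finally show ?thesis by (simp add: nn_integral_radial_measure)
qed

lemma AE_bessel_measure: "(AE x in bessel_measure \<alpha>. P x) \<longleftrightarrow> (AE x in radial_measure \<alpha>. P x)"
proof -
  have "(AE x in bessel_measure \<alpha>. P x) \<longleftrightarrow> (AE x in lebesgue_on {0..}. 0 < ennreal (x powr (2 * \<alpha> + 1)) \<longrightarrow> P x)"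
    unfolding bessel_measure_def
    by (intro AE_density measurable_restrict_space1 measurable_completion) simp
  also have "\<dots> \<longleftrightarrow> (AE x in lborel. x \<in> {0..} \<longrightarrow> 0 < ennreal (x powr (2 * \<alpha> + 1)) \<longrightarrow> P x)"
    by (simp add: AE_restrict_space_iff AE_completion_iff)
  also have "\<dots> \<longleftrightarrow> (AE x in radial_measure \<alpha>. P x)"
    unfolding AE_radial_measure by (intro AE_cong) auto
  finally show ?thesis .
qed

lemma distr_bessel_measure: "distr (bessel_measure \<alpha>) borel (\<lambda>x. x) = radial_measure \<alpha>"
proof (rule measure_eqI)
  fix A assume "A \<in> sets (distr (bessel_measure \<alpha>) borel (\<lambda>x. x))"
  then have A [measurable]: "A \<in> sets borel" by simp
  have id: "(\<lambda>x. x) \<in> bessel_measure \<alpha> \<rightarrow>\<^sub>M borel"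
    by (rule borel_measurable_bessel_measure_if_borel) simp
  have "emeasure (distr (bessel_measure \<alpha>) borel (\<lambda>x. x)) A = (\<integral>\<^sup>+x. indicator A x \<partial>distr (bessel_measure \<alpha>) borel (\<lambda>x. x))"
    by simp
  also have "\<dots> = (\<integral>\<^sup>+x. indicator A x \<partial>bessel_measure \<alpha>)"
    by (rule nn_integral_distr[OF id]) simp
  also have "\<dots> = emeasure (radial_measure \<alpha>) A"
    by (simp add: nn_integral_bessel_measure)
  finally show "emeasure (distr (bessel_measure \<alpha>) borel (\<lambda>x. x)) A = emeasure (radial_measure \<alpha>) A" .
qed simp

lemma integral_bessel_measure:
  fixes f :: "real \<Rightarrow> complex"
  assumes "f \<in> borel_measurable borel"
  shows "(\<integral>x. f x \<partial>bessel_measure \<alpha>) = (\<integral>x. f x \<partial>radial_measure \<alpha>)"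
  unfolding distr_bessel_measure[symmetric]
  by (rule integral_distr[symmetric]) (auto intro: borel_measurable_bessel_measure_if_borel assms)

lemma borel_representative_lebesgue:
  fixes f :: "real \<Rightarrow> complex"
  assumes f: "f \<in> borel_measurable lebesgue"
  obtains f' where "f' \<in> borel_measurable borel" "AE x in lborel. f x = f' x"
proof -
  have "(\<lambda>x. Re (f x)) \<in> borel_measurable (completion lborel)" "(\<lambda>x. Im (f x)) \<in> borel_measurable (completion lborel)"
    using f by measurable
  then obtain u v where u: "u \<in> borel_measurable lborel" "AE x in lborel. Re (f x) = u x"
    and v: "v \<in> borel_measurable lborel" "AE x in lborel. Im (f x) = v x"
    using completion_ex_borel_measurable_real by metis
  show thesis
  proof
    show "(\<lambda>x. Complex (u x) (v x)) \<in> borel_measurable borel"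
      using u(1) v(1) unfolding Complex_eq by measurable
    show "AE x in lborel. f x = Complex (u x) (v x)"
      using u(2) v(2) by eventually_elim (simp add: complex_eq_iff)
  qed
qed

lemma borel_representative:
  fixes f :: "real \<Rightarrow> complex"
  assumes f: "f \<in> borel_measurable (bessel_measure \<alpha>)"
  obtains f' where "f' \<in> borel_measurable borel" "AE x in radial_measure \<alpha>. f x = f' x"
proof -
  have "(\<lambda>x. if x \<in> {0..} then f x else 0) \<in> borel_measurable lebesgue"
    using f by (intro borel_measurable_if_I) (auto simp: measurable_bessel_measure)
  then obtain f' where f': "f' \<in> borel_measurable borel" "AE x in lborel. (if x \<in> {0..} then f x else 0) = f' x"
    by (rule borel_representative_lebesgue)
  from f'(2) have "AE x in radial_measure \<alpha>. f x = f' x"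
    unfolding AE_radial_measure by eventually_elim auto
  with f'(1) show thesis by (rule that)
qed

lemma measurable_if_borel_representative:
  fixes f :: "real \<Rightarrow> complex"
  assumes "f' \<in> borel_measurable borel" and ae: "AE x in radial_measure \<alpha>. f x = f' x"
  shows "f \<in> borel_measurable (bessel_measure \<alpha>)"
proof -
  have "(\<lambda>x. if x \<in> {0..} then f x else 0) \<in> borel_measurable lebesgue"
  proof (rule borel_measurable_AE)
    show "(\<lambda>x. if x \<in> {0..} then f' x else 0) \<in> borel_measurable lebesgue"
      using assms(1) by (intro measurable_completion) simp
    have "AE x in lborel. (if x \<in> {0..} then f' x else 0) = (if x \<in> {0..} then f x else 0)"
      using ae AE_lborel_singleton[of 0] unfolding AE_radial_measure by eventually_elim auto
    then show "AE x in lebesgue. (if x \<in> {0..} then f' x else 0) = (if x \<in> {0..} then f x else 0)"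
      by (rule AE_completion)
  qed
  then show ?thesis
    by (simp only: measurable_bessel_measure borel_measurable_if_D)
qed

text \<open>Both end points are atoms, so a property holding almost everywhere holds at them.\<close>

lemma AE_angle_measure_half:
  assumes "AE \<phi> in angle_measure (- (1 / 2)). P \<phi>"
  shows "P 0" "P pi"
proof -
  obtain N where N: "N \<in> null_sets (angle_measure (- (1 / 2)))" "\<And>x. x \<in> space (angle_measure (- (1 / 2))) - N \<Longrightarrow> P x"
    using AE_E3[OF assms] by metis
  then have [measurable]: "N \<in> sets borel" by (auto simp: null_sets_def)
  have "(indicator N 0 + indicator N pi) / 2 = (\<integral>\<^sup>+\<phi>. indicator N \<phi> \<partial>angle_measure (- (1 / 2)))"
    by (rule nn_integral_angle_measure_half[symmetric]) measurable
  also have "\<dots> = 0" using N(1) by (simp add: null_setsD1)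
  finally have "(indicator N 0 + indicator N pi :: ennreal) = 0"
    by (simp add: ennreal_divide_eq_0_iff)
  then show "P 0" "P pi" using N(2) by (auto simp: indicator_eq_0_iff)
qed

text \<open>
  The translation of an arbitrary measurable function can be computed from a Borel representative,
  since by the symmetry of the translation \<open>third_side\<close> pulls null sets back to null sets.
\<close>

lemma bessel_translation_eq_translate:
  assumes a: "\<alpha> \<ge> - 1 / 2" and t: "t \<ge> 0" and [measurable]: "f' \<in> borel_measurable borel"
    and ae: "AE x in radial_measure \<alpha>. f x = f' x"
  shows "AE s in radial_measure \<alpha>. bessel_translation \<alpha> t f s = translate \<alpha> t f' s"
  using AE_third_side[OF a t ae] AE_radial_measure_pos
proof eventually_elim
  case (elim s)
  show ?case
  proof (cases "\<alpha> = - 1 / 2")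
    case True
    have half: "\<alpha> = - (1 / 2)" using True by simp
    have "AE \<phi> in angle_measure (- (1 / 2)). f (third_side t s \<phi>) = f' (third_side t s \<phi>)"
      using elim(1) unfolding half .
    then have "f (third_side t s 0) = f' (third_side t s 0)" "f (third_side t s pi) = f' (third_side t s pi)"
      by (rule AE_angle_measure_half)+
    then show ?thesis
      using elim(2) t half integral_angle_measure_half[of "\<lambda>\<phi>. f' (third_side t s \<phi>)"]
      by (simp add: bessel_translation_def translate_def third_side_0_angle third_side_pi scaleR_conv_of_real add.commute)
  next
    case False
    with a have a': "\<alpha> > - 1 / 2" by simp
    let ?w = "\<lambda>\<phi>. complex_of_real (sin \<phi> powr (2 * \<alpha>))"
    have Z: "angle_mass \<alpha> > 0" by (rule angle_mass_pos[OF a'])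
    have "AE \<phi> in lborel. 0 < ennreal (indicator {0..pi} \<phi> * sin \<phi> powr (2 * \<alpha>) / angle_mass \<alpha>) \<longrightarrow>
        f (third_side t s \<phi>) = f' (third_side t s \<phi>)"
      using elim(1) False unfolding angle_measure_def by (subst (asm) if_not_P, simp, subst (asm) AE_density) auto
    then have e: "AE \<phi> in lborel. indicator {0..pi} \<phi> *\<^sub>R (f' (third_side t s \<phi>) * ?w \<phi>) =
        indicator {0..pi} \<phi> *\<^sub>R (f (third_side t s \<phi>) * ?w \<phi>)"
      by eventually_elim (use Z in \<open>auto simp: indicator_def\<close>)
    have m: "(\<lambda>\<phi>. indicator {0..pi} \<phi> *\<^sub>R (f' (third_side t s \<phi>) * ?w \<phi>)) \<in> borel_measurable lebesgue"
      by (intro measurable_completion) measurable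
    have "(LINT \<phi>:{0..pi}|lebesgue. f (third_side t s \<phi>) * ?w \<phi>) = (LINT \<phi>:{0..pi}|lebesgue. f' (third_side t s \<phi>) * ?w \<phi>)"
      unfolding set_lebesgue_integral_def
      using borel_measurable_AE[OF m AE_completion[OF e]] m AE_completion[OF e]
      by (intro integral_cong_AE) auto
    also have "\<dots> = (LBINT \<phi>:{0..pi}. f' (third_side t s \<phi>) * ?w \<phi>)"
      unfolding set_lebesgue_integral_def by (intro integral_completion) measurable
    finally have n: "(LINT \<phi>:{0..pi}|lebesgue. f (third_side t s \<phi>) * ?w \<phi>) = (LBINT \<phi>:{0..pi}. f' (third_side t s \<phi>) * ?w \<phi>)" .
    have d: "(LINT \<theta>:{0..pi}|lebesgue. sin \<theta> powr (2 * \<alpha>)) = angle_mass \<alpha>"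
      unfolding set_lebesgue_integral_def angle_mass_def by (intro integral_completion) measurable
    have "translate \<alpha> t f' s = (LBINT \<phi>:{0..pi}. (sin \<phi> powr (2 * \<alpha>) / angle_mass \<alpha>) *\<^sub>R f' (third_side t s \<phi>))"
      unfolding translate_def by (rule integral_angle_measure[OF a']) measurable
    also have "\<dots> = (LBINT \<phi>:{0..pi}. f' (third_side t s \<phi>) * ?w \<phi> / of_real (angle_mass \<alpha>))"
      by (intro set_lebesgue_integral_cong) (auto simp: scaleR_conv_of_real mult_ac)
    also have "\<dots> = (LBINT \<phi>:{0..pi}. f' (third_side t s \<phi>) * ?w \<phi>) / of_real (angle_mass \<alpha>)"
      by (rule set_integral_divide_zero)
    finally show ?thesis
      using False by (simp add: bessel_translation_def d n third_side_def[symmetric])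
  qed
qed

lemma hankel_integral_eq_radial_hankel:
  assumes a: "\<alpha> \<ge> - 1 / 2" and f': "f' \<in> borel_measurable borel"
    and ae: "AE x in radial_measure \<alpha>. f x = f' x"
  shows "hankel_integral \<alpha> f = radial_hankel \<alpha> f'"
proof
  fix y
  note [measurable] = borel_measurable_poisson_j[OF a] f'
  have j: "(\<lambda>x. complex_of_real (poisson_j \<alpha> (x * y))) \<in> borel_measurable borel" by measurable
  have "(\<integral>x. f x * of_real (poisson_j \<alpha> (x * y)) \<partial>bessel_measure \<alpha>) = (\<integral>x. f' x * of_real (poisson_j \<alpha> (x * y)) \<partial>bessel_measure \<alpha>)"
  proof (rule integral_cong_AE)
    show "(\<lambda>x. f x * of_real (poisson_j \<alpha> (x * y))) \<in> borel_measurable (bessel_measure \<alpha>)"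
      by (intro borel_measurable_times measurable_if_borel_representative[OF f' ae] borel_measurable_bessel_measure_if_borel j)
    show "(\<lambda>x. f' x * of_real (poisson_j \<alpha> (x * y))) \<in> borel_measurable (bessel_measure \<alpha>)"
      by (intro borel_measurable_bessel_measure_if_borel) measurable
    show "AE x in bessel_measure \<alpha>. f x * of_real (poisson_j \<alpha> (x * y)) = f' x * of_real (poisson_j \<alpha> (x * y))"
      unfolding AE_bessel_measure using ae by eventually_elim simp
  qed
  also have "\<dots> = (\<integral>x. f' x * of_real (poisson_j \<alpha> (x * y)) \<partial>radial_measure \<alpha>)"
    by (rule integral_bessel_measure) measurable
  finally show "hankel_integral \<alpha> f y = radial_hankel \<alpha> f' y"
    unfolding hankel_integral_def radial_hankel_def hankel_const_def bessel_j_of_real[OF a] by simp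
qed

section \<open>The weighted norms\<close>

text \<open>
  Every bound below is read off from these two characterisations of the norm by a real constant.
\<close>

lemma bnorm_le_iff_finite:
  fixes r C :: real
  assumes r: "r \<ge> 1" and C: "C \<ge> 0"
  shows "bnorm (ennreal r) \<alpha> f \<le> ennreal C \<longleftrightarrow>
    (\<integral>\<^sup>+x. ennreal (norm (f x) powr r) \<partial>bessel_measure \<alpha>) \<le> ennreal (C powr r)"
proof (cases "(\<integral>\<^sup>+x. ennreal (norm (f x) powr r) \<partial>bessel_measure \<alpha>) = \<infinity>")
  case True
  then show ?thesis using r by (simp add: bnorm_def top_unique)
next
  case False
  then obtain I where I: "(\<integral>\<^sup>+x. ennreal (norm (f x) powr r) \<partial>bessel_measure \<alpha>) = ennreal I" "I \<ge> 0"
    by (metis ennreal_cases infinity_ennreal_def)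
  have "bnorm (ennreal r) \<alpha> f = ennreal (I powr (1 / r))"
    using r I by (simp add: bnorm_def)
  moreover have "I powr (1 / r) \<le> C \<longleftrightarrow> I \<le> C powr r"
  proof
    assume "I powr (1 / r) \<le> C"
    then have "(I powr (1 / r)) powr r \<le> C powr r" using r I by (intro powr_mono2) auto
    then show "I \<le> C powr r" using r I by (simp add: powr_powr)
  next
    assume "I \<le> C powr r"
    then have "I powr (1 / r) \<le> (C powr r) powr (1 / r)" using r I by (intro powr_mono2) auto
    then show "I powr (1 / r) \<le> C" using r C by (simp add: powr_powr)
  qed
  ultimately show ?thesis using I C by (simp add: ennreal_le_iff)
qed

lemma bnorm_le_iff_infinity:
  assumes f: "f \<in> borel_measurable (bessel_measure \<alpha>)" and C: "C \<ge> 0"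
  shows "bnorm top \<alpha> f \<le> ennreal C \<longleftrightarrow> (AE x in bessel_measure \<alpha>. norm (f x) \<le> C)"
proof
  assume "bnorm top \<alpha> f \<le> ennreal C"
  then have l: "esssup (bessel_measure \<alpha>) (\<lambda>x. ennreal (cmod (f x))) \<le> ennreal C" by (simp add: bnorm_def)
  have "AE x in bessel_measure \<alpha>. ennreal (cmod (f x)) \<le> ennreal C"
    using esssup_AE[of "\<lambda>x. ennreal (cmod (f x))"] by eventually_elim (rule order_trans[OF _ l])
  then show "AE x in bessel_measure \<alpha>. norm (f x) \<le> C" using C by (simp add: ennreal_le_iff)
next
  assume "AE x in bessel_measure \<alpha>. norm (f x) \<le> C"
  then have "AE x in bessel_measure \<alpha>. ennreal (cmod (f x)) \<le> ennreal C" using C by (simp add: ennreal_le_iff)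
  then show "bnorm top \<alpha> f \<le> ennreal C" using f by (simp add: bnorm_def esssup_I)
qed

lemma exponent_cases:
  assumes "(1::ennreal) \<le> q"
  obtains "q = top" | r where "q = ennreal r" "r \<ge> 1"
  using assms by (cases q) (auto simp flip: ennreal_1)

lemma bnorm_le_cmult:
  assumes q: "1 \<le> q" and c: "c \<ge> 0"
    and f: "f \<in> borel_measurable (bessel_measure \<alpha>)" and g: "g \<in> borel_measurable (bessel_measure \<alpha>)"
    and le: "AE x in bessel_measure \<alpha>. norm (f x) \<le> c * norm (g x)"
  shows "bnorm q \<alpha> f \<le> ennreal c * bnorm q \<alpha> g"
proof (cases "bnorm q \<alpha> g = \<infinity> \<and> c > 0")
  case True
  then show ?thesis by (simp add: ennreal_mult_top)
next
  case False
  define B where "B = (if bnorm q \<alpha> g = \<infinity> then 0 else enn2real (bnorm q \<alpha> g))"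
  have B0: "B \<ge> 0" by (simp add: B_def)
  have cB: "ennreal c * bnorm q \<alpha> g = ennreal (c * B)"
    using False c by (auto simp: B_def ennreal_mult less_top)
  have gB: "bnorm q \<alpha> g \<le> ennreal B" if "c > 0"
    using False that by (simp add: B_def less_top)
  from q have "bnorm q \<alpha> f \<le> ennreal (c * B)"
  proof (cases rule: exponent_cases)
    case 1
    have "AE x in bessel_measure \<alpha>. norm (f x) \<le> c * B"
    proof (cases "c = 0")
      case False
      then have "AE x in bessel_measure \<alpha>. norm (g x) \<le> B"
        using gB c g B0 by (simp add: 1 bnorm_le_iff_infinity)
      with le show ?thesis
        by eventually_elim (meson c mult_left_mono order_trans)
    qed (use le in simp)
    then show ?thesis using c B0 f by (simp add: 1 bnorm_le_iff_infinity)
  next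
    case (2 r)
    have "(\<integral>\<^sup>+x. ennreal (norm (f x) powr r) \<partial>bessel_measure \<alpha>) \<le>
        (\<integral>\<^sup>+x. ennreal (c powr r) * ennreal (norm (g x) powr r) \<partial>bessel_measure \<alpha>)"
    proof (rule nn_integral_mono_AE)
      show "AE x in bessel_measure \<alpha>. ennreal (norm (f x) powr r) \<le> ennreal (c powr r) * ennreal (norm (g x) powr r)"
        using le
      proof eventually_elim
        case (elim x)
        then have "norm (f x) powr r \<le> (c * norm (g x)) powr r" using 2 by (intro powr_mono2) auto
        then show ?case using c by (simp add: powr_mult ennreal_mult[symmetric] ennreal_leI)
      qed
    qed
    also have "\<dots> = ennreal (c powr r) * (\<integral>\<^sup>+x. ennreal (norm (g x) powr r) \<partial>bessel_measure \<alpha>)"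
      using g by (intro nn_integral_cmult) measurable
    also have "\<dots> \<le> ennreal ((c * B) powr r)"
    proof (cases "c = 0")
      case False
      then have "(\<integral>\<^sup>+x. ennreal (norm (g x) powr r) \<partial>bessel_measure \<alpha>) \<le> ennreal (B powr r)"
        using gB c 2 B0 by (simp add: bnorm_le_iff_finite)
      then show ?thesis using c B0 by (simp add: powr_mult ennreal_mult mult_left_mono)
    qed (use 2 in simp)
    finally show ?thesis using 2 c B0 by (simp add: bnorm_le_iff_finite)
  qed
  then show ?thesis by (simp add: cB)
qed

lemma bnorm_mono:
  assumes "1 \<le> q" "f \<in> borel_measurable (bessel_measure \<alpha>)" "g \<in> borel_measurable (bessel_measure \<alpha>)"
    and "AE x in bessel_measure \<alpha>. norm (f x) \<le> norm (g x)"
  shows "bnorm q \<alpha> f \<le> bnorm q \<alpha> g"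
  using bnorm_le_cmult[of q 1 f \<alpha> g] assms by simp

lemma bnorm_cong:
  assumes "1 \<le> q" "f \<in> borel_measurable (bessel_measure \<alpha>)" "g \<in> borel_measurable (bessel_measure \<alpha>)"
    and "AE x in bessel_measure \<alpha>. f x = g x"
  shows "bnorm q \<alpha> f = bnorm q \<alpha> g"
  using assms by (intro antisym bnorm_mono) (auto elim: eventually_mono)

text \<open>
  A triangle inequality up to a constant is enough for questions of convergence, and follows from
  \<open>\<bar>u + v\<bar> \<le> 2 max \<bar>u\<bar> \<bar>v\<bar>\<close>.
\<close>

lemma bnorm_add_le:
  assumes q: "1 \<le> q"
    and f: "f \<in> borel_measurable (bessel_measure \<alpha>)" and g: "g \<in> borel_measurable (bessel_measure \<alpha>)"
  shows "bnorm q \<alpha> (\<lambda>x. f x + g x) \<le> 2 * (bnorm q \<alpha> f + bnorm q \<alpha> g)"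
proof (cases "bnorm q \<alpha> f = \<infinity> \<or> bnorm q \<alpha> g = \<infinity>")
  case True
  then show ?thesis by (auto simp: ennreal_mult_top)
next
  case False
  define A where "A = enn2real (bnorm q \<alpha> f)"
  define B where "B = enn2real (bnorm q \<alpha> g)"
  have AB0: "A \<ge> 0" "B \<ge> 0" by (simp_all add: A_def B_def)
  have AB: "bnorm q \<alpha> f = ennreal A" "bnorm q \<alpha> g = ennreal B"
    using False by (simp_all add: A_def B_def less_top)
  from q have "bnorm q \<alpha> (\<lambda>x. f x + g x) \<le> ennreal (2 * (A + B))"
  proof (cases rule: exponent_cases)
    case 1
    have "AE x in bessel_measure \<alpha>. norm (f x) \<le> A" "AE x in bessel_measure \<alpha>. norm (g x) \<le> B"
      using AB AB0 f g unfolding 1 by (simp_all flip: bnorm_le_iff_infinity)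
    then have "AE x in bessel_measure \<alpha>. norm (f x + g x) \<le> 2 * (A + B)"
      by eventually_elim (use AB0 norm_triangle_ineq in \<open>fastforce intro: order_trans\<close>)
    then show ?thesis unfolding 1 using f g AB0 by (subst bnorm_le_iff_infinity) auto
  next
    case (2 r)
    have i: "(\<integral>\<^sup>+x. ennreal (norm (f x) powr r) \<partial>bessel_measure \<alpha>) \<le> ennreal (A powr r)"
      "(\<integral>\<^sup>+x. ennreal (norm (g x) powr r) \<partial>bessel_measure \<alpha>) \<le> ennreal (B powr r)"
      using AB AB0 2 by (simp_all flip: bnorm_le_iff_finite)
    have "(\<integral>\<^sup>+x. ennreal (norm (f x + g x) powr r) \<partial>bessel_measure \<alpha>) \<le>
        (\<integral>\<^sup>+x. ennreal (2 powr r) * (ennreal (norm (f x) powr r) + ennreal (norm (g x) powr r)) \<partial>bessel_measure \<alpha>)"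
    proof (rule nn_integral_mono)
      fix x
      have "norm (f x + g x) \<le> 2 * max (norm (f x)) (norm (g x))"
        using norm_triangle_ineq[of "f x" "g x"] by linarith
      then have "norm (f x + g x) powr r \<le> (2 * max (norm (f x)) (norm (g x))) powr r"
        using 2 by (intro powr_mono2) auto
      also have "\<dots> \<le> 2 powr r * (norm (f x) powr r + norm (g x) powr r)"
        by (simp add: powr_mult max_def)
      finally show "ennreal (norm (f x + g x) powr r) \<le>
          ennreal (2 powr r) * (ennreal (norm (f x) powr r) + ennreal (norm (g x) powr r))"
        by (simp add: ennreal_leI flip: ennreal_plus ennreal_mult)
    qed
    also have "\<dots> = ennreal (2 powr r) * ((\<integral>\<^sup>+x. ennreal (norm (f x) powr r) \<partial>bessel_measure \<alpha>) +
        (\<integral>\<^sup>+x. ennreal (norm (g x) powr r) \<partial>bessel_measure \<alpha>))"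
      using f g by (subst nn_integral_cmult) (auto simp: nn_integral_add)
    also have "\<dots> \<le> ennreal (2 powr r) * (ennreal (A powr r) + ennreal (B powr r))"
      by (intro mult_left_mono add_mono i) auto
    also have "\<dots> = ennreal (2 powr r * (A powr r + B powr r))"
      by (simp flip: ennreal_plus ennreal_mult)
    also have "\<dots> \<le> ennreal ((2 * (A + B)) powr r)"
    proof (rule ennreal_leI)
      have s: "x powr r = x * x powr (r - 1)" if "x \<ge> 0" for x :: real
        using that by (cases "x = 0") (simp_all add: powr_diff)
      have "A powr r + B powr r \<le> A * (A + B) powr (r - 1) + B * (A + B) powr (r - 1)"
        using AB0 2 by (simp only: s) (intro add_mono mult_left_mono powr_mono2; simp)
      also have "\<dots> = (A + B) powr r" using AB0 s[of "A + B"] by (simp add: distrib_right)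
      finally show "2 powr r * (A powr r + B powr r) \<le> (2 * (A + B)) powr r"
        using AB0 by (simp only: powr_mult zero_le_numeral add_nonneg_nonneg) simp
    qed
    finally show ?thesis unfolding 2(1) using 2(2) AB0 by (subst bnorm_le_iff_finite) auto
  qed
  also have "ennreal (2 * (A + B)) = 2 * (bnorm q \<alpha> f + bnorm q \<alpha> g)"
    using AB0 by (simp add: AB ennreal_mult)
  finally show ?thesis .
qed

lemma bnorm_diff_le:
  assumes "1 \<le> q" "f \<in> borel_measurable (bessel_measure \<alpha>)" "g \<in> borel_measurable (bessel_measure \<alpha>)"
  shows "bnorm q \<alpha> (\<lambda>x. f x - g x) \<le> 2 * (bnorm q \<alpha> f + bnorm q \<alpha> g)"
proof -
  have "bnorm q \<alpha> (\<lambda>x. - g x) \<le> bnorm q \<alpha> g"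
    using assms by (intro bnorm_mono) auto
  then have "2 * (bnorm q \<alpha> f + bnorm q \<alpha> (\<lambda>x. - g x)) \<le> 2 * (bnorm q \<alpha> f + bnorm q \<alpha> g)"
    by (intro mult_left_mono add_left_mono) auto
  then show ?thesis
    using bnorm_add_le[of q f \<alpha> "\<lambda>x. - g x"] assms by (auto intro: order_trans)
qed

lemma bnorm_minus_commute:
  assumes "1 \<le> q" "f \<in> borel_measurable (bessel_measure \<alpha>)" "g \<in> borel_measurable (bessel_measure \<alpha>)"
  shows "bnorm q \<alpha> (\<lambda>x. f x - g x) = bnorm q \<alpha> (\<lambda>x. g x - f x)"
  using assms by (intro antisym bnorm_mono) (auto simp: norm_minus_commute)

lemma measurable_bessel_translation:
  assumes a: "\<alpha> \<ge> - 1 / 2" and t: "t \<ge> 0" and f: "f \<in> borel_measurable (bessel_measure \<alpha>)"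
  shows "bessel_translation \<alpha> t f \<in> borel_measurable (bessel_measure \<alpha>)"
proof -
  obtain f' where f': "f' \<in> borel_measurable borel" "AE x in radial_measure \<alpha>. f x = f' x"
    using f by (rule borel_representative)
  show ?thesis
    by (rule measurable_if_borel_representative[OF borel_measurable_translate[OF a f'(1)] bessel_translation_eq_translate[OF a t f']])
qed

text \<open>Jensen's inequality in the angle, followed by the invariance of the measure.\<close>

lemma bnorm_bessel_translation_le:
  assumes a: "\<alpha> \<ge> - 1 / 2" and t: "t \<ge> 0" and q: "1 \<le> q" and f: "f \<in> borel_measurable (bessel_measure \<alpha>)"
  shows "bnorm q \<alpha> (bessel_translation \<alpha> t f) \<le> bnorm q \<alpha> f"
proof (cases "bnorm q \<alpha> f = \<infinity>")
  case False
  interpret A: prob_space "angle_measure \<alpha>" using a by (rule prob_space_angle_measure)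
  define B where "B = enn2real (bnorm q \<alpha> f)"
  have B: "bnorm q \<alpha> f = ennreal B" "B \<ge> 0" using False by (simp_all add: B_def less_top)
  obtain f' where f' [measurable]: "f' \<in> borel_measurable borel" and ae: "AE x in radial_measure \<alpha>. f x = f' x"
    using f by (rule borel_representative)
  note fm = borel_measurable_bessel_measure_if_borel
  note [measurable] = borel_measurable_translate[OF a]
  have ff': "bnorm q \<alpha> f' = bnorm q \<alpha> f"
    using ae by (intro bnorm_cong q f fm f') (auto simp: AE_bessel_measure elim: eventually_mono)
  have "bnorm q \<alpha> (bessel_translation \<alpha> t f) = bnorm q \<alpha> (translate \<alpha> t f')"
    using bessel_translation_eq_translate[OF a t f' ae]
    by (intro bnorm_cong q measurable_bessel_translation[OF a t f] fm) (auto simp: AE_bessel_measure)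
  also have "\<dots> \<le> ennreal B"
    using q
  proof (cases rule: exponent_cases)
    case 1
    have "bnorm top \<alpha> f' \<le> ennreal B" using ff' B by (simp add: 1)
    then have "AE x in radial_measure \<alpha>. norm (f' x) \<le> B"
      using B by (simp add: bnorm_le_iff_infinity[OF fm[OF f']] AE_bessel_measure)
    then have "AE s in radial_measure \<alpha>. AE \<phi> in angle_measure \<alpha>. norm (f' (third_side t s \<phi>)) \<le> B"
      by (rule AE_third_side[OF a t])
    then have "AE s in radial_measure \<alpha>. norm (translate \<alpha> t f' s) \<le> B"
    proof eventually_elim
      case (elim s)
      have "integrable (angle_measure \<alpha>) (\<lambda>\<phi>. f' (third_side t s \<phi>))"
        using elim by (intro A.integrable_const_bound[of _ B]) auto
      then have "(\<integral>\<phi>. norm (f' (third_side t s \<phi>)) \<partial>angle_measure \<alpha>) \<le> (\<integral>\<phi>. B \<partial>angle_measure \<alpha>)"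
        using elim by (intro integral_mono_AE) auto
      moreover have "norm (translate \<alpha> t f' s) \<le> (\<integral>\<phi>. norm (f' (third_side t s \<phi>)) \<partial>angle_measure \<alpha>)"
        unfolding translate_def by (rule integral_norm_bound)
      ultimately show ?case by (simp add: measure_angle_measure[OF a])
    qed
    then show ?thesis using B by (simp add: 1 bnorm_le_iff_infinity fm AE_bessel_measure)
  next
    case (2 r)
    have "(\<integral>\<^sup>+s. ennreal (norm (translate \<alpha> t f' s) powr r) \<partial>bessel_measure \<alpha>) =
        (\<integral>\<^sup>+s. ennreal (norm (translate \<alpha> t f' s) powr r) \<partial>radial_measure \<alpha>)"
      by (rule nn_integral_bessel_measure) measurable
    also have "\<dots> \<le> (\<integral>\<^sup>+s. \<integral>\<^sup>+\<phi>. ennreal (norm (f' (third_side t s \<phi>)) powr r) \<partial>angle_measure \<alpha> \<partial>radial_measure \<alpha>)"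
      unfolding translate_def using 2 by (intro nn_integral_mono A.norm_integral_powr_le) auto
    also have "\<dots> = (\<integral>\<^sup>+s. ennreal (norm (f' s) powr r) \<partial>radial_measure \<alpha>)"
      by (rule nn_integral_translate[OF a t]) measurable
    also have "\<dots> = (\<integral>\<^sup>+s. ennreal (norm (f' s) powr r) \<partial>bessel_measure \<alpha>)"
      by (rule nn_integral_bessel_measure[symmetric]) measurable
    also have "\<dots> \<le> ennreal (B powr r)"
      using ff' B 2 by (simp flip: bnorm_le_iff_finite)
    finally show ?thesis using 2 B by (simp add: bnorm_le_iff_finite)
  qed
  finally show ?thesis by (simp add: B)
qed simp

section \<open>The transform on the weighted spaces\<close>

lemma conjugate_exponent_cases:
  fixes p p' :: ennreal
  assumes "1 \<le> p" "p \<le> 2" "1 / p + 1 / p' = 1"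
  obtains "p = 1" "p' = top"
  | r where "p = ennreal r" "1 < r" "r \<le> 2" "p' = ennreal (r / (r - 1))"
proof -
  obtain r where r: "p = ennreal r" "r \<ge> 0"
    using assms(2) by (cases p) (auto simp: top_unique)
  have r12: "1 \<le> r" "r \<le> 2"
    using assms(1,2) r by (auto simp flip: ennreal_1 ennreal_numeral)
  have d: "1 / p = ennreal (1 / r)"
    using r r12 by (simp add: divide_ennreal flip: ennreal_1)
  show thesis
  proof (cases p')
    case top
    with assms(3) d r12 have "r = 1" by simp
    then show thesis using r top that(1) by simp
  next
    case (real s)
    have s: "s > 0"
      using real assms(3) by (cases "s = 0") (auto simp: ennreal_divide_zero)
    then have "1 / p' = ennreal (1 / s)" using real by (simp add: divide_ennreal flip: ennreal_1)
    with assms(3) d r12 s have "ennreal (1 / r + 1 / s) = ennreal 1" by (simp add: ennreal_plus)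
    then have e: "1 / r + 1 / s = 1" using r12 s by (simp only: ennreal_inj add_nonneg_nonneg divide_nonneg_nonneg zero_le_one)
    then have "r \<noteq> 1" using s by auto
    then have r1: "r > 1" using r12 by simp
    have "s = r / (r - 1)" using e s r1 by (simp add: field_simps)
    then show thesis using r r1 r12 real that(2) by simp
  qed
qed

lemma bspace_measurable: "f \<in> bspace q \<alpha> \<Longrightarrow> f \<in> borel_measurable (bessel_measure \<alpha>)"
  by (simp add: bspace_def)

lemma bnorm_finite: "f \<in> bspace q \<alpha> \<Longrightarrow> bnorm q \<alpha> f < \<infinity>"
  by (simp add: bspace_def)

lemma bspace_bound:
  assumes "f \<in> bspace q \<alpha>"
  obtains B where "B \<ge> 0" "bnorm q \<alpha> f = ennreal B"
  using bnorm_finite[OF assms] by (cases "bnorm q \<alpha> f") auto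

lemma bspaceI:
  assumes "f \<in> borel_measurable (bessel_measure \<alpha>)" "bnorm q \<alpha> f \<le> B" "B < \<infinity>"
  shows "f \<in> bspace q \<alpha>"
  using assms by (auto simp: bspace_def intro: le_less_trans)

lemma bspace_diff:
  assumes "1 \<le> q" and f: "f \<in> bspace q \<alpha>" and g: "g \<in> bspace q \<alpha>"
  shows "(\<lambda>x. f x - g x) \<in> bspace q \<alpha>"
proof (rule bspaceI)
  show "bnorm q \<alpha> (\<lambda>x. f x - g x) \<le> 2 * (bnorm q \<alpha> f + bnorm q \<alpha> g)"
    using assms by (intro bnorm_diff_le bspace_measurable)
  show "2 * (bnorm q \<alpha> f + bnorm q \<alpha> g) < \<infinity>"
    using bnorm_finite[OF f] bnorm_finite[OF g] by (simp add: ennreal_mult_less_top)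
  show "(\<lambda>x. f x - g x) \<in> borel_measurable (bessel_measure \<alpha>)"
    using bspace_measurable[OF f] bspace_measurable[OF g] by (rule borel_measurable_diff)
qed

lemma bspace_dominated:
  assumes "1 \<le> q" "c \<ge> 0" and f: "f \<in> borel_measurable (bessel_measure \<alpha>)" and g: "g \<in> bspace q \<alpha>"
    and "AE x in bessel_measure \<alpha>. norm (f x) \<le> c * norm (g x)"
  shows "f \<in> bspace q \<alpha>"
proof (rule bspaceI[OF f bnorm_le_cmult])
  show "ennreal c * bnorm q \<alpha> g < \<infinity>" using bnorm_finite[OF g] by (simp add: ennreal_mult_less_top)
qed (use assms bspace_measurable[OF g] in auto)

lemma integrable_borel_representative:
  assumes "f \<in> bspace 1 \<alpha>" and f': "f' \<in> borel_measurable borel" "AE x in radial_measure \<alpha>. f x = f' x"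
  shows "integrable (radial_measure \<alpha>) f'"
    and "ennreal (\<integral>x. norm (f' x) \<partial>radial_measure \<alpha>) \<le> bnorm 1 \<alpha> f"
proof -
  obtain B where B: "B \<ge> 0" "bnorm 1 \<alpha> f = ennreal B" by (rule bspace_bound[OF assms(1)])
  have "bnorm (ennreal 1) \<alpha> f = ennreal B" using B by simp
  then have "(\<integral>\<^sup>+x. ennreal (norm (f x) powr 1) \<partial>bessel_measure \<alpha>) \<le> ennreal (B powr 1)"
    using B by (intro bnorm_le_iff_finite[THEN iffD1]) auto
  then have "(\<integral>\<^sup>+x. ennreal (norm (f x)) \<partial>bessel_measure \<alpha>) \<le> ennreal B"
    using B by simp
  also have "(\<integral>\<^sup>+x. ennreal (norm (f x)) \<partial>bessel_measure \<alpha>) = (\<integral>\<^sup>+x. ennreal (norm (f' x)) \<partial>bessel_measure \<alpha>)"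
    using f'(2) by (intro nn_integral_cong_AE) (auto simp: AE_bessel_measure elim: eventually_mono)
  also have "\<dots> = (\<integral>\<^sup>+x. ennreal (norm (f' x)) \<partial>radial_measure \<alpha>)"
    using f'(1) by (intro nn_integral_bessel_measure) measurable
  finally have l: "(\<integral>\<^sup>+x. ennreal (norm (f' x)) \<partial>radial_measure \<alpha>) \<le> ennreal B" .
  then show i: "integrable (radial_measure \<alpha>) f'"
    using f'(1) by (intro integrableI_bounded) (auto intro: le_less_trans)
  show "ennreal (\<integral>x. norm (f' x) \<partial>radial_measure \<alpha>) \<le> bnorm 1 \<alpha> f"
    using l i B by (subst nn_integral_eq_integral[symmetric]) auto
qed

lemma measurable_hankel_integral:
  assumes a: "\<alpha> \<ge> - 1 / 2" and f: "f \<in> bspace q \<alpha>"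
  shows "hankel_integral \<alpha> f \<in> borel_measurable borel"
proof -
  obtain f' where f': "f' \<in> borel_measurable borel" "AE x in radial_measure \<alpha>. f x = f' x"
    using bspace_measurable[OF f] by (rule borel_representative)
  show ?thesis
    unfolding hankel_integral_eq_radial_hankel[OF a f'] by (rule borel_measurable_radial_hankel[OF a f'(1)])
qed

lemma hankel_integral_diff:
  assumes a: "\<alpha> \<ge> - 1 / 2" and f: "f \<in> bspace 1 \<alpha>" and g: "g \<in> bspace 1 \<alpha>"
  shows "hankel_integral \<alpha> (\<lambda>x. f x - g x) y = hankel_integral \<alpha> f y - hankel_integral \<alpha> g y"
proof -
  obtain f' where f': "f' \<in> borel_measurable borel" "AE x in radial_measure \<alpha>. f x = f' x"
    using bspace_measurable[OF f] by (rule borel_representative)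
  obtain g' where g': "g' \<in> borel_measurable borel" "AE x in radial_measure \<alpha>. g x = g' x"
    using bspace_measurable[OF g] by (rule borel_representative)
  have d: "AE x in radial_measure \<alpha>. f x - g x = f' x - g' x"
    using f'(2) g'(2) by eventually_elim simp
  show ?thesis
    using hankel_integral_eq_radial_hankel[OF a borel_measurable_diff[OF f'(1) g'(1)] d]
      hankel_integral_eq_radial_hankel[OF a f'] hankel_integral_eq_radial_hankel[OF a g']
    by (simp add: radial_hankel_diff[OF a] integrable_borel_representative(1)[OF f f'] integrable_borel_representative(1)[OF g g'])
qed

text \<open>
  The three ranges \<open>p = 1\<close>, \<open>p = 2\<close> and \<open>1 < p < 2\<close> are the trivial bound, Plancherel's inequality and the
  interpolation between them.
\<close>

theorem hausdorff_young:
  assumes a: "\<alpha> \<ge> - 1 / 2" and p: "1 \<le> p" "p \<le> 2" "1 / p + 1 / p' = 1"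
  obtains C where "C \<ge> 0"
    "\<And>f. f \<in> bspace 1 \<alpha> \<Longrightarrow> f \<in> bspace p \<alpha> \<Longrightarrow> bnorm p' \<alpha> (hankel_integral \<alpha> f) \<le> ennreal C * bnorm p \<alpha> f"
  using p
proof (cases rule: conjugate_exponent_cases)
  case 1
  have "bnorm p' \<alpha> (hankel_integral \<alpha> f) \<le> ennreal (hankel_const \<alpha>) * bnorm p \<alpha> f" if f: "f \<in> bspace 1 \<alpha>" for f
  proof -
    obtain f' where f': "f' \<in> borel_measurable borel" "AE x in radial_measure \<alpha>. f x = f' x"
      using bspace_measurable[OF f] by (rule borel_representative)
    note i = integrable_borel_representative[OF f f']
    have c: "hankel_const \<alpha> > 0" by (rule hankel_const_pos[OF a])
    have "bnorm top \<alpha> (hankel_integral \<alpha> f) \<le> ennreal (hankel_const \<alpha> * (\<integral>x. norm (f' x) \<partial>radial_measure \<alpha>))"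
      using c norm_radial_hankel_le[OF a i(1)]
      by (subst bnorm_le_iff_infinity)
        (auto simp: hankel_integral_eq_radial_hankel[OF a f'] borel_measurable_bessel_measure_if_borel borel_measurable_radial_hankel[OF a f'(1)])
    also have "\<dots> \<le> ennreal (hankel_const \<alpha>) * bnorm 1 \<alpha> f"
      using c i(2) by (simp add: ennreal_mult mult_left_mono)
    finally show ?thesis by (simp add: 1)
  qed
  then show thesis using that[of "hankel_const \<alpha>"] hankel_const_pos[OF a] by simp
next
  case (2 r)
  define q where "q = r / (r - 1)"
  have q: "q \<ge> 2" using 2 by (simp add: q_def field_simps)
  define D where "D = (if r = 2 then 1 else 4 * q / (q - 2) * (2 * hankel_const \<alpha>) powr (q - 2))"
  have D: "D \<ge> 0" using q by (simp add: D_def)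
  have "bnorm p' \<alpha> (hankel_integral \<alpha> f) \<le> ennreal (D powr (1 / q)) * bnorm p \<alpha> f"
    if f: "f \<in> bspace 1 \<alpha>" and fp: "f \<in> bspace p \<alpha>" for f
  proof -
    obtain f' where f': "f' \<in> borel_measurable borel" "AE x in radial_measure \<alpha>. f x = f' x"
      using bspace_measurable[OF f] by (rule borel_representative)
    note [measurable] = f'(1) borel_measurable_radial_hankel[OF a]
    note i = integrable_borel_representative[OF f f']
    obtain B where B: "B \<ge> 0" "bnorm p \<alpha> f = ennreal B" by (rule bspace_bound[OF fp])
    have "(\<integral>\<^sup>+x. ennreal (norm (f x) powr r) \<partial>bessel_measure \<alpha>) \<le> ennreal (B powr r)"
      using B 2 by (simp flip: bnorm_le_iff_finite)
    also have "(\<integral>\<^sup>+x. ennreal (norm (f x) powr r) \<partial>bessel_measure \<alpha>) = (\<integral>\<^sup>+x. ennreal (norm (f' x) powr r) \<partial>bessel_measure \<alpha>)"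
      using f'(2) by (intro nn_integral_cong_AE) (auto simp: AE_bessel_measure elim: eventually_mono)
    also have "\<dots> = (\<integral>\<^sup>+x. ennreal (norm (f' x) powr r) \<partial>radial_measure \<alpha>)"
      by (intro nn_integral_bessel_measure) measurable
    finally have l: "(\<integral>\<^sup>+x. ennreal (norm (f' x) powr r) \<partial>radial_measure \<alpha>) \<le> ennreal (B powr r)" .
    then obtain I where I: "(\<integral>\<^sup>+x. ennreal (norm (f' x) powr r) \<partial>radial_measure \<alpha>) = ennreal I" "I \<ge> 0"
      by (cases "\<integral>\<^sup>+x. ennreal (norm (f' x) powr r) \<partial>radial_measure \<alpha>") (auto simp: top_unique)
    have IB: "I \<le> B powr r" using l I by (simp add: ennreal_le_iff)
    have "(\<integral>\<^sup>+y. ennreal (norm (hankel_integral \<alpha> f y) powr q) \<partial>bessel_measure \<alpha>) =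
        (\<integral>\<^sup>+y. ennreal (norm (radial_hankel \<alpha> f' y) powr q) \<partial>radial_measure \<alpha>)"
      unfolding hankel_integral_eq_radial_hankel[OF a f'] by (intro nn_integral_bessel_measure) measurable
    also have "\<dots> \<le> ennreal (D * I powr (q - 1))"
    proof (cases "r = 2")
      case True
      then have "q = 2" by (simp add: q_def)
      then show ?thesis
        using radial_hankel_L2[OF a i(1)] I True by (simp add: D_def)
    next
      case False
      then show ?thesis
        using radial_hausdorff_young[OF a _ _ q_def i(1) I] 2 by (simp add: D_def)
    qed
    also have "\<dots> \<le> ennreal ((D powr (1 / q) * B) powr q)"
    proof (rule ennreal_leI)
      have "I powr (q - 1) \<le> (B powr r) powr (q - 1)" using I IB q by (intro powr_mono2) auto
      also have "\<dots> = B powr q"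
      proof -
        have "r * (q - 1) = q" using 2 by (simp add: q_def field_simps)
        then show ?thesis by (simp add: powr_powr)
      qed
      finally show "D * I powr (q - 1) \<le> (D powr (1 / q) * B) powr q"
        using D B q by (simp add: powr_mult powr_powr mult_left_mono)
    qed
    finally have "bnorm (ennreal q) \<alpha> (hankel_integral \<alpha> f) \<le> ennreal (D powr (1 / q) * B)"
      using q D B by (subst bnorm_le_iff_finite) auto
    then show ?thesis using 2 B by (simp add: q_def ennreal_mult)
  qed
  then show thesis using that[of "D powr (1 / q)"] by simp
qed

text \<open>
  Completeness, for sequences that converge so rapidly that they converge almost everywhere; the
  rate is kept in the limit by Fatou's lemma.
\<close>

lemma bnorm_cauchy_limit:
  fixes u :: "nat \<Rightarrow> real \<Rightarrow> complex" and r :: real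
  assumes r: "r \<ge> 1" and u [measurable]: "\<And>k. u k \<in> borel_measurable (bessel_measure \<alpha>)"
    and cauchy: "\<And>k l. k \<le> l \<Longrightarrow> bnorm (ennreal r) \<alpha> (\<lambda>x. u k x - u l x) \<le> ennreal ((1 / 4) ^ k)"
  obtains g where "g \<in> borel_measurable (bessel_measure \<alpha>)"
    "\<And>k. bnorm (ennreal r) \<alpha> (\<lambda>x. u k x - g x) \<le> ennreal ((1 / 4) ^ k)"
proof -
  define g where "g x = lim (\<lambda>k. u k x)" for x
  have g [measurable]: "g \<in> borel_measurable (bessel_measure \<alpha>)"
    unfolding g_def by (rule borel_measurable_lim_metric) measurable
  have n: "(\<integral>\<^sup>+x. ennreal (norm (u k x - u l x) powr r) \<partial>bessel_measure \<alpha>) \<le> ennreal (((1 / 4) ^ k) powr r)" if "k \<le> l" for k l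
    using cauchy[OF that] r by (subst (asm) bnorm_le_iff_finite) auto
  \<comment> \<open>The weights \<open>2 ^ k\<close> leave a summable majorant of the increments at almost every point.\<close>
  define S where "S x = (\<Sum>k. ennreal ((2 ^ k * norm (u k x - u (Suc k) x)) powr r))" for x
  have "(\<integral>\<^sup>+x. S x \<partial>bessel_measure \<alpha>) = (\<Sum>k. \<integral>\<^sup>+x. ennreal ((2 ^ k * norm (u k x - u (Suc k) x)) powr r) \<partial>bessel_measure \<alpha>)"
    unfolding S_def by (rule nn_integral_suminf) measurable
  also have "\<dots> \<le> (\<Sum>k. ennreal ((1 / 2) ^ k))"
  proof (rule suminf_le)
    fix k
    have "(\<integral>\<^sup>+x. ennreal ((2 ^ k * norm (u k x - u (Suc k) x)) powr r) \<partial>bessel_measure \<alpha>) =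
        (\<integral>\<^sup>+x. ennreal ((2 ^ k) powr r) * ennreal (norm (u k x - u (Suc k) x) powr r) \<partial>bessel_measure \<alpha>)"
      by (intro nn_integral_cong) (simp add: powr_mult ennreal_mult)
    also have "\<dots> = ennreal ((2 ^ k) powr r) * (\<integral>\<^sup>+x. ennreal (norm (u k x - u (Suc k) x) powr r) \<partial>bessel_measure \<alpha>)"
      by (rule nn_integral_cmult) measurable
    also have "\<dots> \<le> ennreal ((2 ^ k) powr r) * ennreal (((1 / 4) ^ k) powr r)"
      by (intro mult_left_mono n) auto
    also have "\<dots> = ennreal ((2 ^ k * (1 / 4) ^ k) powr r)"
      by (simp add: powr_mult ennreal_mult)
    also have "2 ^ k * (1 / 4) ^ k = (1 / 2 :: real) ^ k"
      by (simp flip: power_mult_distrib)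
    also have "ennreal (((1 / 2) ^ k) powr r) \<le> ennreal ((1 / 2) ^ k)"
    proof (rule ennreal_leI)
      have "((1 / 2) ^ k) powr r \<le> ((1 / 2 :: real) ^ k) powr 1"
        using r by (intro powr_mono') (auto simp: power_le_one)
      then show "((1 / 2) ^ k) powr r \<le> ((1 / 2) ^ k :: real)" by simp
    qed
    finally show "(\<integral>\<^sup>+x. ennreal ((2 ^ k * norm (u k x - u (Suc k) x)) powr r) \<partial>bessel_measure \<alpha>) \<le> ennreal ((1 / 2) ^ k)" .
  qed auto
  also have "\<dots> < \<infinity>"
    by (subst suminf_ennreal2) (auto intro!: summable_geometric)
  finally have "(\<integral>\<^sup>+x. S x \<partial>bessel_measure \<alpha>) \<noteq> \<infinity>" by simp
  then have "AE x in bessel_measure \<alpha>. S x \<noteq> \<infinity>"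
    by (intro nn_integral_noteq_infinite) (auto simp: S_def)
  then have conv: "AE x in bessel_measure \<alpha>. (\<lambda>k. u k x) \<longlonglongrightarrow> g x"
  proof eventually_elim
    case (elim x)
    then obtain s where s: "S x = ennreal s" "s \<ge> 0" by (cases "S x") auto
    have b: "norm (u (Suc k) x - u k x) \<le> s powr (1 / r) * (1 / 2) ^ k" for k
    proof -
      have "sum (\<lambda>k. ennreal ((2 ^ k * norm (u k x - u (Suc k) x)) powr r)) {k} \<le> S x"
        unfolding S_def by (rule sum_le_suminf) (rule summableI, simp_all only: finite.intros zero_le)
      then have "ennreal ((2 ^ k * norm (u k x - u (Suc k) x)) powr r) \<le> S x"
        by (simp only: sum.insert_if finite.emptyI sum.empty empty_iff if_False add_0_right)
      then have "(2 ^ k * norm (u k x - u (Suc k) x)) powr r \<le> s"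
        using s by (simp add: ennreal_le_iff)
      then have "((2 ^ k * norm (u k x - u (Suc k) x)) powr r) powr (1 / r) \<le> s powr (1 / r)"
        using r by (intro powr_mono2) auto
      then have "2 ^ k * norm (u k x - u (Suc k) x) \<le> s powr (1 / r)"
        using r by (simp add: powr_powr)
      then have "norm (u k x - u (Suc k) x) \<le> s powr (1 / r) / 2 ^ k"
        by (subst pos_le_divide_eq) (simp_all add: mult.commute)
      then show ?thesis unfolding norm_minus_commute[of "u (Suc k) x"] by (simp add: power_divide)
    qed
    have "summable (\<lambda>k. s powr (1 / r) * (1 / 2) ^ k)"
      by (intro summable_mult summable_geometric) simp
    then have "summable (\<lambda>k. u (Suc k) x - u k x)"
      by (rule summable_comparison_test'[where N = 0]) (rule b)
    then have "convergent (\<lambda>k. u k x - u 0 x)"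
      by (simp only: summable_iff_convergent sum_lessThan_telescope[of "\<lambda>k. u k x"])
    then have "convergent (\<lambda>k. u k x)"
      by (simp add: convergent_diff_const_right_iff)
    then show ?case by (simp add: g_def convergent_LIMSEQ_iff)
  qed
  have "bnorm (ennreal r) \<alpha> (\<lambda>x. u k x - g x) \<le> ennreal ((1 / 4) ^ k)" for k
  proof -
    have "(\<integral>\<^sup>+x. ennreal (norm (u k x - g x) powr r) \<partial>bessel_measure \<alpha>) =
        (\<integral>\<^sup>+x. liminf (\<lambda>l. ennreal (norm (u k x - u l x) powr r)) \<partial>bessel_measure \<alpha>)"
    proof (rule nn_integral_cong_AE, use conv in eventually_elim)
      case (elim x)
      have "(\<lambda>l. ennreal (norm (u k x - u l x) powr r)) \<longlonglongrightarrow> ennreal (norm (u k x - g x) powr r)"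
        using elim r by (intro tendsto_ennrealI tendsto_powr2 tendsto_intros) auto
      then show ?case by (rule lim_imp_Liminf[OF sequentially_bot, symmetric])
    qed
    also have "\<dots> \<le> liminf (\<lambda>l. \<integral>\<^sup>+x. ennreal (norm (u k x - u l x) powr r) \<partial>bessel_measure \<alpha>)"
      by (rule nn_integral_liminf) measurable
    also have "\<dots> \<le> ennreal (((1 / 4) ^ k) powr r)"
    proof (rule Liminf_le)
      show "\<forall>\<^sub>F l in sequentially. (\<integral>\<^sup>+x. ennreal (norm (u k x - u l x) powr r) \<partial>bessel_measure \<alpha>) \<le> ennreal (((1 / 4) ^ k) powr r)"
        using eventually_ge_at_top[of k] by eventually_elim (rule n)
    qed simp
    finally show ?thesis using r by (subst bnorm_le_iff_finite) auto
  qed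
  with g show thesis by (rule that)
qed

text \<open>Truncation to bounded intervals, which have finite measure, gives integrable functions.\<close>

lemma bspace_1_dense:
  assumes a: "\<alpha> \<ge> - 1 / 2" and p: "1 \<le> p" "p \<noteq> top" and f: "f \<in> bspace p \<alpha>" and e: "\<epsilon> > (0::real)"
  obtains \<phi> where "\<phi> \<in> bspace 1 \<alpha>" "\<phi> \<in> bspace p \<alpha>" "bnorm p \<alpha> (\<lambda>x. \<phi> x - f x) \<le> ennreal \<epsilon>"
proof -
  from p obtain r where r: "p = ennreal r" "r \<ge> 1" by (auto elim: exponent_cases)
  note [measurable] = bspace_measurable[OF f]
  have i [measurable]: "(\<lambda>x. indicator {..real n} x :: complex) \<in> borel_measurable (bessel_measure \<alpha>)"
    "(\<lambda>x. indicator {..real n} x :: real) \<in> borel_measurable (bessel_measure \<alpha>)"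
    "(\<lambda>x. indicator {..real n} x :: ennreal) \<in> borel_measurable (bessel_measure \<alpha>)" for n
    using borel_measurable_bessel_measure_if_borel[of "indicator {..real n} :: real \<Rightarrow> complex" \<alpha>]
      borel_measurable_bessel_measure_if_borel[of "indicator {..real n} :: real \<Rightarrow> real" \<alpha>]
      borel_measurable_bessel_measure_if_borel[of "indicator {..real n} :: real \<Rightarrow> ennreal" \<alpha>]
    by auto
  define \<phi> where "\<phi> n x = indicator {..real n} x * f x" for n x
  have m [measurable]: "\<phi> n \<in> borel_measurable (bessel_measure \<alpha>)" for n
    unfolding \<phi>_def by measurable
  obtain B where B: "B \<ge> 0" "bnorm p \<alpha> f = ennreal B" by (rule bspace_bound[OF f])
  have fB: "(\<integral>\<^sup>+x. ennreal (norm (f x) powr r) \<partial>bessel_measure \<alpha>) \<le> ennreal (B powr r)"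
    using B r by (simp flip: bnorm_le_iff_finite)
  have "\<phi> n \<in> bspace 1 \<alpha>" for n
  proof -
    have "(\<integral>\<^sup>+x. ennreal (norm (\<phi> n x) powr 1) \<partial>bessel_measure \<alpha>) \<le>
        (\<integral>\<^sup>+x. indicator {..real n} x + ennreal (norm (f x) powr r) \<partial>bessel_measure \<alpha>)"
    proof (rule nn_integral_mono)
      fix x
      have "norm (f x) \<le> 1 + norm (f x) powr r"
      proof (cases "norm (f x) \<le> 1")
        case False
        then have "norm (f x) powr 1 \<le> norm (f x) powr r" using r by (intro powr_mono) auto
        then show ?thesis using False by simp
      qed (simp add: add_increasing2)
      then have "ennreal (norm (f x)) \<le> 1 + ennreal (norm (f x) powr r)"
        by (metis ennreal_1 ennreal_leI ennreal_plus powr_ge_zero zero_le_one)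
      then show "ennreal (norm (\<phi> n x) powr 1) \<le> indicator {..real n} x + ennreal (norm (f x) powr r)"
        by (simp add: \<phi>_def indicator_def)
    qed
    also have "\<dots> = (\<integral>\<^sup>+x. indicator {..real n} x \<partial>bessel_measure \<alpha>) + (\<integral>\<^sup>+x. ennreal (norm (f x) powr r) \<partial>bessel_measure \<alpha>)"
      by (rule nn_integral_add) measurable
    also have "(\<integral>\<^sup>+x. indicator {..real n} x \<partial>bessel_measure \<alpha>) = ennreal (real n powr (2 * \<alpha> + 2) / (2 * \<alpha> + 2))"
    proof -
      have "(\<integral>\<^sup>+x. indicator {..real n} x \<partial>bessel_measure \<alpha>) = (\<integral>\<^sup>+x. indicator {..real n} x \<partial>radial_measure \<alpha>)"
        by (rule nn_integral_bessel_measure) measurable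
      also have "\<dots> = (\<integral>\<^sup>+x. ennreal (indicator {0<..} x * x powr (2 * \<alpha> + 1)) * indicator {..real n} x \<partial>lborel)"
        by (rule nn_integral_radial_measure) measurable
      also have "\<dots> = (\<integral>\<^sup>+x. ennreal (x powr ((2 * \<alpha> + 2) - 1)) * indicator {0<..real n} x \<partial>lborel)"
        by (intro nn_integral_cong) (auto simp: indicator_def add.commute)
      also have "\<dots> = ennreal (real n powr (2 * \<alpha> + 2) / (2 * \<alpha> + 2))"
        using a by (intro nn_integral_powr_layer) auto
      finally show ?thesis .
    qed
    also have "\<dots> + (\<integral>\<^sup>+x. ennreal (norm (f x) powr r) \<partial>bessel_measure \<alpha>) \<le>
        ennreal (real n powr (2 * \<alpha> + 2) / (2 * \<alpha> + 2)) + ennreal (B powr r)"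
      by (intro add_left_mono fB)
    also have "\<dots> = ennreal ((real n powr (2 * \<alpha> + 2) / (2 * \<alpha> + 2) + B powr r) powr 1)"
      using a by (simp add: ennreal_plus)
    finally have "bnorm (ennreal 1) \<alpha> (\<phi> n) \<le> ennreal (real n powr (2 * \<alpha> + 2) / (2 * \<alpha> + 2) + B powr r)"
      using a by (subst bnorm_le_iff_finite) auto
    then show ?thesis by (intro bspaceI m) auto
  qed
  moreover have "\<phi> n \<in> bspace p \<alpha>" for n
    by (rule bspace_dominated[OF p(1) _ m f, of 1]) (auto simp: \<phi>_def indicator_def)
  moreover have "\<exists>n. bnorm p \<alpha> (\<lambda>x. \<phi> n x - f x) \<le> ennreal \<epsilon>"
  proof -
    have "(\<lambda>n. \<integral>\<^sup>+x. ennreal (norm (\<phi> n x - f x) powr r) \<partial>bessel_measure \<alpha>) \<longlonglongrightarrow> (\<integral>\<^sup>+x. 0 \<partial>bessel_measure \<alpha>)"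
    proof (rule nn_integral_dominated_convergence[where w = "\<lambda>x. ennreal (norm (f x) powr r)"])
      show "(\<integral>\<^sup>+x. ennreal (norm (f x) powr r) \<partial>bessel_measure \<alpha>) < \<infinity>"
        using fB by (rule le_less_trans) simp
      show "AE x in bessel_measure \<alpha>. ennreal (norm (\<phi> n x - f x) powr r) \<le> ennreal (norm (f x) powr r)" for n
        by (auto simp: \<phi>_def indicator_def)
      show "AE x in bessel_measure \<alpha>. (\<lambda>n. ennreal (norm (\<phi> n x - f x) powr r)) \<longlonglongrightarrow> 0"
      proof (rule AE_I2)
        fix x
        obtain N where N: "x \<le> real N" using real_arch_simple by blast
        have "\<forall>\<^sub>F n in sequentially. ennreal (norm (\<phi> n x - f x) powr r) = 0"
          using eventually_ge_at_top[of N] by eventually_elim (use N in \<open>auto simp: \<phi>_def\<close>)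
        then show "(\<lambda>n. ennreal (norm (\<phi> n x - f x) powr r)) \<longlonglongrightarrow> 0"
          by (rule tendsto_eventually)
      qed
    qed measurable
    then have "\<forall>\<^sub>F n in sequentially. (\<integral>\<^sup>+x. ennreal (norm (\<phi> n x - f x) powr r) \<partial>bessel_measure \<alpha>) < ennreal (\<epsilon> powr r)"
      using e by (intro order_tendstoD(2)) auto
    then obtain n where "(\<integral>\<^sup>+x. ennreal (norm (\<phi> n x - f x) powr r) \<partial>bessel_measure \<alpha>) < ennreal (\<epsilon> powr r)"
      by (auto simp: eventually_sequentially)
    then show ?thesis using r e by (intro exI[of _ n]) (simp add: bnorm_le_iff_finite less_imp_le)
  qed
  ultimately show thesis using that by blast
qed

lemma ennreal_two_times_add:
  "a \<ge> 0 \<Longrightarrow> b \<ge> 0 \<Longrightarrow> 2 * (ennreal a + ennreal b) = ennreal (2 * (a + b))"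
  by (simp add: ennreal_mult)

lemma conjugate_exponent_ge_1:
  fixes p p' :: ennreal
  assumes "1 \<le> p" "p \<le> 2" "1 / p + 1 / p' = 1"
  shows "1 \<le> p'"
  using assms
proof (cases rule: conjugate_exponent_cases)
  case (2 r)
  then have "1 \<le> r / (r - 1)" by (simp add: field_simps)
  then show ?thesis using 2 by (metis ennreal_1 ennreal_leI)
qed simp

text \<open>
  For \<open>p > 1\<close> the transform is the limit along a rapidly convergent approximating sequence; for
  \<open>p = 1\<close> it is the integral itself.
\<close>

theorem hankel_transform_exists:
  assumes a: "\<alpha> \<ge> - 1 / 2" and p: "1 \<le> p" "p \<le> 2" "1 / p + 1 / p' = 1" and f: "f \<in> bspace p \<alpha>"
  shows "\<exists>g. is_hankel_transform p p' \<alpha> f g"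
proof -
  note p'1 = conjugate_exponent_ge_1[OF p]
  note fm = bspace_measurable[OF f]
  note Hm = borel_measurable_bessel_measure_if_borel[OF measurable_hankel_integral[OF a]]
  obtain C where C: "C \<ge> 0"
    and hy: "\<And>f. f \<in> bspace 1 \<alpha> \<Longrightarrow> f \<in> bspace p \<alpha> \<Longrightarrow> bnorm p' \<alpha> (hankel_integral \<alpha> f) \<le> ennreal C * bnorm p \<alpha> f"
    using hausdorff_young[OF a p] by blast
  have hyd: "bnorm p' \<alpha> (\<lambda>y. hankel_integral \<alpha> \<phi> y - hankel_integral \<alpha> \<psi> y) \<le> ennreal C * bnorm p \<alpha> (\<lambda>x. \<phi> x - \<psi> x)"
    if "\<phi> \<in> bspace 1 \<alpha>" "\<phi> \<in> bspace p \<alpha>" "\<psi> \<in> bspace 1 \<alpha>" "\<psi> \<in> bspace p \<alpha>" for \<phi> \<psi>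
  proof -
    have "hankel_integral \<alpha> (\<lambda>x. \<phi> x - \<psi> x) = (\<lambda>y. hankel_integral \<alpha> \<phi> y - hankel_integral \<alpha> \<psi> y)"
      by (rule ext) (rule hankel_integral_diff[OF a that(1,3)])
    then show ?thesis
      using hy[of "\<lambda>x. \<phi> x - \<psi> x"] that p(1) bspace_diff[of 1 \<phi> \<alpha> \<psi>] bspace_diff[of p \<phi> \<alpha> \<psi>] by simp
  qed
  from p show ?thesis
  proof (cases rule: conjugate_exponent_cases)
    case 1
    have "is_hankel_transform p p' \<alpha> f (hankel_integral \<alpha> f)"
      unfolding is_hankel_transform_def
    proof (intro conjI allI impI)
      have f1: "f \<in> bspace 1 \<alpha>" using f 1 by simp
      obtain B where B: "B \<ge> 0" "bnorm p \<alpha> f = ennreal B" by (rule bspace_bound[OF f])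
      show "hankel_integral \<alpha> f \<in> bspace p' \<alpha>"
        by (rule bspaceI[OF Hm[OF f] hy[OF f1 f]]) (simp add: B ennreal_mult_less_top)
      fix \<epsilon> :: real assume e: "\<epsilon> > 0"
      show "\<exists>\<delta>>0. \<forall>\<phi>\<in>bspace 1 \<alpha> \<inter> bspace p \<alpha>. bnorm p \<alpha> (\<lambda>x. \<phi> x - f x) < ennreal \<delta> \<longrightarrow>
          bnorm p' \<alpha> (\<lambda>y. hankel_integral \<alpha> \<phi> y - hankel_integral \<alpha> f y) < ennreal \<epsilon>"
      proof (intro exI[of _ "\<epsilon> / (C + 1)"] conjI ballI impI)
        fix \<phi> assume \<phi>: "\<phi> \<in> bspace 1 \<alpha> \<inter> bspace p \<alpha>" and l: "bnorm p \<alpha> (\<lambda>x. \<phi> x - f x) < ennreal (\<epsilon> / (C + 1))"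
        have "bnorm p' \<alpha> (\<lambda>y. hankel_integral \<alpha> \<phi> y - hankel_integral \<alpha> f y) \<le> ennreal C * bnorm p \<alpha> (\<lambda>x. \<phi> x - f x)"
          using \<phi> f f1 by (intro hyd) auto
        also have "\<dots> \<le> ennreal C * ennreal (\<epsilon> / (C + 1))"
          using l by (intro mult_left_mono) auto
        also have "\<dots> = ennreal (C * (\<epsilon> / (C + 1)))" using C e by (subst ennreal_mult[symmetric]) auto
        also have "\<dots> < ennreal \<epsilon>"
          using C e by (intro ennreal_lessI) (auto simp: field_simps)
        finally show "bnorm p' \<alpha> (\<lambda>y. hankel_integral \<alpha> \<phi> y - hankel_integral \<alpha> f y) < ennreal \<epsilon>" .
      qed (use C e in simp)
    qed
    then show ?thesis by blast
  next
    case (2 r)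
    \<comment> \<open>Two approximants within \<open>e k\<close> of \<open>f\<close> have transforms within \<open>C * (4 * e k)\<close> of each other, which is
      at most \<open>(1 / 4) ^ k\<close>.\<close>
    define e where "e k = (1 / 4) ^ k / (C + 1) / 4" for k :: nat
    have e0: "e k > 0" for k using C by (simp add: e_def)
    have eC: "C * (4 * e k) \<le> (1 / 4) ^ k" for k
    proof -
      have "C * (4 * (x / D / 4)) = C / D * x" for x D :: real by simp
      then have "C * (4 * e k) = C / (C + 1) * (1 / 4) ^ k" by (simp only: e_def)
      also have "\<dots> \<le> 1 * (1 / 4) ^ k" using C by (intro mult_right_mono) auto
      finally show ?thesis by simp
    qed
    have e_mono: "e l \<le> e k" if "k \<le> l" for k l
      unfolding e_def using C that by (intro divide_right_mono power_decreasing) auto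
    have "\<exists>\<phi>. \<phi> \<in> bspace 1 \<alpha> \<and> \<phi> \<in> bspace p \<alpha> \<and> bnorm p \<alpha> (\<lambda>x. \<phi> x - f x) \<le> ennreal (e k)" for k
      using bspace_1_dense[OF a p(1) _ f e0[of k]] 2(1) by (metis ennreal_neq_top)
    then obtain \<phi> where \<phi>: "\<And>k. \<phi> k \<in> bspace 1 \<alpha>" "\<And>k. \<phi> k \<in> bspace p \<alpha>"
      "\<And>k. bnorm p \<alpha> (\<lambda>x. \<phi> k x - f x) \<le> ennreal (e k)" by metis
    note \<phi>m = bspace_measurable[OF \<phi>(2)]
    have approx: "bnorm p' \<alpha> (\<lambda>y. hankel_integral \<alpha> \<psi> y - hankel_integral \<alpha> (\<phi> k) y) \<le> ennreal (C * (2 * (d + e k)))"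
      if \<psi>: "\<psi> \<in> bspace 1 \<alpha>" "\<psi> \<in> bspace p \<alpha>" and d: "bnorm p \<alpha> (\<lambda>x. \<psi> x - f x) \<le> ennreal d" "d \<ge> 0" for \<psi> k d
    proof -
      have "bnorm p \<alpha> (\<lambda>x. \<psi> x - \<phi> k x) = bnorm p \<alpha> (\<lambda>x. (\<psi> x - f x) - (\<phi> k x - f x))" by simp
      also have "\<dots> \<le> 2 * (bnorm p \<alpha> (\<lambda>x. \<psi> x - f x) + bnorm p \<alpha> (\<lambda>x. \<phi> k x - f x))"
        using bspace_measurable[OF \<psi>(2)] fm \<phi>m by (intro bnorm_diff_le p) auto
      also have "\<dots> \<le> 2 * (ennreal d + ennreal (e k))"
        using d(1) \<phi>(3)[of k] by (intro mult_left_mono add_mono) auto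
      also have "\<dots> = ennreal (2 * (d + e k))"
        using d e0[of k] by (simp add: ennreal_mult)
      finally have "ennreal C * bnorm p \<alpha> (\<lambda>x. \<psi> x - \<phi> k x) \<le> ennreal C * ennreal (2 * (d + e k))"
        by (rule mult_left_mono) simp
      also have "\<dots> = ennreal (C * (2 * (d + e k)))"
        using C d e0[of k] by (simp only: ennreal_mult'[symmetric])
      finally show ?thesis using hyd[OF \<psi> \<phi>(1)[of k] \<phi>(2)[of k]] by (rule order_trans[rotated])
    qed
    have cauchy: "bnorm (ennreal (r / (r - 1))) \<alpha> (\<lambda>y. hankel_integral \<alpha> (\<phi> k) y - hankel_integral \<alpha> (\<phi> l) y) \<le> ennreal ((1 / 4) ^ k)"
      if "k \<le> l" for k l
    proof -
      have "bnorm p' \<alpha> (\<lambda>y. hankel_integral \<alpha> (\<phi> k) y - hankel_integral \<alpha> (\<phi> l) y) \<le> ennreal (C * (2 * (e k + e l)))"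
        by (rule approx[OF \<phi>(1,2,3)]) (use e0[of k] in simp)
      also have "\<dots> \<le> ennreal ((1 / 4) ^ k)"
      proof (rule ennreal_leI)
        have "C * (2 * (e k + e l)) \<le> C * (4 * e k)" using C e_mono[OF that] by (intro mult_left_mono) auto
        then show "C * (2 * (e k + e l)) \<le> (1 / 4) ^ k" using eC[of k] by linarith
      qed
      finally show ?thesis using 2 by simp
    qed
    have "1 \<le> r / (r - 1)" using 2 by (simp add: field_simps)
    then obtain g where gm: "g \<in> borel_measurable (bessel_measure \<alpha>)"
      and "\<And>k. bnorm (ennreal (r / (r - 1))) \<alpha> (\<lambda>y. hankel_integral \<alpha> (\<phi> k) y - g y) \<le> ennreal ((1 / 4) ^ k)"
      using bnorm_cauchy_limit[of "r / (r - 1)" "\<lambda>k. hankel_integral \<alpha> (\<phi> k)", OF _ Hm[OF \<phi>(2)] cauchy] by blast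
    then have g: "\<And>k. bnorm p' \<alpha> (\<lambda>y. hankel_integral \<alpha> (\<phi> k) y - g y) \<le> ennreal ((1 / 4) ^ k)"
      using 2 by simp
    have "is_hankel_transform p p' \<alpha> f g"
      unfolding is_hankel_transform_def
    proof (intro conjI allI impI)
      have "(\<lambda>y. hankel_integral \<alpha> (\<phi> 0) y - (hankel_integral \<alpha> (\<phi> 0) y - g y)) \<in> bspace p' \<alpha>"
      proof (rule bspace_diff[OF p'1])
        show "hankel_integral \<alpha> (\<phi> 0) \<in> bspace p' \<alpha>"
          using bnorm_finite[OF \<phi>(2)[of 0]]
          by (intro bspaceI[OF Hm[OF \<phi>(2)] hy[OF \<phi>(1,2)]]) (simp add: ennreal_mult_less_top)
        show "(\<lambda>y. hankel_integral \<alpha> (\<phi> 0) y - g y) \<in> bspace p' \<alpha>"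
          by (rule bspaceI[OF borel_measurable_diff[OF Hm[OF \<phi>(2)] gm] g[of 0]]) simp
      qed
      then show "g \<in> bspace p' \<alpha>" by simp
      fix \<epsilon> :: real assume e: "\<epsilon> > 0"
      define \<delta> where "\<delta> = \<epsilon> / (16 * (C + 1))"
      have \<delta>: "\<delta> > 0" using e C by (simp add: \<delta>_def)
      obtain k where k: "(1 / 4 :: real) ^ k < \<epsilon> / 8"
        using real_arch_pow_inv[of "\<epsilon> / 8" "1 / 4"] e by auto
      show "\<exists>\<delta>>0. \<forall>\<psi>\<in>bspace 1 \<alpha> \<inter> bspace p \<alpha>. bnorm p \<alpha> (\<lambda>x. \<psi> x - f x) < ennreal \<delta> \<longrightarrow>
          bnorm p' \<alpha> (\<lambda>y. hankel_integral \<alpha> \<psi> y - g y) < ennreal \<epsilon>"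
      proof (intro exI[of _ \<delta>] conjI ballI impI)
        fix \<psi> assume \<psi>: "\<psi> \<in> bspace 1 \<alpha> \<inter> bspace p \<alpha>" and l: "bnorm p \<alpha> (\<lambda>x. \<psi> x - f x) < ennreal \<delta>"
        have "bnorm p' \<alpha> (\<lambda>y. hankel_integral \<alpha> \<psi> y - g y) =
            bnorm p' \<alpha> (\<lambda>y. (hankel_integral \<alpha> \<psi> y - hankel_integral \<alpha> (\<phi> k) y) + (hankel_integral \<alpha> (\<phi> k) y - g y))"
          by simp
        also have "\<dots> \<le> 2 * (bnorm p' \<alpha> (\<lambda>y. hankel_integral \<alpha> \<psi> y - hankel_integral \<alpha> (\<phi> k) y) +
            bnorm p' \<alpha> (\<lambda>y. hankel_integral \<alpha> (\<phi> k) y - g y))"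
          using \<psi> by (intro bnorm_add_le p'1 borel_measurable_diff Hm[of _ p] gm \<phi>) auto
        also have "\<dots> \<le> 2 * (ennreal (C * (2 * (\<delta> + e k))) + ennreal ((1 / 4) ^ k))"
          using \<psi> l \<delta> by (intro mult_left_mono add_mono g approx) auto
        also have "\<dots> = ennreal (2 * (C * (2 * (\<delta> + e k)) + (1 / 4) ^ k))"
          using C \<delta> e0[of k] by (intro ennreal_two_times_add) auto
        also have "\<dots> < ennreal \<epsilon>"
        proof (rule ennreal_lessI[OF e])
          have "C * \<delta> \<le> \<epsilon> / 16" using C e by (simp add: \<delta>_def field_simps)
          moreover have "2 * (C * (2 * (\<delta> + e k)) + (1 / 4) ^ k) = 4 * (C * \<delta>) + C * (4 * e k) + 2 * (1 / 4) ^ k"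
            by (simp add: algebra_simps)
          ultimately show "2 * (C * (2 * (\<delta> + e k)) + (1 / 4) ^ k) < \<epsilon>"
            using eC[of k] k e by linarith
        qed
        finally show "bnorm p' \<alpha> (\<lambda>y. hankel_integral \<alpha> \<psi> y - g y) < ennreal \<epsilon>" .
      qed (use \<delta> in simp)
    qed
    then show ?thesis by blast
  qed
qed

lemma is_hankel_transform_hankel:
  assumes "\<alpha> \<ge> - 1 / 2" "1 \<le> p" "p \<le> 2" "1 / p + 1 / p' = 1" "f \<in> bspace p \<alpha>"
  shows "is_hankel_transform p p' \<alpha> f (hankel p p' \<alpha> f)"
  unfolding hankel_def using hankel_transform_exists[OF assms] by (rule someI_ex)

text \<open>
  Every property of the extended transform below is obtained from integrable functions that
  approximate the function and its transform at the same time.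
\<close>

lemma hankel_approximation:
  assumes a: "\<alpha> \<ge> - 1 / 2" and p: "1 \<le> p" "p \<noteq> top" and f: "f \<in> bspace p \<alpha>"
    and g: "is_hankel_transform p p' \<alpha> f g" and e: "\<epsilon> > (0::real)"
  obtains \<phi> where "\<phi> \<in> bspace 1 \<alpha>" "\<phi> \<in> bspace p \<alpha>" "bnorm p \<alpha> (\<lambda>x. \<phi> x - f x) \<le> ennreal \<epsilon>"
    "bnorm p' \<alpha> (\<lambda>y. hankel_integral \<alpha> \<phi> y - g y) \<le> ennreal \<epsilon>"
proof -
  obtain \<delta> where \<delta>: "\<delta> > 0" "\<And>\<phi>. \<phi> \<in> bspace 1 \<alpha> \<Longrightarrow> \<phi> \<in> bspace p \<alpha> \<Longrightarrow> bnorm p \<alpha> (\<lambda>x. \<phi> x - f x) < ennreal \<delta> \<Longrightarrow>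
        bnorm p' \<alpha> (\<lambda>y. hankel_integral \<alpha> \<phi> y - g y) < ennreal \<epsilon>"
    using g e unfolding is_hankel_transform_def by blast
  have "min \<epsilon> (\<delta> / 2) > 0" using e \<delta> by simp
  from bspace_1_dense[OF a p f this] obtain \<phi> where \<phi>: "\<phi> \<in> bspace 1 \<alpha>" "\<phi> \<in> bspace p \<alpha>"
    "bnorm p \<alpha> (\<lambda>x. \<phi> x - f x) \<le> ennreal (min \<epsilon> (\<delta> / 2))" .
  have "bnorm p \<alpha> (\<lambda>x. \<phi> x - f x) \<le> ennreal \<epsilon>"
    using \<phi>(3) by (rule order_trans) (simp add: ennreal_leI)
  moreover have "bnorm p \<alpha> (\<lambda>x. \<phi> x - f x) < ennreal \<delta>"
    using \<phi>(3) by (rule le_less_trans) (use \<delta> in \<open>auto intro!: ennreal_lessI\<close>)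
  ultimately show thesis using that[OF \<phi>(1,2)] \<delta>(2)[OF \<phi>(1,2)] by (simp add: less_imp_le)
qed

section \<open>Averages of the Bessel function\<close>

lemma sinc_le:
  fixes u :: real
  assumes "u \<noteq> 0"
  shows "min 1 (u\<^sup>2) / 8 \<le> 1 - sin u / u"
proof -
  have *: "min 1 (u\<^sup>2) / 8 \<le> 1 - sin u / u" if u: "u > 0" for u :: real
  proof (cases "u \<le> 2")
    case True
    have "\<bar>sin u - (\<Sum>m<5. sin_coeff m * u ^ m)\<bar> \<le> inverse (fact 5) * \<bar>u\<bar> ^ 5"
      by (rule Maclaurin_sin_bound)
    also have "(\<Sum>m<5. sin_coeff m * u ^ m) = u - u ^ 3 / 6"
    proof -
      have "{..<5} = {0, 1, 2, 3, 4 :: nat}" by auto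
      then show ?thesis by (simp add: sin_coeff_def fact_numeral)
    qed
    finally have "\<bar>sin u - (u - u ^ 3 / 6)\<bar> \<le> u ^ 5 / 120"
      using u by (simp add: fact_numeral field_simps)
    then have "sin u \<le> u - u ^ 3 / 6 + u ^ 5 / 120" by linarith
    also have "u ^ 5 = u ^ 3 * u\<^sup>2" by (simp flip: power_add)
    also have "u ^ 3 * u\<^sup>2 \<le> u ^ 3 * 4"
      using u True power_mono[of u 2 2] by (intro mult_left_mono) auto
    finally have "sin u \<le> u - u ^ 3 / 8"
      using zero_less_power[OF u, of 3] by linarith
    then have "sin u \<le> (1 - u\<^sup>2 / 8) * u"
      by (simp add: algebra_simps power3_eq_cube power2_eq_square)
    then have "sin u / u \<le> 1 - u\<^sup>2 / 8" using u by (simp add: pos_divide_le_eq)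
    then show ?thesis using min.cobounded2[of 1 "u\<^sup>2"] by linarith
  next
    case False
    then have "sin u / u \<le> 1 / 2"
      using sin_le_one[of u] by (subst pos_divide_le_eq) linarith+
    then show ?thesis using min.cobounded1[of 1 "u\<^sup>2"] by linarith
  qed
  show ?thesis
  proof (cases "u > 0")
    case False
    then have "min 1 ((- u)\<^sup>2) / 8 \<le> 1 - sin (- u) / (- u)" using assms by (intro *) simp
    then show ?thesis by simp
  qed (rule *)
qed

definition unit_interval_measure :: "real measure" where
  "unit_interval_measure = uniform_measure lborel {0..1}"

lemma sets_unit_interval_measure [simp, measurable_cong]: "sets unit_interval_measure = sets borel"
  by (simp add: unit_interval_measure_def)

lemma prob_space_unit_interval_measure: "prob_space unit_interval_measure"
  unfolding unit_interval_measure_def by (rule prob_space_uniform_measure) auto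

lemma AE_unit_interval_measure: "AE \<theta> in unit_interval_measure. \<theta> \<in> {0..1}"
  unfolding unit_interval_measure_def by (rule AE_uniform_measureI) auto

lemma integral_unit_interval_one_minus_cos:
  "min 1 (u\<^sup>2) / 8 \<le> (\<integral>\<theta>. 1 - cos (\<theta> * u) \<partial>unit_interval_measure)"
proof (cases "u = 0")
  case False
  have d: "unit_interval_measure = density lborel (\<lambda>\<theta>. ennreal (indicator {0..1} \<theta>))"
    by (simp add: unit_interval_measure_def uniform_measure_def ennreal_indicator divide_ennreal_def)
  have "(\<integral>\<theta>. 1 - cos (\<theta> * u) \<partial>unit_interval_measure) = (\<integral>\<theta>. indicator {0..1} \<theta> *\<^sub>R (1 - cos (\<theta> * u)) \<partial>lborel)"
    unfolding d by (rule integral_density) auto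
  also have "\<dots> = (1 - sin (1 * u) / u) - (0 - sin (0 * u) / u)"
    by (rule integral_FTC_Icc) (use False in \<open>auto intro!: derivative_eq_intros continuous_intros
        simp flip: has_real_derivative_iff_has_vector_derivative\<close>)
  finally show ?thesis using sinc_le[OF False] by simp
qed simp

text \<open>
  For \<open>\<alpha> = - 1 / 2\<close> the Bessel function is the cosine, which returns to the value \<open>1\<close> arbitrarily far
  out, so that \<open>1 - j\<close> stays away from \<open>0\<close> only after averaging over dilations.
  By Poisson's integral the average is an integral of \<open>1 - sin u / u\<close> at \<open>u = z cos \<phi>\<close>, which for \<open>z \<ge> 1\<close> is
  at least \<open>(cos \<phi>)\<^sup>2 / 8\<close>; the constant is the second moment divided by \<open>8\<close>.
\<close>

lemma average_one_minus_poisson_j: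
  assumes a: "\<alpha> \<ge> - 1 / 2" and z: "z \<ge> 1"
  shows "1 / (16 * (\<alpha> + 1)) \<le> (\<integral>\<theta>. 1 - poisson_j \<alpha> (\<theta> * z) \<partial>unit_interval_measure)"
proof -
  interpret A: prob_space "angle_measure \<alpha>" using a by (rule prob_space_angle_measure)
  interpret U: prob_space unit_interval_measure by (rule prob_space_unit_interval_measure)
  interpret P: pair_prob_space unit_interval_measure "angle_measure \<alpha>" ..
  have ic: "integrable (angle_measure \<alpha>) (\<lambda>\<phi>. cos (x * cos \<phi>))" for x
    by (rule integrable_angle_measure[OF a, where B = 1]) auto
  have i: "integrable (unit_interval_measure \<Otimes>\<^sub>M angle_measure \<alpha>) (\<lambda>(\<theta>, \<phi>). 1 - cos (\<theta> * z * cos \<phi>))"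
  proof (rule P.integrable_const_bound[where B = 2])
    show "AE x in unit_interval_measure \<Otimes>\<^sub>M angle_measure \<alpha>. norm (case x of (\<theta>, \<phi>) \<Rightarrow> 1 - cos (\<theta> * z * cos \<phi>)) \<le> 2"
    proof (rule AE_I2)
      fix x :: "real \<times> real"
      show "norm (case x of (\<theta>, \<phi>) \<Rightarrow> 1 - cos (\<theta> * z * cos \<phi>)) \<le> 2"
        using cos_le_one[of "fst x * z * cos (snd x)"] cos_ge_minus_one[of "fst x * z * cos (snd x)"]
        by (simp add: case_prod_unfold abs_le_iff)
    qed
  qed measurable
  have "1 / (16 * (\<alpha> + 1)) = cos_moment \<alpha> (2 * 1) / 8"
    unfolding cos_moment_even[OF a] by simp
  also have "\<dots> = (\<integral>\<phi>. (cos \<phi>)\<^sup>2 / 8 \<partial>angle_measure \<alpha>)"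
    by (simp add: cos_moment_def)
  also have "\<dots> \<le> (\<integral>\<phi>. (\<integral>\<theta>. 1 - cos (\<theta> * z * cos \<phi>) \<partial>unit_interval_measure) \<partial>angle_measure \<alpha>)"
  proof (rule integral_mono)
    show "integrable (angle_measure \<alpha>) (\<lambda>\<phi>. (cos \<phi>)\<^sup>2 / 8)"
      by (rule integrable_angle_measure[OF a, where B = 1]) (auto simp: abs_square_le_1 intro: order_trans[of _ 1])
    show "integrable (angle_measure \<alpha>) (\<lambda>\<phi>. \<integral>\<theta>. 1 - cos (\<theta> * z * cos \<phi>) \<partial>unit_interval_measure)"
      using P.integrable_snd[OF i] by simp
    fix \<phi>
    have "1 * \<bar>cos \<phi>\<bar> \<le> z * \<bar>cos \<phi>\<bar>" using z by (intro mult_right_mono) auto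
    then have "\<bar>cos \<phi>\<bar>\<^sup>2 \<le> (z * \<bar>cos \<phi>\<bar>)\<^sup>2" by (intro power_mono) auto
    then have "(cos \<phi>)\<^sup>2 \<le> min 1 ((z * cos \<phi>)\<^sup>2)"
      by (simp add: power_mult_distrib abs_square_le_1)
    also have "\<dots> / 8 \<le> (\<integral>\<theta>. 1 - cos (\<theta> * (z * cos \<phi>)) \<partial>unit_interval_measure)"
      by (rule integral_unit_interval_one_minus_cos)
    finally show "(cos \<phi>)\<^sup>2 / 8 \<le> (\<integral>\<theta>. 1 - cos (\<theta> * z * cos \<phi>) \<partial>unit_interval_measure)"
      by (simp add: mult.assoc)
  qed
  also have "\<dots> = (\<integral>\<theta>. (\<integral>\<phi>. 1 - cos (\<theta> * z * cos \<phi>) \<partial>angle_measure \<alpha>) \<partial>unit_interval_measure)"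
    using P.Fubini_integral[OF i] by simp
  also have "\<dots> = (\<integral>\<theta>. 1 - poisson_j \<alpha> (\<theta> * z) \<partial>unit_interval_measure)"
    by (intro Bochner_Integration.integral_cong refl)
      (simp add: poisson_j_def ic measure_angle_measure[OF a])
  finally show ?thesis .
qed

text \<open>
  Minkowski's inequality for averages of a family with a common bound; for finite exponents it is
  Jensen's inequality followed by Fubini's theorem.
\<close>

lemma bnorm_average_le:
  fixes F :: "real \<Rightarrow> real \<Rightarrow> complex"
  assumes P: "prob_space P" "sets P = sets borel" and q: "1 \<le> q" and B: "B \<ge> (0::real)"
    and F [measurable]: "case_prod F \<in> borel_measurable (borel \<Otimes>\<^sub>M borel)"
    and le: "AE \<theta> in P. bnorm q \<alpha> (F \<theta>) \<le> ennreal B"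
  shows "bnorm q \<alpha> (\<lambda>y. \<integral>\<theta>. F \<theta> y \<partial>P) \<le> ennreal B"
proof -
  interpret prob_space P by fact
  interpret R: sigma_finite_measure "radial_measure \<alpha>" by (rule sigma_finite_radial_measure)
  interpret PR: pair_sigma_finite P "radial_measure \<alpha>" ..
  note [measurable_cong] = P(2)
  have Fb [measurable]: "F \<theta> \<in> borel_measurable borel" for \<theta> by measurable
  note fm = borel_measurable_bessel_measure_if_borel
  have m: "(\<lambda>y. \<integral>\<theta>. F \<theta> y \<partial>P) \<in> borel_measurable borel" by measurable
  from q show ?thesis
  proof (cases rule: exponent_cases)
    case 1
    have "AE \<theta> in P. AE y in radial_measure \<alpha>. norm (F \<theta> y) \<le> B"
      by (rule eventually_mono[OF le]) (simp add: 1 B bnorm_le_iff_infinity fm AE_bessel_measure)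
    then have "AE y in radial_measure \<alpha>. AE \<theta> in P. norm (F \<theta> y) \<le> B"
      by (subst (asm) PR.AE_commute) measurable
    then have "AE y in radial_measure \<alpha>. norm (\<integral>\<theta>. F \<theta> y \<partial>P) \<le> B"
    proof eventually_elim
      case (elim y)
      have "integrable P (\<lambda>\<theta>. F \<theta> y)" using elim by (intro integrable_const_bound[of _ B]) auto
      then have "(\<integral>\<theta>. norm (F \<theta> y) \<partial>P) \<le> (\<integral>\<theta>. B \<partial>P)" using elim by (intro integral_mono_AE) auto
      then show ?case by (intro order_trans[OF integral_norm_bound]) (simp add: prob_space)
    qed
    then show ?thesis using B m by (simp add: 1 bnorm_le_iff_infinity fm AE_bessel_measure)
  next
    case (2 r)
    have "(\<integral>\<^sup>+y. ennreal (norm (\<integral>\<theta>. F \<theta> y \<partial>P) powr r) \<partial>bessel_measure \<alpha>) =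
        (\<integral>\<^sup>+y. ennreal (norm (\<integral>\<theta>. F \<theta> y \<partial>P) powr r) \<partial>radial_measure \<alpha>)"
      using m by (intro nn_integral_bessel_measure) measurable
    also have "\<dots> \<le> (\<integral>\<^sup>+y. \<integral>\<^sup>+\<theta>. ennreal (norm (F \<theta> y) powr r) \<partial>P \<partial>radial_measure \<alpha>)"
      using 2 by (intro nn_integral_mono norm_integral_powr_le) auto
    also have "\<dots> = (\<integral>\<^sup>+\<theta>. \<integral>\<^sup>+y. ennreal (norm (F \<theta> y) powr r) \<partial>radial_measure \<alpha> \<partial>P)"
      by (rule PR.Fubini') measurable
    also have "\<dots> \<le> (\<integral>\<^sup>+\<theta>. ennreal (B powr r) \<partial>P)"
    proof (rule nn_integral_mono_AE, use le in eventually_elim)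
      case (elim \<theta>)
      then show ?case
        using 2 B by (simp add: bnorm_le_iff_finite nn_integral_bessel_measure)
    qed
    also have "\<dots> = ennreal (B powr r)" using emeasure_space_1 by simp
    finally show ?thesis using 2 B by (simp add: bnorm_le_iff_finite)
  qed
qed

section \<open>Translations and the transform\<close>

text \<open>
  Linearity needs the integrability in the angle of \<open>f (third_side t s \<phi>)\<close>, which for almost every
  \<open>s\<close> follows from the invariance of the norm.
\<close>

lemma bessel_translation_diff:
  assumes a: "\<alpha> \<ge> - 1 / 2" and t: "t \<ge> 0" and q: "1 \<le> q" and f: "f \<in> bspace q \<alpha>" and g: "g \<in> bspace q \<alpha>"
  shows "AE s in bessel_measure \<alpha>. bessel_translation \<alpha> t (\<lambda>x. f x - g x) s =
    bessel_translation \<alpha> t f s - bessel_translation \<alpha> t g s"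
proof -
  interpret A: prob_space "angle_measure \<alpha>" using a by (rule prob_space_angle_measure)
  have int: "AE s in radial_measure \<alpha>. integrable (angle_measure \<alpha>) (\<lambda>\<phi>. h' (third_side t s \<phi>))"
    if h: "h \<in> bspace q \<alpha>" and h' [measurable]: "h' \<in> borel_measurable borel" and ae: "AE x in radial_measure \<alpha>. h x = h' x" for h h'
  proof -
    obtain B where B: "B \<ge> 0" "bnorm q \<alpha> h = ennreal B" by (rule bspace_bound[OF h])
    have "bnorm q \<alpha> h' = bnorm q \<alpha> h"
      using ae by (intro bnorm_cong q bspace_measurable[OF h] borel_measurable_bessel_measure_if_borel h')
        (auto simp: AE_bessel_measure elim: eventually_mono)
    then have l: "bnorm q \<alpha> h' \<le> ennreal B" using B by simp
    from q show ?thesis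
    proof (cases rule: exponent_cases)
      case 1
      have "AE x in radial_measure \<alpha>. norm (h' x) \<le> B"
        using l B by (simp add: 1 bnorm_le_iff_infinity borel_measurable_bessel_measure_if_borel AE_bessel_measure)
      then have "AE s in radial_measure \<alpha>. AE \<phi> in angle_measure \<alpha>. norm (h' (third_side t s \<phi>)) \<le> B"
        by (rule AE_third_side[OF a t])
      then show ?thesis
        by (rule eventually_mono) (auto intro!: A.integrable_const_bound[of _ B])
    next
      case (2 r)
      have "(\<integral>\<^sup>+s. \<integral>\<^sup>+\<phi>. ennreal (norm (h' (third_side t s \<phi>)) powr r) \<partial>angle_measure \<alpha> \<partial>radial_measure \<alpha>) =
          (\<integral>\<^sup>+s. ennreal (norm (h' s) powr r) \<partial>radial_measure \<alpha>)"
        by (rule nn_integral_translate[OF a t]) measurable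
      also have "\<dots> = (\<integral>\<^sup>+s. ennreal (norm (h' s) powr r) \<partial>bessel_measure \<alpha>)"
        by (rule nn_integral_bessel_measure[symmetric]) measurable
      also have "\<dots> \<le> ennreal (B powr r)" using l B 2 by (simp add: bnorm_le_iff_finite)
      finally have "(\<integral>\<^sup>+s. \<integral>\<^sup>+\<phi>. ennreal (norm (h' (third_side t s \<phi>)) powr r) \<partial>angle_measure \<alpha> \<partial>radial_measure \<alpha>) \<noteq> \<infinity>"
        by (auto simp: top_unique)
      then have "AE s in radial_measure \<alpha>. (\<integral>\<^sup>+\<phi>. ennreal (norm (h' (third_side t s \<phi>)) powr r) \<partial>angle_measure \<alpha>) \<noteq> \<infinity>"
        by (rule nn_integral_noteq_infinite[rotated]) measurable
      then show ?thesis
      proof (rule eventually_mono)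
        fix s assume "(\<integral>\<^sup>+\<phi>. ennreal (norm (h' (third_side t s \<phi>)) powr r) \<partial>angle_measure \<alpha>) \<noteq> \<infinity>"
        then have "integrable (angle_measure \<alpha>) (\<lambda>\<phi>. norm (h' (third_side t s \<phi>)) powr r)"
          by (intro integrableI_bounded) (auto simp: less_top)
        then have "integrable (angle_measure \<alpha>) (\<lambda>\<phi>. 1 + norm (h' (third_side t s \<phi>)) powr r)" by simp
        then show "integrable (angle_measure \<alpha>) (\<lambda>\<phi>. h' (third_side t s \<phi>))"
        proof (rule Bochner_Integration.integrable_bound)
          have "norm z \<le> norm (1 + norm z powr r)" for z :: complex
          proof (cases "norm z \<le> 1")
            case False
            then have "norm z powr 1 \<le> norm z powr r" using 2 by (intro powr_mono) auto
            then show ?thesis using False by simp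
          qed (simp add: add_increasing2)
          then show "AE \<phi> in angle_measure \<alpha>. norm (h' (third_side t s \<phi>)) \<le> norm (1 + norm (h' (third_side t s \<phi>)) powr r)"
            by simp
        qed measurable
      qed
    qed
  qed
  obtain f' where f': "f' \<in> borel_measurable borel" "AE x in radial_measure \<alpha>. f x = f' x"
    using bspace_measurable[OF f] by (rule borel_representative)
  obtain g' where g': "g' \<in> borel_measurable borel" "AE x in radial_measure \<alpha>. g x = g' x"
    using bspace_measurable[OF g] by (rule borel_representative)
  have "AE x in radial_measure \<alpha>. f x - g x = f' x - g' x"
    using f'(2) g'(2) by eventually_elim simp
  note d = bessel_translation_eq_translate[OF a t borel_measurable_diff[OF f'(1) g'(1)] this]
  show ?thesis
    unfolding AE_bessel_measure
    using d bessel_translation_eq_translate[OF a t f'] bessel_translation_eq_translate[OF a t g']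
      int[OF f f'] int[OF g g']
    by eventually_elim (simp add: translate_def)
qed

lemma bessel_translation_0:
  assumes a: "\<alpha> \<ge> - 1 / 2" and f: "f \<in> borel_measurable (bessel_measure \<alpha>)"
  shows "AE s in bessel_measure \<alpha>. bessel_translation \<alpha> 0 f s = f s"
proof -
  obtain f' where f': "f' \<in> borel_measurable borel" "AE x in radial_measure \<alpha>. f x = f' x"
    using f by (rule borel_representative)
  show ?thesis
    unfolding AE_bessel_measure
    using bessel_translation_eq_translate[OF a order_refl f'] f'(2) AE_radial_measure_pos
    by eventually_elim (simp add: translate_def measure_angle_measure[OF a])
qed

lemma bspace_bessel_translation:
  assumes "\<alpha> \<ge> - 1 / 2" "t \<ge> 0" "1 \<le> q" and f: "f \<in> bspace q \<alpha>"
  shows "bessel_translation \<alpha> t f \<in> bspace q \<alpha>"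
  using bnorm_finite[OF f] bspace_measurable[OF f] assms
  by (intro bspaceI[OF _ bnorm_bessel_translation_le] measurable_bessel_translation) auto

lemma measurable_poisson_j_dilate:
  assumes "\<alpha> \<ge> - 1 / 2"
  shows "(\<lambda>x. complex_of_real (poisson_j \<alpha> (x * t))) \<in> borel_measurable (bessel_measure \<alpha>)"
proof -
  note [measurable] = borel_measurable_poisson_j[OF assms]
  show ?thesis by (rule borel_measurable_bessel_measure_if_borel) measurable
qed

lemma bspace_poisson_j_mult:
  assumes a: "\<alpha> \<ge> - 1 / 2" and q: "1 \<le> q" and f: "f \<in> bspace q \<alpha>"
  shows "(\<lambda>x. of_real (poisson_j \<alpha> (x * t)) * f x) \<in> bspace q \<alpha>"
  by (rule bspace_dominated[OF q _ _ f, of 1])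
    (auto intro!: borel_measurable_times measurable_poisson_j_dilate[OF a] bspace_measurable[OF f]
      mult_left_le_one_le simp: norm_mult abs_poisson_j_le_1[OF a])

text \<open>
  An identity between operators that the transform intertwines needs to be checked only on the
  functions whose transform is given by the integral; by density it becomes this norm inequality.
\<close>

lemma hankel_intertwining_bound:
  assumes a: "\<alpha> \<ge> - 1 / 2" and p: "1 \<le> p" "p \<noteq> top" "1 \<le> p'" and C: "C \<ge> 0" and c: "c \<ge> 0"
    and hy: "\<And>f. f \<in> bspace 1 \<alpha> \<Longrightarrow> f \<in> bspace p \<alpha> \<Longrightarrow> bnorm p' \<alpha> (hankel_integral \<alpha> f) \<le> ennreal C * bnorm p \<alpha> f"
    and f: "f \<in> bspace p \<alpha>" and g: "is_hankel_transform p p' \<alpha> f g"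
    and R1: "\<And>\<phi>. \<phi> \<in> bspace 1 \<alpha> \<Longrightarrow> R \<phi> \<in> bspace 1 \<alpha>"
    and Rp: "\<And>\<phi>. \<phi> \<in> bspace p \<alpha> \<Longrightarrow> R \<phi> \<in> bspace p \<alpha>"
    and Rc: "\<And>\<phi>. \<phi> \<in> bspace p \<alpha> \<Longrightarrow> bnorm p \<alpha> (R \<phi>) \<le> ennreal c * bnorm p \<alpha> \<phi>"
    and Rd: "\<And>\<phi> \<psi>. \<phi> \<in> bspace p \<alpha> \<Longrightarrow> \<psi> \<in> bspace p \<alpha> \<Longrightarrow>
      AE x in bessel_measure \<alpha>. R (\<lambda>x. \<phi> x - \<psi> x) x = R \<phi> x - R \<psi> x"
    and Sp: "\<And>\<phi>. \<phi> \<in> bspace p' \<alpha> \<Longrightarrow> S \<phi> \<in> bspace p' \<alpha>"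
    and Sc: "\<And>\<phi>. \<phi> \<in> bspace p' \<alpha> \<Longrightarrow> bnorm p' \<alpha> (S \<phi>) \<le> ennreal c * bnorm p' \<alpha> \<phi>"
    and Sd: "\<And>\<phi> \<psi>. \<phi> \<in> bspace p' \<alpha> \<Longrightarrow> \<psi> \<in> bspace p' \<alpha> \<Longrightarrow>
      AE x in bessel_measure \<alpha>. S (\<lambda>x. \<phi> x - \<psi> x) x = S \<phi> x - S \<psi> x"
    and SR: "\<And>\<phi>. \<phi> \<in> bspace 1 \<alpha> \<Longrightarrow> AE y in bessel_measure \<alpha>. S (hankel_integral \<alpha> \<phi>) y = hankel_integral \<alpha> (R \<phi>) y"
  shows "bnorm p' \<alpha> (S g) \<le> ennreal (4 * C) * bnorm p \<alpha> (R f)"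
proof (rule ennreal_le_epsilon)
  fix e :: real assume e: "e > 0"
  define \<eta> where "\<eta> = e / ((4 * C + 2) * (c + 1))"
  have \<eta>: "\<eta> > 0" using e C c by (simp add: \<eta>_def)
  let ?X = "bnorm p \<alpha> (R f)"
  obtain \<phi> where \<phi>: "\<phi> \<in> bspace 1 \<alpha>" "\<phi> \<in> bspace p \<alpha>" "bnorm p \<alpha> (\<lambda>x. \<phi> x - f x) \<le> ennreal \<eta>"
    "bnorm p' \<alpha> (\<lambda>y. hankel_integral \<alpha> \<phi> y - g y) \<le> ennreal \<eta>"
    by (rule hankel_approximation[OF a p(1,2) f g \<eta>])
  have gs: "g \<in> bspace p' \<alpha>" using g by (simp add: is_hankel_transform_def)
  note Hm = borel_measurable_bessel_measure_if_borel[OF measurable_hankel_integral[OF a]]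
  have ws: "hankel_integral \<alpha> \<phi> \<in> bspace p' \<alpha>"
    using bnorm_finite[OF \<phi>(2)] by (intro bspaceI[OF Hm[OF \<phi>(1)] hy[OF \<phi>(1,2)]]) (simp add: ennreal_mult_less_top)
  have wg: "(\<lambda>y. hankel_integral \<alpha> \<phi> y - g y) \<in> bspace p' \<alpha>" by (rule bspace_diff[OF p(3) ws gs])
  have d: "(\<lambda>x. \<phi> x - f x) \<in> bspace p \<alpha>" by (rule bspace_diff[OF p(1) \<phi>(2) f])
  note m = bspace_measurable
  have small: "ennreal c * x \<le> ennreal (c * \<eta>)" if "x \<le> ennreal \<eta>" for x
    using mult_left_mono[OF that, of "ennreal c"] c \<eta> by (simp add: ennreal_mult)
  have "bnorm p' \<alpha> (S g) = bnorm p' \<alpha> (\<lambda>y. hankel_integral \<alpha> (R \<phi>) y - S (\<lambda>y. hankel_integral \<alpha> \<phi> y - g y) y)"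
    using Sd[OF ws gs] SR[OF \<phi>(1)]
    by (intro bnorm_cong p borel_measurable_diff m[OF Sp[OF gs]] m[OF Sp[OF wg]] Hm[OF R1[OF \<phi>(1)]]) (auto elim: eventually_elim2)
  also have "\<dots> \<le> 2 * (bnorm p' \<alpha> (hankel_integral \<alpha> (R \<phi>)) + bnorm p' \<alpha> (S (\<lambda>y. hankel_integral \<alpha> \<phi> y - g y)))"
    by (intro bnorm_diff_le p m[OF Sp[OF wg]] Hm[OF R1[OF \<phi>(1)]])
  also have "\<dots> \<le> 2 * (ennreal C * bnorm p \<alpha> (R \<phi>) + ennreal (c * \<eta>))"
    using order_trans[OF Sc[OF wg] small[OF \<phi>(4)]] by (intro mult_left_mono add_mono hy R1 Rp \<phi>) auto
  also have "bnorm p \<alpha> (R \<phi>) = bnorm p \<alpha> (\<lambda>x. R f x + R (\<lambda>x. \<phi> x - f x) x)"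
    using Rd[OF \<phi>(2) f]
    by (intro bnorm_cong p borel_measurable_add m[OF Rp[OF f]] m[OF Rp[OF d]] m[OF Rp[OF \<phi>(2)]]) (auto elim: eventually_mono)
  also have "\<dots> \<le> 2 * (?X + bnorm p \<alpha> (R (\<lambda>x. \<phi> x - f x)))"
    by (intro bnorm_add_le p m[OF Rp[OF f]] m[OF Rp[OF d]])
  also have "bnorm p \<alpha> (R (\<lambda>x. \<phi> x - f x)) \<le> ennreal (c * \<eta>)"
    by (rule order_trans[OF Rc[OF d] small[OF \<phi>(3)]])
  also have "2 * (ennreal C * (2 * (?X + ennreal (c * \<eta>))) + ennreal (c * \<eta>)) = ennreal (4 * C) * ?X + ennreal ((4 * C + 2) * (c * \<eta>))"
  proof -
    have "ennreal (4 * C) = 4 * ennreal C"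
      "ennreal ((4 * C + 2) * (c * \<eta>)) = 4 * (ennreal C * ennreal (c * \<eta>)) + 2 * ennreal (c * \<eta>)"
      using C c \<eta> by (simp_all add: distrib_right mult.assoc ennreal_mult ennreal_plus)
    then show ?thesis by (simp add: distrib_left mult_ac)
  qed
  also have "\<dots> \<le> ennreal (4 * C) * ?X + ennreal e"
  proof (intro add_left_mono ennreal_leI)
    have "(4 * C + 2) * (c * \<eta>) \<le> (4 * C + 2) * ((c + 1) * \<eta>)"
      using C \<eta> by (intro mult_left_mono mult_right_mono) auto
    also have "\<dots> = e" using C c by (simp add: \<eta>_def)
    finally show "(4 * C + 2) * (c * \<eta>) \<le> e" .
  qed
  finally show "bnorm p' \<alpha> (S g) \<le> ennreal (4 * C) * ?X + ennreal e"
    by (simp add: add_left_mono mult_left_mono)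
qed

text \<open>The two instances from which the theorem follows.\<close>

lemma bnorm_translation_difference_of_hankel:
  assumes a: "\<alpha> \<ge> - 1 / 2" and p: "1 \<le> p" "p \<noteq> top" "1 \<le> p'" and C: "C \<ge> 0"
    and hy: "\<And>f. f \<in> bspace 1 \<alpha> \<Longrightarrow> f \<in> bspace p \<alpha> \<Longrightarrow> bnorm p' \<alpha> (hankel_integral \<alpha> f) \<le> ennreal C * bnorm p \<alpha> f"
    and f: "f \<in> bspace p \<alpha>" and g: "is_hankel_transform p p' \<alpha> f g"
    and t: "t \<ge> 0" and u: "u \<ge> 0"
  shows "bnorm p' \<alpha> (\<lambda>s. bessel_translation \<alpha> u g s - bessel_translation \<alpha> t g s) \<le>
    ennreal (4 * C) * bnorm p \<alpha> (\<lambda>x. of_real (poisson_j \<alpha> (x * u) - poisson_j \<alpha> (x * t)) * f x)"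
  \<comment> \<open>A difference of two contractions is bounded by \<open>2 * (1 + 1)\<close> in these norms, the multiplier by \<open>2\<close>.\<close>
proof (rule hankel_intertwining_bound[OF a p C _ hy f g, where c = 4])
  fix \<phi> :: "real \<Rightarrow> complex"
  let ?J = "\<lambda>x. complex_of_real (poisson_j \<alpha> (x * u) - poisson_j \<alpha> (x * t))"
  have Jm: "?J \<in> borel_measurable (bessel_measure \<alpha>)"
    using borel_measurable_diff[OF measurable_poisson_j_dilate[OF a] measurable_poisson_j_dilate[OF a]] by simp
  have J: "norm (?J x * \<phi> x) \<le> 4 * norm (\<phi> x)" for x
  proof -
    have "norm (?J x) \<le> 4"
      using abs_poisson_j_le_1[OF a, of "x * u"] abs_poisson_j_le_1[OF a, of "x * t"]
      unfolding norm_of_real by linarith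
    then show ?thesis unfolding norm_mult by (rule mult_right_mono) simp
  qed
  show "(\<lambda>x. ?J x * \<phi> x) \<in> bspace 1 \<alpha>" if "\<phi> \<in> bspace 1 \<alpha>"
    using J by (intro bspace_dominated[OF _ _ _ that, of 4] borel_measurable_times Jm bspace_measurable[OF that]) auto
  show "(\<lambda>x. ?J x * \<phi> x) \<in> bspace p \<alpha>" if "\<phi> \<in> bspace p \<alpha>"
    using J by (intro bspace_dominated[OF p(1) _ _ that, of 4] borel_measurable_times Jm bspace_measurable[OF that]) auto
  show "bnorm p \<alpha> (\<lambda>x. ?J x * \<phi> x) \<le> ennreal 4 * bnorm p \<alpha> \<phi>" if "\<phi> \<in> bspace p \<alpha>"
    using J by (intro bnorm_le_cmult p borel_measurable_times Jm bspace_measurable[OF that]) auto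
  note T = bspace_bessel_translation[OF a _ p(3)] and Tm = measurable_bessel_translation[OF a _ bspace_measurable]
  show "(\<lambda>s. bessel_translation \<alpha> u \<phi> s - bessel_translation \<alpha> t \<phi> s) \<in> bspace p' \<alpha>" if "\<phi> \<in> bspace p' \<alpha>"
    by (intro bspace_diff p T t u that)
  show "bnorm p' \<alpha> (\<lambda>s. bessel_translation \<alpha> u \<phi> s - bessel_translation \<alpha> t \<phi> s) \<le> ennreal 4 * bnorm p' \<alpha> \<phi>"
    if h: "\<phi> \<in> bspace p' \<alpha>"
  proof -
    have "bnorm p' \<alpha> (\<lambda>s. bessel_translation \<alpha> u \<phi> s - bessel_translation \<alpha> t \<phi> s) \<le>
        2 * (bnorm p' \<alpha> (bessel_translation \<alpha> u \<phi>) + bnorm p' \<alpha> (bessel_translation \<alpha> t \<phi>))"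
      by (intro bnorm_diff_le p Tm[OF _ h] t u)
    also have "\<dots> \<le> 2 * (bnorm p' \<alpha> \<phi> + bnorm p' \<alpha> \<phi>)"
      by (intro mult_left_mono add_mono bnorm_bessel_translation_le[OF a] p t u bspace_measurable[OF h]) auto
    finally show ?thesis by (simp add: mult.assoc[symmetric] flip: mult_2)
  qed
  show "AE y in bessel_measure \<alpha>. bessel_translation \<alpha> u (hankel_integral \<alpha> \<phi>) y - bessel_translation \<alpha> t (hankel_integral \<alpha> \<phi>) y =
      hankel_integral \<alpha> (\<lambda>x. ?J x * \<phi> x) y" if \<phi>: "\<phi> \<in> bspace 1 \<alpha>"
  proof -
    obtain \<phi>' where \<phi>': "\<phi>' \<in> borel_measurable borel" "AE x in radial_measure \<alpha>. \<phi> x = \<phi>' x"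
      using bspace_measurable[OF \<phi>] by (rule borel_representative)
    note i = integrable_borel_representative(1)[OF \<phi> \<phi>']
    note [measurable] = borel_measurable_poisson_j[OF a] \<phi>'(1)
    have w: "hankel_integral \<alpha> \<phi> = radial_hankel \<alpha> \<phi>'" by (rule hankel_integral_eq_radial_hankel[OF a \<phi>'])
    have T: "AE s in radial_measure \<alpha>. bessel_translation \<alpha> v (hankel_integral \<alpha> \<phi>) s =
        hankel_integral \<alpha> (\<lambda>x. of_real (poisson_j \<alpha> (x * v)) * \<phi> x) s" if v: "v \<ge> 0" for v
    proof -
      have m: "(\<lambda>x. complex_of_real (poisson_j \<alpha> (x * v)) * \<phi>' x) \<in> borel_measurable borel" by measurable
      have "AE x in radial_measure \<alpha>. of_real (poisson_j \<alpha> (x * v)) * \<phi> x = of_real (poisson_j \<alpha> (x * v)) * \<phi>' x"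
        using \<phi>'(2) by eventually_elim simp
      note h = hankel_integral_eq_radial_hankel[OF a m this]
      have "AE s in radial_measure \<alpha>. bessel_translation \<alpha> v (radial_hankel \<alpha> \<phi>') s = translate \<alpha> v (radial_hankel \<alpha> \<phi>') s"
        by (rule bessel_translation_eq_translate[OF a v borel_measurable_radial_hankel[OF a \<phi>'(1)]]) simp
      then show ?thesis by (simp add: w h translate_radial_hankel[OF a i])
    qed
    have "(\<lambda>x. ?J x * \<phi> x) = (\<lambda>x. of_real (poisson_j \<alpha> (x * u)) * \<phi> x - of_real (poisson_j \<alpha> (x * t)) * \<phi> x)"
      by (auto simp: left_diff_distrib)
    then have "hankel_integral \<alpha> (\<lambda>x. ?J x * \<phi> x) s = hankel_integral \<alpha> (\<lambda>x. of_real (poisson_j \<alpha> (x * u)) * \<phi> x) s -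
        hankel_integral \<alpha> (\<lambda>x. of_real (poisson_j \<alpha> (x * t)) * \<phi> x) s" for s
      using bspace_poisson_j_mult[OF a order_refl \<phi>] by (simp only: hankel_integral_diff[OF a])
    then show ?thesis using T[OF u] T[OF t] unfolding AE_bessel_measure by (auto elim: eventually_elim2)
  qed
  fix \<psi> assume h: "\<phi> \<in> bspace p' \<alpha>" "\<psi> \<in> bspace p' \<alpha>"
  show "AE s in bessel_measure \<alpha>. bessel_translation \<alpha> u (\<lambda>x. \<phi> x - \<psi> x) s - bessel_translation \<alpha> t (\<lambda>x. \<phi> x - \<psi> x) s =
      bessel_translation \<alpha> u \<phi> s - bessel_translation \<alpha> t \<phi> s - (bessel_translation \<alpha> u \<psi> s - bessel_translation \<alpha> t \<psi> s)"
    using bessel_translation_diff[OF a t p(3) h] bessel_translation_diff[OF a u p(3) h] by eventually_elim simp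
qed (auto simp: algebra_simps)

lemma bnorm_hankel_multiplier:
  assumes a: "\<alpha> \<ge> - 1 / 2" and p: "1 \<le> p" "p \<noteq> top" "1 \<le> p'" and C: "C \<ge> 0"
    and hy: "\<And>f. f \<in> bspace 1 \<alpha> \<Longrightarrow> f \<in> bspace p \<alpha> \<Longrightarrow> bnorm p' \<alpha> (hankel_integral \<alpha> f) \<le> ennreal C * bnorm p \<alpha> f"
    and f: "f \<in> bspace p \<alpha>" and g: "is_hankel_transform p p' \<alpha> f g" and h: "h \<ge> 0"
  shows "bnorm p' \<alpha> (\<lambda>y. of_real (1 - poisson_j \<alpha> (h * y)) * g y) \<le>
    ennreal (4 * C) * bnorm p \<alpha> (\<lambda>s. f s - bessel_translation \<alpha> h f s)"
proof (rule hankel_intertwining_bound[OF a p C _ hy f g, where c = 4])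
  fix \<phi> :: "real \<Rightarrow> complex"
  let ?T = "bessel_translation \<alpha> h"
  let ?J = "\<lambda>y. complex_of_real (1 - poisson_j \<alpha> (h * y))"
  have Jm: "?J \<in> borel_measurable (bessel_measure \<alpha>)"
    using borel_measurable_diff[OF borel_measurable_const[of 1] measurable_poisson_j_dilate[OF a, of h]]
    by (simp add: mult.commute)
  have J: "norm (?J y * \<phi> y) \<le> 4 * norm (\<phi> y)" for y
  proof -
    have "norm (?J y) \<le> 4"
      using abs_poisson_j_le_1[OF a, of "h * y"] unfolding norm_of_real by linarith
    then show ?thesis unfolding norm_mult by (rule mult_right_mono) simp
  qed
  note T = bspace_bessel_translation[OF a h]
  show "(\<lambda>s. \<phi> s - ?T \<phi> s) \<in> bspace 1 \<alpha>" if "\<phi> \<in> bspace 1 \<alpha>"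
    by (intro bspace_diff T that) auto
  show "(\<lambda>s. \<phi> s - ?T \<phi> s) \<in> bspace p \<alpha>" if "\<phi> \<in> bspace p \<alpha>"
    by (intro bspace_diff T that p)
  show "bnorm p \<alpha> (\<lambda>s. \<phi> s - ?T \<phi> s) \<le> ennreal 4 * bnorm p \<alpha> \<phi>" if "\<phi> \<in> bspace p \<alpha>"
  proof -
    note m = bspace_measurable[OF that]
    have "bnorm p \<alpha> (\<lambda>s. \<phi> s - ?T \<phi> s) \<le> 2 * (bnorm p \<alpha> \<phi> + bnorm p \<alpha> (?T \<phi>))"
      by (intro bnorm_diff_le p m measurable_bessel_translation[OF a h])
    also have "\<dots> \<le> 2 * (bnorm p \<alpha> \<phi> + bnorm p \<alpha> \<phi>)"
      by (intro mult_left_mono add_mono bnorm_bessel_translation_le[OF a h] p m) auto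
    finally show ?thesis by (simp add: mult.assoc[symmetric] flip: mult_2)
  qed
  show "(\<lambda>y. ?J y * \<phi> y) \<in> bspace p' \<alpha>" if "\<phi> \<in> bspace p' \<alpha>"
    using J by (intro bspace_dominated[OF p(3) _ _ that, of 4] borel_measurable_times Jm bspace_measurable[OF that]) auto
  show "bnorm p' \<alpha> (\<lambda>y. ?J y * \<phi> y) \<le> ennreal 4 * bnorm p' \<alpha> \<phi>" if "\<phi> \<in> bspace p' \<alpha>"
    using J by (intro bnorm_le_cmult p borel_measurable_times Jm bspace_measurable[OF that]) auto
  show "AE y in bessel_measure \<alpha>. ?J y * hankel_integral \<alpha> \<phi> y = hankel_integral \<alpha> (\<lambda>s. \<phi> s - ?T \<phi> s) y"
    if \<phi>: "\<phi> \<in> bspace 1 \<alpha>"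
  proof -
    obtain \<phi>' where \<phi>': "\<phi>' \<in> borel_measurable borel" "AE x in radial_measure \<alpha>. \<phi> x = \<phi>' x"
      using bspace_measurable[OF \<phi>] by (rule borel_representative)
    note i = integrable_borel_representative(1)[OF \<phi> \<phi>']
    have "hankel_integral \<alpha> (?T \<phi>) = radial_hankel \<alpha> (translate \<alpha> h \<phi>')"
      by (rule hankel_integral_eq_radial_hankel[OF a borel_measurable_translate[OF a \<phi>'(1)] bessel_translation_eq_translate[OF a h \<phi>']])
    then show ?thesis
      using AE_radial_measure_pos[of \<alpha>] hankel_integral_eq_radial_hankel[OF a \<phi>'] T[OF order_refl \<phi>]
      by (auto elim!: eventually_mono
          simp: AE_bessel_measure hankel_integral_diff[OF a \<phi>] radial_hankel_translate[OF a h _ i] left_diff_distrib)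
  qed
  fix \<psi> assume "\<phi> \<in> bspace p \<alpha>" "\<psi> \<in> bspace p \<alpha>"
  from bessel_translation_diff[OF a h p(1) this]
  show "AE s in bessel_measure \<alpha>. \<phi> s - \<psi> s - ?T (\<lambda>x. \<phi> x - \<psi> x) s = \<phi> s - ?T \<phi> s - (\<psi> s - ?T \<psi> s)"
    by eventually_elim simp
qed (auto simp: algebra_simps)

text \<open>
  Averaging the hypothesis over \<open>h = \<delta> \<theta>\<close> with \<open>\<theta>\<close> uniform in the unit interval multiplies \<open>g\<close> by a
  factor which beyond \<open>1 / \<delta>\<close> is at least \<open>1 / (16 * (\<alpha> + 1))\<close>.
\<close>

lemma bnorm_tail_le:
  assumes a: "\<alpha> \<ge> - 1 / 2" and q: "1 \<le> q" and B: "B \<ge> (0::real)" and g: "g \<in> borel_measurable (bessel_measure \<alpha>)"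
    and \<delta>: "\<delta> > 0" and le: "\<And>h. h \<in> {0..\<delta>} \<Longrightarrow> bnorm q \<alpha> (\<lambda>y. of_real (1 - poisson_j \<alpha> (h * y)) * g y) \<le> ennreal B"
  shows "bnorm q \<alpha> (\<lambda>y. indicator {1 / \<delta>..} y * g y) \<le> ennreal (16 * (\<alpha> + 1) * B)"
proof -
  note [measurable] = borel_measurable_poisson_j[OF a]
  interpret U: prob_space unit_interval_measure by (rule prob_space_unit_interval_measure)
  obtain g' where g' [measurable]: "g' \<in> borel_measurable borel" and ae: "AE x in radial_measure \<alpha>. g x = g' x"
    using g by (rule borel_representative)
  note bm = borel_measurable_bessel_measure_if_borel
  define F where "F \<theta> y = of_real (1 - poisson_j \<alpha> (\<delta> * \<theta> * y)) * g' y" for \<theta> y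
  define m where "m z = (\<integral>\<theta>. 1 - poisson_j \<alpha> (\<theta> * z) \<partial>unit_interval_measure)" for z
  have F: "case_prod F \<in> borel_measurable (borel \<Otimes>\<^sub>M borel)" unfolding F_def by measurable
  have F1: "F \<theta> \<in> borel_measurable (bessel_measure \<alpha>)" for \<theta> unfolding F_def by (intro bm) measurable
  have FI: "(\<integral>\<theta>. F \<theta> y \<partial>unit_interval_measure) = of_real (m (\<delta> * y)) * g' y" for y
  proof -
    have "(\<integral>\<theta>. F \<theta> y \<partial>unit_interval_measure) = (\<integral>\<theta>. complex_of_real (1 - poisson_j \<alpha> (\<theta> * (\<delta> * y))) \<partial>unit_interval_measure) * g' y"
      unfolding F_def by (subst integral_mult_left_zero[symmetric]) (simp add: mult_ac)
    then show ?thesis unfolding m_def integral_complex_of_real .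
  qed
  have mm: "(\<lambda>y. complex_of_real (m (\<delta> * y)) * g' y) \<in> borel_measurable borel"
    unfolding m_def by measurable
  have "bnorm q \<alpha> (\<lambda>y. \<integral>\<theta>. F \<theta> y \<partial>unit_interval_measure) \<le> ennreal B"
  proof (rule bnorm_average_le[OF prob_space_unit_interval_measure _ q B F])
    show "AE \<theta> in unit_interval_measure. bnorm q \<alpha> (F \<theta>) \<le> ennreal B"
    proof (rule eventually_mono[OF AE_unit_interval_measure])
      fix \<theta> :: real assume \<theta>: "\<theta> \<in> {0..1}"
      have J: "(\<lambda>y. complex_of_real (1 - poisson_j \<alpha> (\<delta> * \<theta> * y))) \<in> borel_measurable (bessel_measure \<alpha>)"
        by (intro bm) measurable
      have "bnorm q \<alpha> (F \<theta>) = bnorm q \<alpha> (\<lambda>y. of_real (1 - poisson_j \<alpha> (\<delta> * \<theta> * y)) * g y)"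
        using ae by (intro bnorm_cong q F1 borel_measurable_times J g) (auto simp: AE_bessel_measure F_def elim: eventually_mono)
      also have "\<dots> \<le> ennreal B" using \<theta> \<delta> by (intro le) (auto simp: mult_left_le)
      finally show "bnorm q \<alpha> (F \<theta>) \<le> ennreal B" .
    qed
  qed simp
  then have b: "bnorm q \<alpha> (\<lambda>y. of_real (m (\<delta> * y)) * g' y) \<le> ennreal B" by (simp add: FI)
  have i: "(\<lambda>y. indicator {1 / \<delta>..} y * g y) \<in> borel_measurable (bessel_measure \<alpha>)"
    by (intro borel_measurable_times bm g) measurable
  have "bnorm q \<alpha> (\<lambda>y. indicator {1 / \<delta>..} y * g y) \<le>
      ennreal (16 * (\<alpha> + 1)) * bnorm q \<alpha> (\<lambda>y. of_real (m (\<delta> * y)) * g' y)"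
  proof (rule bnorm_le_cmult[OF q _ i bm[OF mm]])
    show "0 \<le> 16 * (\<alpha> + 1)" using a by simp
    show "AE y in bessel_measure \<alpha>. norm (indicator {1 / \<delta>..} y * g y) \<le> 16 * (\<alpha> + 1) * norm (of_real (m (\<delta> * y)) * g' y)"
      unfolding AE_bessel_measure using ae
    proof eventually_elim
      case (elim y)
      show ?case
      proof (cases "y \<in> {1 / \<delta>..}")
        case True
        then have "\<delta> * y \<ge> 1" using \<delta> by (simp add: field_simps)
        then have "1 / (16 * (\<alpha> + 1)) \<le> m (\<delta> * y)" unfolding m_def by (rule average_one_minus_poisson_j[OF a])
        then have "1 \<le> 16 * (\<alpha> + 1) * m (\<delta> * y)" using a by (simp add: field_simps)
        also have "\<dots> \<le> 16 * (\<alpha> + 1) * \<bar>m (\<delta> * y)\<bar>" using a by (intro mult_left_mono) auto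
        finally have "1 * norm (g' y) \<le> (16 * (\<alpha> + 1) * \<bar>m (\<delta> * y)\<bar>) * norm (g' y)"
          by (rule mult_right_mono) simp
        then show ?thesis using True elim by (simp add: norm_mult mult.assoc)
      qed (use a in \<open>simp add: indicator_def\<close>)
    qed
  qed
  also have "\<dots> \<le> ennreal (16 * (\<alpha> + 1)) * ennreal B" using b by (rule mult_left_mono) simp
  also have "\<dots> = ennreal (16 * (\<alpha> + 1) * B)" using a B by (intro ennreal_mult[symmetric]) auto
  finally show ?thesis .
qed

section \<open>Compactness conditions and the transform\<close>

lemma P_A_imp_P_B_hankel:
  assumes a: "\<alpha> \<ge> - 1 / 2" and p: "1 \<le> p" "p \<le> 2" "1 / p + 1 / p' = 1" and K: "K \<subseteq> bspace p \<alpha>"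
    and bd: "bbounded p \<alpha> K" and PA: "P_A p \<alpha> K"
  shows "P_B p' \<alpha> (hankel p p' \<alpha> ` K)"
  unfolding P_B_def
proof (intro allI impI)
  fix \<epsilon> M0 :: real assume e: "\<epsilon> > 0" and "M0 > 0"
  note p'1 = conjugate_exponent_ge_1[OF p]
  have pt: "p \<noteq> top" using p(2) by (auto simp: top_unique)
  obtain C where C: "C \<ge> 0"
    and hy: "\<And>f. f \<in> bspace 1 \<alpha> \<Longrightarrow> f \<in> bspace p \<alpha> \<Longrightarrow> bnorm p' \<alpha> (hankel_integral \<alpha> f) \<le> ennreal C * bnorm p \<alpha> f"
    using hausdorff_young[OF a p] by blast
  obtain B0 where "\<forall>f\<in>K. bnorm p \<alpha> f \<le> ennreal B0" using bd by (auto simp: bbounded_def)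
  then have B: "\<And>f. f \<in> K \<Longrightarrow> bnorm p \<alpha> f \<le> ennreal (max 0 B0)"
    by (meson ennreal_leI max.cobounded2 order_trans)
  define B where "B = max 0 B0"
  have B0: "B \<ge> 0" by (simp add: B_def)
  \<comment> \<open>The final bound is \<open>4 * C * (2 * (\<delta> * R * B + 2 * \<epsilon>'))\<close>, and \<open>\<delta>\<close> makes \<open>\<delta> * R * B\<close> at most \<open>\<epsilon>'\<close>.\<close>
  define \<epsilon>' where "\<epsilon>' = \<epsilon> / (64 * (C + 1))"
  have e': "\<epsilon>' > 0" using e C by (simp add: \<epsilon>'_def)
  obtain R where R: "R > 0" "\<And>f. f \<in> K \<Longrightarrow> bnorm p \<alpha> (\<lambda>x. indicator {R..} x * f x) < ennreal \<epsilon>'"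
    using PA e' unfolding P_A_def by blast
  define \<delta> where "\<delta> = \<epsilon>' / (R * (B + 1))"
  have \<delta>: "\<delta> > 0" using e' R B0 by (simp add: \<delta>_def)
  show "\<exists>\<delta>>0. \<forall>h\<in>{0..\<delta>}. \<forall>g\<in>hankel p p' \<alpha> ` K. \<forall>t\<in>{0..M0}.
      bnorm p' \<alpha> (\<lambda>s. bessel_translation \<alpha> (t + h) g s - bessel_translation \<alpha> t g s) < ennreal \<epsilon>"
  proof (intro exI[of _ \<delta>] conjI ballI \<delta>)
    fix h g t assume h: "h \<in> {0..\<delta>}" and "g \<in> hankel p p' \<alpha> ` K" and t: "t \<in> {0..M0}"
    then obtain f where fK: "f \<in> K" and g: "g = hankel p p' \<alpha> f" by auto
    have f: "f \<in> bspace p \<alpha>" using fK K by auto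
    note fm = bspace_measurable[OF f]
    have gt: "is_hankel_transform p p' \<alpha> f g" unfolding g by (rule is_hankel_transform_hankel[OF a p f])
    let ?J = "\<lambda>x. complex_of_real (poisson_j \<alpha> (x * (t + h)) - poisson_j \<alpha> (x * t))"
    have Jm: "?J \<in> borel_measurable (bessel_measure \<alpha>)"
      using borel_measurable_diff[OF measurable_poisson_j_dilate[OF a] measurable_poisson_j_dilate[OF a]] by simp
    have i: "(indicator A :: real \<Rightarrow> complex) \<in> borel_measurable (bessel_measure \<alpha>)" if "A \<in> sets borel" for A
      using that by (intro borel_measurable_bessel_measure_if_borel) simp
    have J1: "norm (?J x) \<le> h * \<bar>x\<bar>" for x
      using poisson_j_lipschitz[OF a, of "x * (t + h)" "x * t"] h
      unfolding norm_of_real by (simp add: distrib_left abs_mult mult.commute)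
    have J2: "norm (?J x) \<le> 2" for x
      using abs_poisson_j_le_1[OF a, of "x * (t + h)"] abs_poisson_j_le_1[OF a, of "x * t"]
      unfolding norm_of_real by linarith
    have J: "bnorm p \<alpha> (\<lambda>x. ?J x * f x) \<le> ennreal (2 * (\<delta> * R * B + 2 * \<epsilon>'))"
    proof -
      have "bnorm p \<alpha> (\<lambda>x. ?J x * f x) =
          bnorm p \<alpha> (\<lambda>x. ?J x * (indicator {..<R} x * f x) + ?J x * (indicator {R..} x * f x))"
        by (intro arg_cong[where f = "bnorm p \<alpha>"] ext) (auto simp: indicator_def)
      also have "\<dots> \<le> 2 * (bnorm p \<alpha> (\<lambda>x. ?J x * (indicator {..<R} x * f x)) + bnorm p \<alpha> (\<lambda>x. ?J x * (indicator {R..} x * f x)))"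
        by (intro bnorm_add_le p borel_measurable_times Jm i fm) auto
      also have "\<dots> \<le> 2 * (ennreal (\<delta> * R) * ennreal B + ennreal 2 * ennreal \<epsilon>')"
      proof (intro mult_left_mono add_mono)
        have "bnorm p \<alpha> (\<lambda>x. ?J x * (indicator {..<R} x * f x)) \<le> ennreal (\<delta> * R) * bnorm p \<alpha> f"
        proof (rule bnorm_le_cmult[OF p(1)])
          show "AE x in bessel_measure \<alpha>. norm (?J x * (indicator {..<R} x * f x)) \<le> \<delta> * R * norm (f x)"
            unfolding AE_bessel_measure
          proof (rule eventually_mono[OF AE_radial_measure_pos])
            fix x :: real assume x: "0 < x"
            show "norm (?J x * (indicator {..<R} x * f x)) \<le> \<delta> * R * norm (f x)"
            proof (cases "x < R")
              case True
              have "h * \<bar>x\<bar> \<le> \<delta> * R" using h x True \<delta> by (intro mult_mono) auto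
              then have "norm (?J x) \<le> \<delta> * R" using J1[of x] by (rule order_trans[rotated])
              then show ?thesis using True by (simp only: norm_mult) (simp add: mult_right_mono)
            qed (use \<delta> R in simp)
          qed
        qed (use \<delta> R Jm fm in \<open>auto intro!: borel_measurable_times i\<close>)
        also have "\<dots> \<le> ennreal (\<delta> * R) * ennreal B"
          using B[OF fK] unfolding B_def by (intro mult_left_mono) auto
        finally show "bnorm p \<alpha> (\<lambda>x. ?J x * (indicator {..<R} x * f x)) \<le> ennreal (\<delta> * R) * ennreal B" .
        have "bnorm p \<alpha> (\<lambda>x. ?J x * (indicator {R..} x * f x)) \<le> ennreal 2 * bnorm p \<alpha> (\<lambda>x. indicator {R..} x * f x)"
        proof (rule bnorm_le_cmult[OF p(1)])
          show "AE x in bessel_measure \<alpha>. norm (?J x * (indicator {R..} x * f x)) \<le> 2 * norm (indicator {R..} x * f x)"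
            unfolding norm_mult[of "?J _"] by (intro AE_I2 mult_right_mono J2) auto
        qed (use Jm fm in \<open>auto intro!: borel_measurable_times i\<close>)
        also have "\<dots> \<le> ennreal 2 * ennreal \<epsilon>'" using R(2)[OF fK] by (intro mult_left_mono) auto
        finally show "bnorm p \<alpha> (\<lambda>x. ?J x * (indicator {R..} x * f x)) \<le> ennreal 2 * ennreal \<epsilon>'" .
      qed auto
      also have "\<dots> = ennreal (2 * (\<delta> * R * B + 2 * \<epsilon>'))"
        using \<delta> R B0 e' by (simp add: ennreal_mult ennreal_plus)
      finally show ?thesis .
    qed
    have "bnorm p' \<alpha> (\<lambda>s. bessel_translation \<alpha> (t + h) g s - bessel_translation \<alpha> t g s) \<le>
        ennreal (4 * C) * bnorm p \<alpha> (\<lambda>x. ?J x * f x)"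
      using t h by (intro bnorm_translation_difference_of_hankel[OF a p(1) pt p'1 C hy f gt]) auto
    also have "\<dots> \<le> ennreal (4 * C) * ennreal (2 * (\<delta> * R * B + 2 * \<epsilon>'))"
      by (rule mult_left_mono[OF J]) simp
    also have "\<dots> = ennreal (4 * C * (2 * (\<delta> * R * B + 2 * \<epsilon>')))"
      using C \<delta> R B0 e' by (intro ennreal_mult[symmetric]) auto
    also have "\<dots> < ennreal \<epsilon>"
    proof (rule ennreal_lessI[OF e])
      have "\<delta> * R * B = \<epsilon>' * (B / (B + 1))" using R by (simp add: \<delta>_def)
      also have "\<dots> \<le> \<epsilon>' * 1" using e' B0 by (intro mult_left_mono) auto
      finally have "\<delta> * R * B + 2 * \<epsilon>' \<le> 3 * \<epsilon>'" by simp
      then have "4 * C * (2 * (\<delta> * R * B + 2 * \<epsilon>')) \<le> 4 * C * (2 * (3 * \<epsilon>'))"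
        using C by (intro mult_left_mono) auto
      also have "4 * C * (2 * (3 * (\<epsilon> / (64 * D)))) = 24 / 64 * \<epsilon> * (C / D)" for D by simp
      then have "4 * C * (2 * (3 * \<epsilon>')) = 24 / 64 * \<epsilon> * (C / (C + 1))" by (simp only: \<epsilon>'_def)
      also have "\<dots> \<le> 24 / 64 * \<epsilon> * 1" using C e by (intro mult_left_mono) auto
      also have "\<dots> < \<epsilon>" using e by simp
      finally show "4 * C * (2 * (\<delta> * R * B + 2 * \<epsilon>')) < \<epsilon>" .
    qed
    finally show "bnorm p' \<alpha> (\<lambda>s. bessel_translation \<alpha> (t + h) g s - bessel_translation \<alpha> t g s) < ennreal \<epsilon>" .
  qed
qed

lemma P_B_imp_P_A_hankel:
  assumes a: "\<alpha> \<ge> - 1 / 2" and p: "1 \<le> p" "p \<le> 2" "1 / p + 1 / p' = 1" and K: "K \<subseteq> bspace p \<alpha>"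
    and PB: "P_B p \<alpha> K"
  shows "P_A p' \<alpha> (hankel p p' \<alpha> ` K)"
  unfolding P_A_def
proof (intro allI impI)
  fix \<epsilon> :: real assume e: "\<epsilon> > 0"
  note p'1 = conjugate_exponent_ge_1[OF p]
  have pt: "p \<noteq> top" using p(2) by (auto simp: top_unique)
  obtain C where C: "C \<ge> 0"
    and hy: "\<And>f. f \<in> bspace 1 \<alpha> \<Longrightarrow> f \<in> bspace p \<alpha> \<Longrightarrow> bnorm p' \<alpha> (hankel_integral \<alpha> f) \<le> ennreal C * bnorm p \<alpha> f"
    using hausdorff_young[OF a p] by blast
  \<comment> \<open>The final bound is \<open>16 * (\<alpha> + 1) * (4 * C * \<epsilon>')\<close>.\<close>
  define \<epsilon>' where "\<epsilon>' = \<epsilon> / (128 * (\<alpha> + 1) * (C + 1))"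
  have e': "\<epsilon>' > 0" using e C a by (simp add: \<epsilon>'_def)
  obtain \<delta> where \<delta>: "\<delta> > 0" "\<And>h f t. h \<in> {0..\<delta>} \<Longrightarrow> f \<in> K \<Longrightarrow> t \<in> {0..1} \<Longrightarrow>
      bnorm p \<alpha> (\<lambda>s. bessel_translation \<alpha> (t + h) f s - bessel_translation \<alpha> t f s) < ennreal \<epsilon>'"
    using PB e' unfolding P_B_def by (meson zero_less_one)
  show "\<exists>R>0. \<forall>g\<in>hankel p p' \<alpha> ` K. bnorm p' \<alpha> (\<lambda>x. indicator {R..} x * g x) < ennreal \<epsilon>"
  proof (intro exI[of _ "1 / \<delta>"] conjI ballI)
    fix g assume "g \<in> hankel p p' \<alpha> ` K"
    then obtain f where fK: "f \<in> K" and g: "g = hankel p p' \<alpha> f" by auto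
    have f: "f \<in> bspace p \<alpha>" using fK K by auto
    note fm = bspace_measurable[OF f]
    have gt: "is_hankel_transform p p' \<alpha> f g" unfolding g by (rule is_hankel_transform_hankel[OF a p f])
    then have gm: "g \<in> borel_measurable (bessel_measure \<alpha>)"
      by (auto simp: is_hankel_transform_def dest: bspace_measurable)
    have "bnorm p' \<alpha> (\<lambda>y. indicator {1 / \<delta>..} y * g y) \<le> ennreal (16 * (\<alpha> + 1) * (4 * C * \<epsilon>'))"
    proof (rule bnorm_tail_le[OF a p'1 _ gm \<delta>(1)])
      fix h assume h: "h \<in> {0..\<delta>}"
      then have h0: "h \<ge> 0" by simp
      note Tm = measurable_bessel_translation[OF a _ fm]
      have "bnorm p \<alpha> (\<lambda>s. f s - bessel_translation \<alpha> h f s) =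
          bnorm p \<alpha> (\<lambda>s. bessel_translation \<alpha> h f s - f s)"
        by (intro bnorm_minus_commute p Tm[OF h0] fm)
      also have "\<dots> = bnorm p \<alpha> (\<lambda>s. bessel_translation \<alpha> (0 + h) f s - bessel_translation \<alpha> 0 f s)"
        using bessel_translation_0[OF a fm] h0
        by (intro bnorm_cong p borel_measurable_diff Tm fm) (auto elim: eventually_mono)
      also have "\<dots> \<le> ennreal \<epsilon>'" using \<delta>(2)[OF h fK, of 0] by simp
      finally have l: "bnorm p \<alpha> (\<lambda>s. f s - bessel_translation \<alpha> h f s) \<le> ennreal \<epsilon>'" .
      have "bnorm p' \<alpha> (\<lambda>y. of_real (1 - poisson_j \<alpha> (h * y)) * g y) \<le>
          ennreal (4 * C) * bnorm p \<alpha> (\<lambda>s. f s - bessel_translation \<alpha> h f s)"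
        by (rule bnorm_hankel_multiplier[OF a p(1) pt p'1 C hy f gt h0])
      also have "\<dots> \<le> ennreal (4 * C) * ennreal \<epsilon>'" by (rule mult_left_mono[OF l]) simp
      also have "\<dots> = ennreal (4 * C * \<epsilon>')" using C e' by (intro ennreal_mult[symmetric]) auto
      finally show "bnorm p' \<alpha> (\<lambda>y. of_real (1 - poisson_j \<alpha> (h * y)) * g y) \<le> ennreal (4 * C * \<epsilon>')" .
    qed (use C e' in auto)
    also have "\<dots> < ennreal \<epsilon>"
    proof (rule ennreal_lessI[OF e])
      have "16 * x * (4 * C * (\<epsilon> / (128 * x * D))) = 1 / 2 * \<epsilon> * (C / D) * (x / x)" for x D
        by simp
      then have "16 * (\<alpha> + 1) * (4 * C * \<epsilon>') = 1 / 2 * \<epsilon> * (C / (C + 1)) * ((\<alpha> + 1) / (\<alpha> + 1))"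
        by (simp only: \<epsilon>'_def)
      also have "\<dots> = 1 / 2 * \<epsilon> * (C / (C + 1))" using a by simp
      also have "\<dots> \<le> 1 / 2 * \<epsilon> * 1" using C e by (intro mult_left_mono) auto
      also have "\<dots> < \<epsilon>" using e by simp
      finally show "16 * (\<alpha> + 1) * (4 * C * \<epsilon>') < \<epsilon>" .
    qed
    finally show "bnorm p' \<alpha> (\<lambda>x. indicator {1 / \<delta>..} x * g x) < ennreal \<epsilon>" .
  qed (use \<delta> in simp)
qed

theorem theorem4:
  fixes \<alpha> :: real and p p' :: ennreal and K :: "(real \<Rightarrow> complex) set"
  assumes "\<alpha> \<ge> - 1 / 2"
    and "1 \<le> p" and "p \<le> 2"
    and "1 / p + 1 / p' = 1"
    and "K \<subseteq> bspace p \<alpha>"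
  shows "hankel p p' \<alpha> ` K \<subseteq> bspace p' \<alpha>
    \<and> (bbounded p \<alpha> K \<and> P_A p \<alpha> K \<longrightarrow> P_B p' \<alpha> (hankel p p' \<alpha> ` K))
    \<and> (P_B p \<alpha> K \<longrightarrow> P_A p' \<alpha> (hankel p p' \<alpha> ` K))"
proof (intro conjI impI)
  show "hankel p p' \<alpha> ` K \<subseteq> bspace p' \<alpha>"
    using is_hankel_transform_hankel[OF assms(1-4)] assms(5) by (auto simp: is_hankel_transform_def)
  show "P_B p' \<alpha> (hankel p p' \<alpha> ` K)" if "bbounded p \<alpha> K \<and> P_A p \<alpha> K"
    using P_A_imp_P_B_hankel[OF assms] that by blast
  show "P_A p' \<alpha> (hankel p p' \<alpha> ` K)" if "P_B p \<alpha> K"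
    by (rule P_B_imp_P_A_hankel[OF assms that])
qed

end
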